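(* Let $Y\subset X\subset W^{1,4}(\mathbb{T}^3)$ be Sobolev spaces and let $\gamma=1/2$. Given $\kappa,\mu,\Omega>0$, fix an integer $m\ge1$. Let $a>0$ be sufficiently large such that $$\kappa<\frac{a\mu m}{2^5\Omega^2m^2+2\mu^2},$$ and let $\Theta_0^{(1)}=a\sin(mx_3)\in Y$, which is a steady state of $$\partial_t\Theta+U\cdot\nabla\Theta=S-\kappa(-\Delta)^{1/2}\Theta,\qquad \nabla\cdot U=0,\quad U_j=M_j\Theta\ (j=1,2,3),\qquad S=\kappa a m\sin(mx_3).$$ Then, given any $T>0$ and any $K>0$, there exist an initial condition $\Theta_0^{(2)}\in Y$ and a corresponding solution $\Theta^{(2)}\in L^\infty(0,T;X)$ of the Cauchy problem for this equation (with the same $S$) such that $$\sup_{t\in[0,T]}\|\Theta^{(2)}(t,\cdot)-\Theta^{(1)}(t,\cdot)\|_X\ge2K\,\|\Theta_0^{(2)}-\Theta_0^{(1)}\|_Y,$$ where $\Theta^{(1)}(t,\cdot)=\Theta_0^{(1)}$. That is, the equations are locally Lipschitz $(X,Y)$ ill-posed when the data is large.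
   Context: Setting. $\mathbb{T}^3=(\mathbb{R}/2\pi\mathbb{Z})^3$; $\hat f(k)$, $k=(k_1,k_2,k_3)\in\mathbb{Z}^3$, are Fourier coefficients. $\mu=\beta^2/\eta$, where $\Omega,\beta,\eta,\kappa>0$ are fixed physical parameters. The operators $M_j$ are Fourier multipliers, $\widehat{M_j\Theta}(k)=\hat M_j(k)\hat\Theta(k)$, where for $k_3\neq0$ $$\hat M_1(k)=\frac{2\Omega k_2k_3|k|^2-\mu k_1k_2^2k_3}{4\Omega^2k_3^2|k|^2+\mu^2k_2^4},\quad \hat M_2(k)=\frac{-2\Omega k_1k_3|k|^2-\mu k_2^3k_3}{4\Omega^2k_3^2|k|^2+\mu^2k_2^4},\quad \hat M_3(k)=\frac{\mu k_2^2(k_1^2+k_2^2)}{4\Omega^2k_3^2|k|^2+\mu^2k_2^4},$$ and $\hat M_j(k)=0$ when $k_3=0$ (so $U$ has zero vertical mean). Solutions are understood in the weak sense: for all smooth $\varphi$ on $\mathbb{T}^3$ and all $t\in(0,T)$, $\int(\Theta(t,\cdot)-\Theta(0,\cdot))\varphi\,dx+\kappa\int_0^t\int\Theta(-\Delta)^{1/2}\varphi\,dx\,d\tau-\int_0^t\int\Theta\,U\cdot\nabla\varphi\,dx\,d\tau=\int_0^t\int S\varphi\,dx\,d\tau$. Definition (Lipschitz local well-posedness). The Cauchy problem is locally Lipschitz $(X,Y)$ well-posed if there exist continuous functions $T,K:[0,\infty)^2\to(0,\infty)$ such that for every pair of initial data $\Theta^{(1)}(0,\cdot),\Theta^{(2)}(0,\cdot)\in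 Y$ there exist unique solutions $\Theta^{(1)},\Theta^{(2)}\in L^\infty(0,T;X)$ which satisfy $\|\Theta^{(1)}(t,\cdot)-\Theta^{(2)}(t,\cdot)\|_X\le K\|\Theta^{(1)}(0,\cdot)-\Theta^{(2)}(0,\cdot)\|_Y$ for every $t\in[0,T]$, with $T$ and $K$ evaluated at $(\|\Theta^{(1)}(0,\cdot)\|_Y,\|\Theta^{(2)}(0,\cdot)\|_Y)$. Ill-posed means not well-posed. *)

theory Defs
  imports "HOL-Analysis.Analysis"
begin

section \<open>Functions on the torus\<close>

text \<open>Functions on \<open>(\<real>/2\<pi>\<int>)\<^sup>3\<close> are functions on \<open>\<real>\<^sup>3\<close> that are \<open>2\<pi>\<close>-periodic in each
  variable; integrals are taken over one period cell, on which \<open>torus\<close> is Lebesgue measure.\<close>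

definition periodic :: "(real^3 \<Rightarrow> real) \<Rightarrow> bool" where
  "periodic f \<longleftrightarrow> (\<forall>x i. f (x + axis i (2 * pi)) = f x)"

definition torus :: "(real^3) measure" where
  "torus = lebesgue_on (cbox 0 (\<chi> i. 2 * pi))"

definition freq :: "int^3 \<Rightarrow> real^3" where
  "freq k = (\<chi> i. real_of_int (k $ i))"

definition fourier_coeff :: "(real^3 \<Rightarrow> real) \<Rightarrow> int^3 \<Rightarrow> complex" where
  "fourier_coeff f k =
     (LINT x|torus. complex_of_real (f x) * cis (- (freq k \<bullet> x))) / complex_of_real ((2 * pi) ^ 3)"

definition partial :: "3 \<Rightarrow> (real^3 \<Rightarrow> real) \<Rightarrow> real^3 \<Rightarrow> real" where
  "partial i f x = frechet_derivative f (at x) (axis i 1)"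

primrec C_order :: "nat \<Rightarrow> (real^3 \<Rightarrow> real) \<Rightarrow> bool" where
  "C_order 0 f \<longleftrightarrow> continuous_on UNIV f"
| "C_order (Suc n) f \<longleftrightarrow> (\<forall>x. f differentiable (at x)) \<and> (\<forall>i. C_order n (partial i f))"

definition test_function :: "(real^3 \<Rightarrow> real) \<Rightarrow> bool" where
  "test_function f \<longleftrightarrow> periodic f \<and> (\<forall>n. C_order n f)"

section \<open>Lebesgue and Sobolev spaces\<close>

text \<open>Elements are functions rather than classes modulo almost everywhere equality; all
  norms below depend on the class only.\<close>

definition Lp :: "ennreal \<Rightarrow> (real^3 \<Rightarrow> real) set" where
  "Lp p = {f. periodic f \<and> f \<in> borel_measurable lebesgue \<and>
     (if p = \<infinity> then \<exists>C. AE x in torus. \<bar>f x\<bar> \<le> C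
      else integrable torus (\<lambda>x. \<bar>f x\<bar> powr enn2real p))}"

definition Lp_norm :: "ennreal \<Rightarrow> (real^3 \<Rightarrow> real) \<Rightarrow> real" where
  "Lp_norm p f =
     (if p = \<infinity> then Inf {C. 0 \<le> C \<and> (AE x in torus. \<bar>f x\<bar> \<le> C)}
      else (LINT x|torus. \<bar>f x\<bar> powr enn2real p) powr (1 / enn2real p))"

text \<open>The relation \<open>fourier_multiplier m f g\<close> says that \<open>g\<close> is (a representative of) the image of
  \<open>f\<close> under the multiplier with symbol \<open>m\<close>, and that this image is square integrable.\<close>

definition fourier_multiplier ::
    "(int^3 \<Rightarrow> real) \<Rightarrow> (real^3 \<Rightarrow> real) \<Rightarrow> (real^3 \<Rightarrow> real) \<Rightarrow> bool" where
  "fourier_multiplier m f g \<longleftrightarrow>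
     g \<in> Lp 2 \<and> (\<forall>k. fourier_coeff g k = complex_of_real (m k) * fourier_coeff f k)"

definition multi_order :: "nat^3 \<Rightarrow> nat" where
  "multi_order \<alpha> = (\<Sum>i\<in>UNIV. \<alpha> $ i)"

definition multi_partial :: "nat^3 \<Rightarrow> (real^3 \<Rightarrow> real) \<Rightarrow> real^3 \<Rightarrow> real" where
  "multi_partial \<alpha> f =
     (partial 1 ^^ (\<alpha> $ 1)) ((partial 2 ^^ (\<alpha> $ 2)) ((partial 3 ^^ (\<alpha> $ 3)) f))"

definition is_weak_deriv ::
    "ennreal \<Rightarrow> nat^3 \<Rightarrow> (real^3 \<Rightarrow> real) \<Rightarrow> (real^3 \<Rightarrow> real) \<Rightarrow> bool" where
  "is_weak_deriv p \<alpha> f g \<longleftrightarrow> g \<in> Lp p \<and>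
     (\<forall>\<phi>. test_function \<phi> \<longrightarrow>
        (LINT x|torus. f x * multi_partial \<alpha> \<phi> x)
          = (- 1) ^ multi_order \<alpha> * (LINT x|torus. g x * \<phi> x))"

definition is_bessel ::
    "ennreal \<Rightarrow> real \<Rightarrow> (real^3 \<Rightarrow> real) \<Rightarrow> (real^3 \<Rightarrow> real) \<Rightarrow> bool" where
  "is_bessel p s f g \<longleftrightarrow> g \<in> Lp p \<and>
     (\<forall>k. fourier_coeff g k
        = complex_of_real ((1 + (norm (freq k))\<^sup>2) powr (s / 2)) * fourier_coeff f k)"

text \<open>A Sobolev space is either \<open>W\<^bsup>k,p\<^esup>\<close> with integer \<open>k\<close> and \<open>1 \<le> p \<le> \<infinity>\<close>, defined through weak
  derivatives, or the Bessel potential space \<open>H\<^bsup>s,p\<^esup>\<close> with real \<open>s \<ge> 0\<close> and \<open>1 < p < \<infinity>\<close> (so that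
  \<open>H\<^bsup>s,2\<^esup>\<close> is \<open>H\<^sup>s\<close>).\<close>

datatype sobolev_index = Wkp nat ennreal | Hsp real ennreal

primrec admissible :: "sobolev_index \<Rightarrow> bool" where
  "admissible (Wkp k p) \<longleftrightarrow> 1 \<le> p"
| "admissible (Hsp s p) \<longleftrightarrow> 0 \<le> s \<and> 1 < p \<and> p < \<infinity>"

primrec sobolev :: "sobolev_index \<Rightarrow> (real^3 \<Rightarrow> real) set" where
  "sobolev (Wkp k p) =
     {f \<in> Lp p. \<forall>\<alpha>. multi_order \<alpha> \<le> k \<longrightarrow> (\<exists>g. is_weak_deriv p \<alpha> f g)}"
| "sobolev (Hsp s p) = {f \<in> Lp p. \<exists>g. is_bessel p s f g}"

text \<open>Weak derivatives and Bessel potentials are unique up to null sets, so the choice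
  made by \<open>SOME\<close> does not affect the norm.\<close>

primrec sobolev_norm :: "sobolev_index \<Rightarrow> (real^3 \<Rightarrow> real) \<Rightarrow> real" where
  "sobolev_norm (Wkp k p) f =
     (if p = \<infinity>
      then Max ((\<lambda>\<alpha>. Lp_norm p (SOME g. is_weak_deriv p \<alpha> f g)) ` {\<alpha>. multi_order \<alpha> \<le> k})
      else (\<Sum>\<alpha> | multi_order \<alpha> \<le> k.
              Lp_norm p (SOME g. is_weak_deriv p \<alpha> f g) powr enn2real p) powr (1 / enn2real p))"
| "sobolev_norm (Hsp s p) f = Lp_norm p (SOME g. is_bessel p s f g)"

text \<open>The Bochner space \<open>L\<^sup>\<infinity>(0,T;X)\<close>: \<open>s n\<close> are simple \<open>X\<close>-valued functions of time
  witnessing strong measurability.\<close>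

definition Linf_time :: "real \<Rightarrow> sobolev_index \<Rightarrow> (real \<Rightarrow> real^3 \<Rightarrow> real) set" where
  "Linf_time T X = {\<Theta>.
     (\<exists>s :: nat \<Rightarrow> real \<Rightarrow> real^3 \<Rightarrow> real.
        (\<forall>n. finite (s n ` {0..T}) \<and> s n ` {0..T} \<subseteq> sobolev X \<and>
             (\<forall>f. {t \<in> {0..T}. s n t = f} \<in> sets lebesgue)) \<and>
        (AE t in lebesgue_on {0..T}. \<Theta> t \<in> sobolev X \<and>
             (\<lambda>n. sobolev_norm X (\<lambda>x. s n t x - \<Theta> t x)) \<longlonglongrightarrow> 0)) \<and>
     (\<exists>C. AE t in lebesgue_on {0..T}. sobolev_norm X (\<Theta> t) \<le> C)}"

section \<open>The equation\<close>

definition M_symbol :: "real \<Rightarrow> real \<Rightarrow> 3 \<Rightarrow> int^3 \<Rightarrow> real" where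
  "M_symbol \<Omega> \<mu> j k =
     (let k1 = freq k $ 1; k2 = freq k $ 2; k3 = freq k $ 3; N = norm (freq k);
          D = 4 * \<Omega>\<^sup>2 * k3\<^sup>2 * N\<^sup>2 + \<mu>\<^sup>2 * k2 ^ 4
      in if k3 = 0 then 0
         else if j = 1 then (2 * \<Omega> * k2 * k3 * N\<^sup>2 - \<mu> * k1 * k2\<^sup>2 * k3) / D
         else if j = 2 then (- 2 * \<Omega> * k1 * k3 * N\<^sup>2 - \<mu> * k2 ^ 3 * k3) / D
         else \<mu> * k2\<^sup>2 * (k1\<^sup>2 + k2\<^sup>2) / D)"

text \<open>The constraint \<open>\<nabla> \<cdot> U = 0\<close> is built into the symbols.\<close>

lemma M_symbol_divergence_free: "(\<Sum>j\<in>UNIV. freq k $ j * M_symbol \<Omega> \<mu> j k) = 0"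
proof (cases "freq k $ 3 = 0")
  case True
  then show ?thesis by (simp add: M_symbol_def)
next
  case False
  then show ?thesis
    by (simp add: sum_3 M_symbol_def Let_def add_divide_distrib[symmetric] divide_simps)
       (simp add: algebra_simps power2_eq_square power3_eq_cube power4_eq_xxxx)
qed

text \<open>Weak solutions on \<open>[0,T]\<close> in \<open>L\<^sup>\<infinity>(0,T;X)\<close> with initial datum \<open>f\<close> and time-independent source
  \<open>S\<close>. In the weak formulation \<open>\<psi>\<close> is \<open>(-\<Delta>)\<^bsup>1/2\<^esup>\<phi>\<close>, which exists for every test function and is
  unique up to null sets, as is the velocity \<open>U\<close>. Since the identity for \<open>0 < t < T\<close> makes \<open>\<Theta>\<close>
  weakly continuous in time, imposing it at \<open>t = T\<close> as well (and \<open>\<Theta> t \<in> X\<close> for every \<open>t\<close>)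
  only fixes the representative of \<open>\<Theta>\<close>; this gives \<open>\<Theta> t\<close> a meaning at each single \<open>t \<in> [0,T]\<close>.\<close>

definition weak_solution ::
    "real \<Rightarrow> real \<Rightarrow> real \<Rightarrow> (real^3 \<Rightarrow> real) \<Rightarrow> sobolev_index \<Rightarrow> real \<Rightarrow>
     (real^3 \<Rightarrow> real) \<Rightarrow> (real \<Rightarrow> real^3 \<Rightarrow> real) \<Rightarrow> bool" where
  "weak_solution \<kappa> \<mu> \<Omega> S X T f \<Theta> \<longleftrightarrow>
     \<Theta> \<in> Linf_time T X \<and> (\<forall>t\<in>{0..T}. \<Theta> t \<in> sobolev X) \<and> (AE x in torus. \<Theta> 0 x = f x) \<and>
     (\<exists>U :: 3 \<Rightarrow> real \<Rightarrow> real^3 \<Rightarrow> real.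
        (\<forall>j. \<forall>t\<in>{0..T}. fourier_multiplier (M_symbol \<Omega> \<mu> j) (\<Theta> t) (U j t)) \<and>
        (\<forall>\<phi> \<psi>. test_function \<phi> \<and> fourier_multiplier (\<lambda>k. norm (freq k)) \<phi> \<psi> \<longrightarrow>
          (\<forall>t\<in>{0..T}.
             (LINT x|torus. (\<Theta> t x - \<Theta> 0 x) * \<phi> x)
             + \<kappa> * (LINT \<tau>:{0..t}|lebesgue. (LINT x|torus. \<Theta> \<tau> x * \<psi> x))
             - (LINT \<tau>:{0..t}|lebesgue.
                  (LINT x|torus. \<Theta> \<tau> x * (\<Sum>j\<in>UNIV. U j \<tau> x * partial j \<phi> x)))
             = (LINT \<tau>:{0..t}|lebesgue. (LINT x|torus. S x * \<phi> x)))))"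

definition unique_weak_solution ::
    "real \<Rightarrow> real \<Rightarrow> real \<Rightarrow> (real^3 \<Rightarrow> real) \<Rightarrow> sobolev_index \<Rightarrow> real \<Rightarrow>
     (real^3 \<Rightarrow> real) \<Rightarrow> (real \<Rightarrow> real^3 \<Rightarrow> real) \<Rightarrow> bool" where
  "unique_weak_solution \<kappa> \<mu> \<Omega> S X T f \<Theta> \<longleftrightarrow>
     weak_solution \<kappa> \<mu> \<Omega> S X T f \<Theta> \<and>
     (\<forall>\<Psi>. weak_solution \<kappa> \<mu> \<Omega> S X T f \<Psi> \<longrightarrow>
        (\<forall>t\<in>{0..T}. AE x in torus. \<Psi> t x = \<Theta> t x))"

definition locally_Lipschitz_well_posed ::
    "real \<Rightarrow> real \<Rightarrow> real \<Rightarrow> (real^3 \<Rightarrow> real) \<Rightarrow> sobolev_index \<Rightarrow> sobolev_index \<Rightarrow> bool" where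
  "locally_Lipschitz_well_posed \<kappa> \<mu> \<Omega> S X Y \<longleftrightarrow>
     (\<exists>T K :: real \<times> real \<Rightarrow> real.
        continuous_on ({0..} \<times> {0..}) T \<and> continuous_on ({0..} \<times> {0..}) K \<and>
        (\<forall>r\<in>{0..} \<times> {0..}. 0 < T r \<and> 0 < K r) \<and>
        (\<forall>f1\<in>sobolev Y. \<forall>f2\<in>sobolev Y.
           let r = (sobolev_norm Y f1, sobolev_norm Y f2) in
           \<exists>\<Theta>1 \<Theta>2.
             unique_weak_solution \<kappa> \<mu> \<Omega> S X (T r) f1 \<Theta>1 \<and>
             unique_weak_solution \<kappa> \<mu> \<Omega> S X (T r) f2 \<Theta>2 \<and>
             (\<forall>t\<in>{0..T r}. sobolev_norm X (\<lambda>x. \<Theta>1 t x - \<Theta>2 t x)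
                             \<le> K r * sobolev_norm Y (\<lambda>x. f1 x - f2 x))))"

abbreviation locally_Lipschitz_ill_posed ::
    "real \<Rightarrow> real \<Rightarrow> real \<Rightarrow> (real^3 \<Rightarrow> real) \<Rightarrow> sobolev_index \<Rightarrow> sobolev_index \<Rightarrow> bool" where
  "locally_Lipschitz_ill_posed \<kappa> \<mu> \<Omega> S X Y \<equiv> \<not> locally_Lipschitz_well_posed \<kappa> \<mu> \<Omega> S X Y"

end

theory Submission
  imports Defs "HOL-Real_Asymp.Real_Asymp"
begin

text \<open>Write a solution as \<open>\<Theta>01 + \<theta>\<close> with \<open>\<theta> = \<Sum>\<^sub>k b\<^sub>k sin (k \<bullet> x)\<close> and \<open>b\<close> real and odd. Then
  \<open>b\<^sub>k' = - \<kappa> |k| b\<^sub>k - (a m / 2) (M\<^sub>3(k - m e\<^sub>3) b\<^bsub>k - m e\<^sub>3\<^esub> + M\<^sub>3(k + m e\<^sub>3) b\<^bsub>k + m e\<^sub>3\<^esub>) - \<Sum>\<^sub>p (M(p) \<bullet> (k - p)) b\<^sub>p b\<^bsub>k - p\<^esub>\<close>.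
  Since \<open>|M\<^sub>j(k)| \<le> (|k\<^sub>1| + |k\<^sub>2|) / \<Omega>\<close>, the linear coupling loses one horizontal derivative, but it leaves
  the horizontal frequency unchanged. In the weighted supremum norm with weight
  \<open>(1 + |k|)\<^sup>r exp (\<lambda> (T - t) (|k\<^sub>1| + |k\<^sub>2|))\<close> and large \<open>\<lambda>\<close> it is therefore a contraction, and the
  dissipation recovers the derivative lost in the quadratic term. Hence small analytic data have a
  solution on any prescribed interval \<open>[0,T]\<close>, although the problem is ill-posed.

  On the frequencies \<open>(l\<^sup>2, l, j m)\<close> the linear system becomes cooperative after the sign change
  \<open>(-1)\<^sup>j\<close>, and the modes \<open>j = 1, 2\<close> grow like \<open>exp (g t)\<close> with
  \<open>g \<sim> l\<^sup>2 (a \<mu> m / (32 \<Omega>\<^sup>2 m\<^sup>2 + 2 \<mu>\<^sup>2) - \<kappa>)\<close>, up to an error quadratic in the size of the data.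
  This beats the power of \<open>l\<close> by which the \<open>Y\<close>-norm of the data exceeds their Fourier coefficients,
  and Fourier coefficients bound the \<open>X\<close>-norm from below. For the ill-posedness, the
  continuous functions \<open>T\<close> and \<open>K\<close> are bounded above and below on a compact set of pairs of norms that
  is chosen before \<open>l\<close>.\<close>

section \<open>Integration by parts on the torus\<close>

text \<open>With order-one dissipation the linear coupling and the damping have the same strength,
  so the size of \<open>a\<close> decides. For \<open>k1 = l^2\<close>, \<open>k2 = l\<close> and
  fixed \<open>k3\<close> both terms of the denominator of \<open>M_symbol \<Omega> \<mu> 3\<close>
  have order \<open>l^4\<close> and the numerator has order \<open>l^6\<close>; the symbol behaves
  like \<open>l^2 * \<mu> / (4 * \<Omega>^2 * k3^2 + \<mu>^2)\<close> and \<open>|k|\<close> like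
  \<open>l^2\<close>. The coupling joins neighbours \<open>j\<close> and \<open>j + 1\<close> and
  the symbol vanishes at \<open>j = 0\<close>, so the first pair whose members feed each other is
  \<open>j = 1, 2\<close>; the smaller symbol, at \<open>k3 = 2 * m\<close>, times
  \<open>a * m / 2\<close> gives the threshold of the theorem. The obstacle is to have solutions at
  all. Data with finitely many modes are analytic with any radius, so a radius proportional to
  \<open>T\<close> can be spent at constant speed. The price is constants that depend on
  \<open>l\<close>; it is harmless because the linear flow is homogeneous in the amplitude while the
  error is quadratic, so the amplitude is chosen last. Oddness survives because the symbols are
  even, and one real sequence describes the solution.\<close>

lemma finite_measure_torus: "finite_measure torus"
  unfolding torus_def by (rule finite_measure_lebesgue_on) simp

interpretation torus: finite_measure torus
  by (rule finite_measure_torus)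

lemma space_torus: "space torus = cbox 0 (\<chi> i. 2 * pi)"
  by (simp add: torus_def)

lemma measure_torus: "measure torus (space torus) = (2 * pi) ^ 3"
proof -
  have "measure torus (space torus) = measure lborel (cbox (0::real^3) (\<chi> i. 2 * pi))"
    by (simp add: torus_def measure_restrict_space measure_completion)
  also have "\<dots> = (2 * pi) ^ 3"
  proof -
    have "cbox (0::real^3) (\<chi> i. 2 * pi) \<noteq> {}"
      by (simp add: interval_ne_empty_cart)
    then have "Henstock_Kurzweil_Integration.content (cbox (0::real^3) (\<chi> i. 2 * pi)) = (\<Prod>i\<in>(UNIV::3 set). 2 * pi)"
      by (simp add: content_cbox_cart)
    then show ?thesis by simp
  qed
  finally show ?thesis .
qed

section \<open>Continuous functions on the period cell\<close>

lemma measurable_torus: "f \<in> borel_measurable lebesgue \<Longrightarrow> f \<in> borel_measurable torus"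
  unfolding torus_def by (rule measurable_restrict_space1)

lemma continuous_measurable_lebesgue:
  fixes f :: "'a::euclidean_space \<Rightarrow> 'b::euclidean_space"
  assumes "continuous_on UNIV f"
  shows "f \<in> borel_measurable lebesgue"
  using continuous_imp_measurable_on_sets_lebesgue[OF assms] by (simp add: lebesgue_on_UNIV_eq)

lemma continuous_measurable_torus:
  fixes f :: "real^3 \<Rightarrow> 'b::euclidean_space"
  assumes "continuous_on UNIV f"
  shows "f \<in> borel_measurable torus"
  using continuous_measurable_lebesgue[OF assms] unfolding torus_def by (rule measurable_restrict_space1)

lemma continuous_bounded_torus:
  fixes f :: "real^3 \<Rightarrow> 'b::real_normed_vector"
  assumes "continuous_on UNIV f"
  obtains C where "0 \<le> C" "\<And>x. x \<in> space torus \<Longrightarrow> norm (f x) \<le> C"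
proof -
  have "compact (f ` cbox 0 (\<chi> i. 2 * pi))"
    by (intro compact_continuous_image continuous_on_subset[OF assms]) auto
  then obtain C where "\<And>x. x \<in> space torus \<Longrightarrow> norm (f x) \<le> C"
    unfolding space_torus by (meson bounded_iff compact_imp_bounded imageI)
  then show ?thesis
    by (intro that[of "max 0 C"]) (auto simp: le_max_iff_disj)
qed

lemma integrable_torus_continuous:
  fixes f :: "real^3 \<Rightarrow> 'b::euclidean_space"
  assumes "continuous_on UNIV f"
  shows "integrable torus f"
proof -
  obtain C where "\<And>x. x \<in> space torus \<Longrightarrow> norm (f x) \<le> C"
    using continuous_bounded_torus[OF assms] by blast
  then show ?thesis
    by (intro torus.integrable_const_bound[where B=C] continuous_measurable_torus assms) auto
qed

lemma integrable_torus_mult_continuous: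
  fixes f g :: "real^3 \<Rightarrow> real"
  assumes f: "integrable torus f" and g: "continuous_on UNIV g"
  shows "integrable torus (\<lambda>x. f x * g x)"
proof -
  obtain C where C: "0 \<le> C" "\<And>x. x \<in> space torus \<Longrightarrow> norm (g x) \<le> C"
    using continuous_bounded_torus[OF g] by blast
  show ?thesis
  proof (rule Bochner_Integration.integrable_bound)
    show "integrable torus (\<lambda>x. C * f x)" using f by simp
    show "(\<lambda>x. f x * g x) \<in> borel_measurable torus"
      using borel_measurable_integrable[OF f] continuous_measurable_torus[OF g] by simp
    show "AE x in torus. norm (f x * g x) \<le> norm (C * f x)"
      using C by (intro AE_I2) (auto simp: abs_mult mult.commute[of C] intro!: mult_mono)
  qed
qed

lemma torus_integral_eq_HK:
  fixes f :: "real^3 \<Rightarrow> real"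
  assumes "continuous_on UNIV f"
  shows "(LINT x|torus. f x) = integral (cbox 0 (\<chi> i. 2 * pi)) f"
  unfolding torus_def
  by (rule lebesgue_integral_eq_integral)
     (use integrable_torus_continuous[OF assms] in \<open>auto simp: torus_def\<close>)

text \<open>The box from \<open>0\<close> to \<open>c + axis j h\<close> is cut twice, at height
  \<open>h\<close> and at height \<open>2 * pi\<close>. The cuts leave the shifted cell and the
  original cell; the discarded slabs are translates of each other by a full period, so periodicity
  makes their integrals equal.\<close>

lemma integral_cube_translate:
  fixes F :: "real^3 \<Rightarrow> real"
  assumes per: "periodic F" and cont: "continuous_on UNIV F" and h: "0 \<le> h" "h \<le> 2 * pi"
  shows "integral (cbox 0 (\<chi> i. 2 * pi)) (\<lambda>x. F (x + axis j h)) = integral (cbox 0 (\<chi> i. 2 * pi)) F"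
proof -
  define c :: "real^3" where "c = (\<chi> i. 2 * pi)"
  define d :: "real^3" where "d = (\<chi> i. if i = j then h else 2 * pi)"
  have box: "x \<in> cbox a b \<longleftrightarrow>
      (a $ j \<le> x $ j \<and> x $ j \<le> b $ j) \<and> (\<forall>i. i \<noteq> j \<longrightarrow> a $ i \<le> x $ i \<and> x $ i \<le> b $ i)" for x a b :: "real^3"
    unfolding mem_box_cart by metis
  have ax: "(axis j t :: real^3) $ j = t" "i \<noteq> j \<Longrightarrow> (axis j t :: real^3) $ i = 0" for i t
    by (simp_all add: axis_def)
  have cd: "c $ i = 2 * pi" "d $ j = h" "i \<noteq> j \<Longrightarrow> d $ i = 2 * pi" for i
    by (simp_all add: c_def d_def)
  have int: "F integrable_on cbox a b" for a b
    by (intro integrable_continuous continuous_on_subset[OF cont]) auto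
  have split: "integral (cbox a b) F
      = integral (cbox a b \<inter> {x. x \<bullet> axis j 1 \<le> s}) F + integral (cbox a b \<inter> {x. x \<bullet> axis j 1 \<ge> s}) F" for a b s
    using int by (rule integral_split) (auto simp: axis_in_Basis_iff)
  have split': "integral (cbox a b) F
      = integral (cbox a b \<inter> {x. x $ j \<le> s}) F + integral (cbox a b \<inter> {x. x $ j \<ge> s}) F" for a b s
    using split[of a b s] by (simp add: inner_axis)
  have "integral (cbox 0 c) (\<lambda>x. F (x + axis j h)) = integral (cbox (axis j h) (c + axis j h)) F"
    using integral_shift_cbox_plus[of 0 c F "axis j h"] by (simp add: o_def add.commute)
  moreover have "cbox 0 (c + axis j h) \<inter> {x. x $ j \<le> h} = cbox 0 d"
    using h by (intro set_eqI) (auto simp: box ax cd)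
  moreover have "cbox 0 (c + axis j h) \<inter> {x. x $ j \<ge> h} = cbox (axis j h) (c + axis j h)"
    using h by (intro set_eqI) (auto simp: box ax cd)
  moreover have "cbox 0 (c + axis j h) \<inter> {x. x $ j \<le> 2 * pi} = cbox 0 c"
    using h by (intro set_eqI) (auto simp: box ax cd)
  moreover have "cbox 0 (c + axis j h) \<inter> {x. x $ j \<ge> 2 * pi} = cbox (axis j (2 * pi)) (d + axis j (2 * pi))"
    using h by (intro set_eqI) (auto simp: box ax cd)
  moreover have "integral (cbox (axis j (2 * pi)) (d + axis j (2 * pi))) F = integral (cbox 0 d) F"
  proof -
    have "F \<circ> (+) (axis j (2 * pi)) = F"
      using per by (auto simp: periodic_def add.commute)
    then show ?thesis
      using integral_shift_cbox_plus[of 0 d F "axis j (2 * pi)"] by simp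
  qed
  ultimately show ?thesis
    using split'[of 0 "c + axis j h" h] split'[of 0 "c + axis j h" "2 * pi"] by (simp add: c_def)
qed

text \<open>By translation invariance the integral of \<open>F (x + axis j t)\<close> over the cell
  does not depend on \<open>t\<close>; differentiating under the integral at \<open>t = 0\<close>
  gives the claim. The derivative is one-sided because the invariance is available for shifts in
  \<open>{0..2*pi}\<close>.\<close>

lemma integral_torus_derivative_zero:
  fixes F G :: "real^3 \<Rightarrow> real"
  assumes per: "periodic F" and F: "continuous_on UNIV F" and G: "continuous_on UNIV G"
    and deriv: "\<And>x. ((\<lambda>t. F (x + axis j t)) has_real_derivative G x) (at 0)"
  shows "(LINT x|torus. G x) = 0"
proof -
  let ?Q = "cbox (0::real^3) (\<chi> i. 2 * pi)"
  have ax: "continuous_on UNIV (\<lambda>z::real \<times> (real^3). snd z + axis j (fst z))"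
  proof -
    have "axis j (fst z) = fst z *\<^sub>R (axis j 1 :: real^3)" for z :: "real \<times> (real^3)"
      by (simp add: vec_eq_iff axis_def)
    then show ?thesis by (auto intro!: continuous_intros)
  qed
  have shift: "continuous_on A (\<lambda>x. F (x + axis j t))" for A t
    by (rule continuous_on_compose2[OF F]) (auto intro!: continuous_intros)
  have d: "((\<lambda>t. F (x + axis j t)) has_real_derivative G (x + axis j t)) (at t within U)" for x t U
  proof -
    have "((\<lambda>s. F ((x + axis j t) + axis j s)) has_real_derivative G (x + axis j t)) (at 0)"
      by (rule deriv)
    moreover have "(x + axis j t) + axis j s = x + axis j (s + t)" for s
      by (simp add: vec_eq_iff axis_def)
    ultimately have "((\<lambda>s. F (x + axis j (s + t))) has_real_derivative G (x + axis j t)) (at 0)"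
      by simp
    then have "((\<lambda>t. F (x + axis j t)) has_real_derivative G (x + axis j t)) (at t)"
      using DERIV_shift[of "\<lambda>t. F (x + axis j t)" "G (x + axis j t)" 0 t] by simp
    then show ?thesis by (rule has_field_derivative_at_within)
  qed
  have "((\<lambda>t. integral ?Q (\<lambda>x. F (x + axis j t))) has_real_derivative
      integral ?Q (\<lambda>x. G (x + axis j 0))) (at 0 within {0..2*pi})"
  proof (rule leibniz_rule_field_derivative[where fx = "\<lambda>t x. G (x + axis j t)"])
    show "continuous_on ({0..2 * pi} \<times> ?Q) (\<lambda>(t, x). G (x + axis j t))"
      unfolding case_prod_beta
      by (rule continuous_on_compose2[OF G continuous_on_subset[OF ax]]) auto
  qed (auto intro!: d integrable_continuous shift)
  moreover have "((\<lambda>t. integral ?Q (\<lambda>x. F (x + axis j t))) has_real_derivative 0) (at 0 within {0..2*pi})"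
  proof (rule has_field_derivative_transform_within[OF DERIV_const[of "integral ?Q F"], of 1])
    show "integral ?Q F = integral ?Q (\<lambda>x. F (x + axis j t))" if "t \<in> {0..2*pi}" for t
      using that by (intro integral_cube_translate[symmetric] per F) auto
  qed auto
  moreover have "at (0::real) within {0..2*pi} \<noteq> bot"
    by (simp add: at_within_Icc_at_right)
  ultimately have "integral ?Q (\<lambda>x. G (x + axis j 0)) = 0"
    using has_field_derivative_unique by blast
  moreover have "axis j 0 = (0 :: real^3)" by (simp add: vec_eq_iff axis_def)
  ultimately show ?thesis using torus_integral_eq_HK[OF G] by simp
qed

section \<open>Plane waves\<close>

lemma freq_simps [simp]:
  "freq 0 = 0" "freq (- k) = - freq k" "freq (k + l) = freq k + freq l" "freq (k - l) = freq k - freq l"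
  by (simp_all add: freq_def vec_eq_iff)

lemma freq_eq_iff [simp]: "freq k = freq l \<longleftrightarrow> k = l"
  by (simp add: freq_def vec_eq_iff)

lemma freq_eq_0_iff [simp]: "freq k = 0 \<longleftrightarrow> k = 0"
  using freq_eq_iff[of k 0] by simp

lemma norm_freq_ge_1: "k \<noteq> 0 \<Longrightarrow> 1 \<le> norm (freq k)"
proof -
  assume "k \<noteq> 0"
  then obtain i where "k $ i \<noteq> 0" by (auto simp: vec_eq_iff)
  then have "1 \<le> \<bar>freq k $ i\<bar>" by (simp add: freq_def)
  then show ?thesis using component_le_norm_cart[of "freq k" i] by linarith
qed

text \<open>The free phase makes the family closed under differentiation (a shift by
  \<open>pi / 2\<close>) and, up to linear combinations, under products. It contains the cosines, so
  sines and cosines need no separate treatment.\<close>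

definition wave :: "int^3 \<Rightarrow> real \<Rightarrow> real^3 \<Rightarrow> real" where
  "wave k \<phi> x = sin (freq k \<bullet> x + \<phi>)"

lemma wave_abs_le: "\<bar>wave k \<phi> x\<bar> \<le> 1"
  by (simp add: wave_def)

lemma wave_mult:
  "wave p \<phi> x * wave q \<theta> x
    = (wave (p - q) (\<phi> - \<theta> + pi / 2) x - wave (p + q) (\<phi> + \<theta> + pi / 2) x) / 2"
proof -
  have sin_shift: "sin (t + pi / 2) = cos t" for t :: real
    by (simp add: sin_add)
  have "wave (p - q) (\<phi> - \<theta> + pi / 2) x = cos ((freq p \<bullet> x + \<phi>) - (freq q \<bullet> x + \<theta>))"
    unfolding wave_def by (subst sin_shift[symmetric]) (simp add: algebra_simps inner_diff_left)
  moreover have "wave (p + q) (\<phi> + \<theta> + pi / 2) x = cos ((freq p \<bullet> x + \<phi>) + (freq q \<bullet> x + \<theta>))"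
    unfolding wave_def by (subst sin_shift[symmetric]) (simp add: algebra_simps inner_add_left)
  ultimately show ?thesis
    unfolding wave_def cos_add cos_diff by simp
qed

lemma continuous_wave [continuous_intros]: "continuous_on A (wave k \<phi>)"
  unfolding wave_def by (intro continuous_intros)

lemma sin_add_2pi_int: "sin (x + of_int n * (2 * pi)) = sin x"
  using sin.plus_of_int[of x n] by (simp add: mult.commute)

lemma periodic_wave: "periodic (wave k \<phi>)"
proof -
  have "wave k \<phi> (x + axis i (2 * pi)) = wave k \<phi> x" for x i
  proof -
    have "freq k \<bullet> (x + axis i (2 * pi)) + \<phi> = (freq k \<bullet> x + \<phi>) + of_int (k $ i) * (2 * pi)"
      by (simp add: inner_add_right inner_axis freq_def)
    then show ?thesis by (simp only: wave_def sin_add_2pi_int)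
  qed
  then show ?thesis by (simp add: periodic_def)
qed

lemma wave_has_derivative:
  "(wave k \<phi> has_derivative (\<lambda>h. (freq k \<bullet> h) * wave k (\<phi> + pi / 2) x)) (at x)"
proof -
  have "sin (freq k \<bullet> x + (\<phi> + pi / 2)) = cos (freq k \<bullet> x + \<phi>)"
    using sin_add[of "freq k \<bullet> x + \<phi>" "pi / 2"] by (simp add: add.assoc)
  then show ?thesis
    unfolding wave_def[abs_def] by (auto intro!: derivative_eq_intros simp: mult.commute)
qed

lemma partial_wave:
  "partial i (\<lambda>x. c * wave k \<phi> x) = (\<lambda>x. (c * freq k $ i) * wave k (\<phi> + pi / 2) x)"
proof
  fix x
  have "((\<lambda>x. c * wave k \<phi> x) has_derivative (\<lambda>h. c * ((freq k \<bullet> h) * wave k (\<phi> + pi / 2) x))) (at x)"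
    by (intro has_derivative_mult_right wave_has_derivative)
  from frechet_derivative_at[OF this, symmetric]
  show "partial i (\<lambda>x. c * wave k \<phi> x) x = (c * freq k $ i) * wave k (\<phi> + pi / 2) x"
    unfolding partial_def by (simp add: inner_axis)
qed

lemma C_order_wave: "C_order n (\<lambda>x. c * wave k \<phi> x)"
proof (induction n arbitrary: c \<phi>)
  case 0
  show ?case by (simp add: continuous_intros)
next
  case (Suc n)
  have "(\<lambda>x. c * wave k \<phi> x) differentiable (at x)" for x
    using has_derivative_mult_right[OF wave_has_derivative] by (rule differentiableI)
  then show ?case using Suc by (simp add: partial_wave)
qed

lemma test_function_wave: "test_function (wave k \<phi>)"
  using periodic_wave[of k \<phi>] C_order_wave[of _ 1 k \<phi>] by (simp add: test_function_def)

section \<open>Test functions and integration by parts against waves\<close>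

lemma test_function_differentiable: "test_function f \<Longrightarrow> f differentiable (at x)"
proof -
  assume "test_function f"
  then have "C_order (Suc 0) f" unfolding test_function_def by blast
  then show ?thesis by simp
qed

lemma test_function_continuous: "test_function f \<Longrightarrow> continuous_on A f"
  by (meson differentiable_imp_continuous_within continuous_at_imp_continuous_on test_function_differentiable)

lemma test_function_has_derivative:
  "test_function f \<Longrightarrow> (f has_derivative frechet_derivative f (at x)) (at x)"
  using test_function_differentiable frechet_derivative_works by blast

lemma periodic_partial:
  assumes "periodic f" "\<And>x. f differentiable (at x)"
  shows "periodic (partial i f)"
  unfolding periodic_def
proof (intro allI)
  fix x j
  let ?p = "axis j (2 * pi) :: real^3"
  have "(f has_derivative frechet_derivative f (at (x + ?p))) (at (x + ?p))"
    using assms(2) frechet_derivative_works by blast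
  then have "((\<lambda>y. f (y + ?p)) has_derivative frechet_derivative f (at (x + ?p))) (at x)"
  proof (rule has_derivative_compose[rotated])
    show "((\<lambda>y. y + ?p) has_derivative (\<lambda>y. y)) (at x)"
      by (intro derivative_eq_intros) auto
  qed
  moreover have "(\<lambda>y. f (y + ?p)) = f"
    using assms(1) by (auto simp: periodic_def)
  ultimately have "frechet_derivative f (at (x + ?p)) = frechet_derivative f (at x)"
    using frechet_derivative_at by metis
  then show "partial i f (x + ?p) = partial i f x"
    by (simp add: partial_def)
qed

lemma test_function_partial:
  assumes "test_function f" shows "test_function (partial i f)"
  unfolding test_function_def
proof (intro conjI allI)
  show "periodic (partial i f)"
    using assms test_function_differentiable by (intro periodic_partial) (auto simp: test_function_def)
  fix n
  have "C_order (Suc n) f" using assms unfolding test_function_def by blast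
  then show "C_order n (partial i f)" by simp
qed

lemma directional_derivative:
  fixes F :: "real^3 \<Rightarrow> real"
  assumes "(F has_derivative D) (at x)"
  shows "((\<lambda>t. F (x + axis i t)) has_real_derivative D (axis i 1)) (at 0)"
proof -
  define e where "e = (axis i 1 :: real^3)"
  have ax: "axis i t = t *\<^sub>R e" for t
    by (simp add: e_def vec_eq_iff axis_def)
  have "((\<lambda>t. x + t *\<^sub>R e) has_derivative (\<lambda>t. t *\<^sub>R e)) (at 0)"
    by (auto intro!: derivative_eq_intros)
  moreover have "(F has_derivative D) (at (x + 0 *\<^sub>R e))"
    using assms by simp
  ultimately have "((\<lambda>t. F (x + t *\<^sub>R e)) has_derivative (\<lambda>t. D (t *\<^sub>R e))) (at 0)"
    using has_derivative_compose[of "\<lambda>t. x + t *\<^sub>R e" _ 0 UNIV F D] by blast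
  moreover have "D (t *\<^sub>R e) = D e * t" for t
    using linear_cmul[OF has_derivative_linear[OF assms]] by simp
  ultimately show ?thesis
    by (simp add: has_field_derivative_def ax e_def[symmetric])
qed

lemma wave_integral_by_parts:
  assumes "test_function f"
  shows "(LINT x|torus. wave k \<phi> x * partial i f x) = - (freq k $ i) * (LINT x|torus. wave k (\<phi> + pi / 2) x * f x)"
proof -
  let ?G = "\<lambda>x. wave k \<phi> x * partial i f x + (freq k $ i) * (wave k (\<phi> + pi / 2) x * f x)"
  have cont: "continuous_on UNIV (partial i f)" "continuous_on UNIV f"
    using assms test_function_continuous test_function_partial by blast+
  have "(LINT x|torus. ?G x) = 0"
  proof (rule integral_torus_derivative_zero[where F = "\<lambda>x. wave k \<phi> x * f x" and j = i])
    show "periodic (\<lambda>x. wave k \<phi> x * f x)"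
      using periodic_wave assms by (simp add: periodic_def test_function_def)
    fix x :: "real^3"
    let ?D = "\<lambda>h. wave k \<phi> x * frechet_derivative f (at x) h + ((freq k \<bullet> h) * wave k (\<phi> + pi / 2) x) * f x"
    have d: "((\<lambda>x. wave k \<phi> x * f x) has_derivative ?D) (at x)"
      using has_derivative_mult[OF wave_has_derivative test_function_has_derivative[OF assms]] .
    have "?D (axis i 1) = ?G x"
      by (simp add: partial_def inner_axis)
    with directional_derivative[OF d, of i]
    show "((\<lambda>t. wave k \<phi> (x + axis i t) * f (x + axis i t)) has_real_derivative ?G x) (at 0)"
      by simp
  qed (intro continuous_intros cont)+
  moreover have "(LINT x|torus. ?G x) = (LINT x|torus. wave k \<phi> x * partial i f x)
      + (LINT x|torus. (freq k $ i) * (wave k (\<phi> + pi / 2) x * f x))"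
    by (intro Bochner_Integration.integral_add integrable_torus_continuous continuous_intros cont)
  ultimately show ?thesis by simp
qed

lemma test_function_partial_iter: "test_function f \<Longrightarrow> test_function ((partial i ^^ n) f)"
  by (induction n) (auto intro: test_function_partial)

lemma wave_integral_by_parts_iter:
  assumes "test_function f"
  shows "(LINT x|torus. wave k \<phi> x * (partial i ^^ n) f x)
    = (- 1) ^ n * (freq k $ i) ^ n * (LINT x|torus. wave k (\<phi> + real n * (pi / 2)) x * f x)"
proof (induction n arbitrary: \<phi>)
  case (Suc n)
  have "\<phi> + pi / 2 + real n * (pi / 2) = \<phi> + real (Suc n) * (pi / 2)"
    by (simp add: field_simps)
  then show ?case
    using wave_integral_by_parts[OF test_function_partial_iter[OF assms, where i = i and n = n], of k \<phi> i]
    unfolding Suc[of "\<phi> + pi / 2"] by (simp only: funpow.simps o_apply power_Suc mult_ac mult_minus_left mult_minus_right mult_1_left)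
qed simp

lemma test_function_multi_partial: "test_function f \<Longrightarrow> test_function (multi_partial \<alpha> f)"
  unfolding multi_partial_def by (intro test_function_partial_iter)

text \<open>Every derivative moved onto the wave costs a factor \<open>-1\<close>, a frequency
  component and a phase shift of \<open>pi / 2\<close>, whatever its direction; only the total order
  enters the sign and the phase.\<close>

lemma wave_multi_partial:
  assumes "test_function f"
  shows "(LINT x|torus. wave k \<phi> x * multi_partial \<alpha> f x)
    = (- 1) ^ multi_order \<alpha> * (\<Prod>i\<in>UNIV. (freq k $ i) ^ (\<alpha> $ i))
      * (LINT x|torus. wave k (\<phi> + real (multi_order \<alpha>) * (pi / 2)) x * f x)"
proof -
  have ph: "\<phi> + real a * (pi / 2) + real b * (pi / 2) + real c * (pi / 2) = \<phi> + real (a + b + c) * (pi / 2)" for a b c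
    by (simp add: field_simps)
  have "multi_order \<alpha> = \<alpha> $ 1 + \<alpha> $ 2 + \<alpha> $ 3"
    unfolding multi_order_def sum_3 ..
  moreover have "(\<Prod>i\<in>UNIV. (freq k $ i) ^ (\<alpha> $ i)) = (freq k $ 1) ^ (\<alpha> $ 1) * (freq k $ 2) ^ (\<alpha> $ 2) * (freq k $ 3) ^ (\<alpha> $ 3)"
    unfolding UNIV_3 by (simp add: mult_ac)
  ultimately show ?thesis
    unfolding multi_partial_def
    by (simp only: wave_integral_by_parts_iter test_function_partial_iter assms power_add ph) (simp only: mult_ac)
qed

text \<open>For \<open>k \<noteq> 0\<close> the wave is a derivative: integrating by parts against
  the constant 1 with phase \<open>\<phi> - pi / 2\<close> shows that \<open>k $ i\<close> times the
  integral is zero.\<close>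

lemma integral_wave: "(LINT x|torus. wave k \<phi> x) = (if k = 0 then (2 * pi) ^ 3 * sin \<phi> else 0)"
proof (cases "k = 0")
  case True
  then show ?thesis by (simp add: wave_def measure_torus)
next
  case False
  then obtain i where i: "k $ i \<noteq> 0" by (auto simp: vec_eq_iff)
  have one: "test_function (\<lambda>_. 1)"
    using test_function_wave[of 0 "pi / 2"] by (simp add: wave_def[abs_def])
  have "partial i (\<lambda>_. 1) = (\<lambda>_. 0)"
    by (auto simp: partial_def frechet_derivative_const fun_eq_iff)
  then show ?thesis
    using False i wave_integral_by_parts[OF one, of k "\<phi> - pi / 2" i] by (simp add: freq_def)
qed

section \<open>Uniqueness of Fourier coefficients\<close>

text \<open>Embeds the torus into Euclidean space so that trigonometric polynomials become ordinary
  polynomials in the image point, the setting of the Stone-Weierstrass theorem.\<close>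

definition cos_sin :: "real^3 \<Rightarrow> (real^3) \<times> (real^3)" where
  "cos_sin x = ((\<chi> i. cos (x $ i)), (\<chi> i. sin (x $ i)))"

lemma continuous_cos_sin: "continuous_on A cos_sin"
  unfolding cos_sin_def by (intro continuous_intros)

text \<open>The cell is closed, so the map identifies opposite faces. Asking one of the two points
  to lie in the open cell still separates a closed set inside the open cell from every other point,
  which is the situation in \<open>moments_closed\<close>.\<close>

lemma cos_sin_inj:
  assumes x: "x \<in> cbox 0 (\<chi> i. 2 * pi)" and y: "y \<in> box 0 (\<chi> i. 2 * pi)" and eq: "cos_sin x = cos_sin y"
  shows "x = y"
proof -
  have "x $ i = y $ i" for i
  proof -
    have "cos (x $ i) = cos (y $ i)" "sin (x $ i) = sin (y $ i)"
      using eq by (auto simp: cos_sin_def vec_eq_iff)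
    then obtain n where n: "x $ i = y $ i + 2 * pi * of_int n"
      using sin_cos_eq_iff[of "x $ i" "y $ i"] by blast
    have "0 \<le> x $ i" "x $ i \<le> 2 * pi" "0 < y $ i" "y $ i < 2 * pi"
      using x y by (auto simp: mem_box_cart)
    then have "2 * pi * real_of_int n < 2 * pi * 1" "2 * pi * (- 1) < 2 * pi * real_of_int n"
      using n by linarith+
    then have "real_of_int n < 1" "- 1 < real_of_int n"
      using mult_less_cancel_left_pos[of "2 * pi"] pi_gt_zero by (metis mult_pos_pos zero_less_numeral)+
    then have "n = 0" by linarith
    then show ?thesis using n by simp
  qed
  then show ?thesis by (simp add: vec_eq_iff)
qed

context
  fixes f :: "real^3 \<Rightarrow> real"
  assumes f: "integrable torus f"
    and moments: "\<And>k \<phi>. (LINT x|torus. f x * wave k \<phi> x) = 0"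
begin

text \<open>Testing against all products \<open>g * wave k \<phi>\<close>, and not against
  \<open>g\<close> alone, makes the set stable under multiplication by waves.\<close>

definition "annihilated = {g. continuous_on UNIV g \<and> (\<forall>k \<phi>. (LINT x|torus. f x * (g x * wave k \<phi> x)) = 0)}"

lemma annihilated_const: "(\<lambda>_. c) \<in> annihilated"
  using moments by (simp add: annihilated_def mult.left_commute[of _ c])

lemma annihilated_add:
  assumes "g \<in> annihilated" "h \<in> annihilated"
  shows "(\<lambda>x. g x + h x) \<in> annihilated"
proof -
  have "integrable torus (\<lambda>x. f x * (g x * wave k \<phi> x))" "integrable torus (\<lambda>x. f x * (h x * wave k \<phi> x))" for k \<phi>
    using assms by (auto simp: annihilated_def intro!: integrable_torus_mult_continuous f continuous_intros)
  then show ?thesis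
    using assms by (simp add: annihilated_def continuous_intros algebra_simps)
qed

lemma annihilated_cmult:
  assumes "g \<in> annihilated"
  shows "(\<lambda>x. c * g x) \<in> annihilated"
  using assms by (simp add: annihilated_def continuous_intros mult.assoc mult.left_commute[of _ c])

lemma annihilated_wave:
  assumes "g \<in> annihilated"
  shows "(\<lambda>x. wave q \<theta> x * g x) \<in> annihilated"
proof -
  have g: "continuous_on UNIV g" "(LINT x|torus. f x * (g x * wave k \<phi> x)) = 0" for k \<phi>
    using assms by (auto simp: annihilated_def)
  have "(LINT x|torus. f x * (wave q \<theta> x * g x * wave k \<phi> x)) = 0" for k \<phi>
  proof -
    have int: "integrable torus (\<lambda>x. f x * (g x * wave k \<phi> x))" for k \<phi>
      by (intro integrable_torus_mult_continuous f continuous_intros g)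
    have "(LINT x|torus. f x * (wave q \<theta> x * g x * wave k \<phi> x))
       = (LINT x|torus. f x * (g x * wave (q - k) (\<theta> - \<phi> + pi / 2) x) / 2
            - f x * (g x * wave (q + k) (\<theta> + \<phi> + pi / 2) x) / 2)"
    proof (rule Bochner_Integration.integral_cong[OF refl])
      fix x
      have "f x * (wave q \<theta> x * g x * wave k \<phi> x) = f x * g x * (wave q \<theta> x * wave k \<phi> x)"
        by simp
      then show "f x * (wave q \<theta> x * g x * wave k \<phi> x) =
        f x * (g x * wave (q - k) (\<theta> - \<phi> + pi / 2) x) / 2 - f x * (g x * wave (q + k) (\<theta> + \<phi> + pi / 2) x) / 2"
        unfolding wave_mult by (simp add: field_simps)
    qed
    also have "\<dots> = 0" using int g(2) by simp
    finally show ?thesis .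
  qed
  then show ?thesis using g by (auto simp: annihilated_def intro!: continuous_intros)
qed

lemma annihilated_sum:
  "finite I \<Longrightarrow> (\<And>i. i \<in> I \<Longrightarrow> g i \<in> annihilated) \<Longrightarrow> (\<lambda>x. \<Sum>i\<in>I. g i x) \<in> annihilated"
proof (induction I rule: finite_induct)
  case empty
  then show ?case using annihilated_const[of 0] by simp
next
  case (insert j I)
  then show ?case using annihilated_add[of "g j" "\<lambda>x. \<Sum>i\<in>I. g i x"] by simp
qed

text \<open>A linear functional of \<open>cos_sin x\<close> is a combination of first-order waves.
  Products are handled by applying one induction hypothesis to the function produced by the other,
  hence the generalisation over \<open>g\<close>.\<close>

lemma annihilated_polynomial:
  assumes "real_polynomial_function p" "g \<in> annihilated"
  shows "(\<lambda>x. p (cos_sin x) * g x) \<in> annihilated"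
  using assms
proof (induction p arbitrary: g rule: real_polynomial_function.induct)
  case (linear p)
  let ?a = "\<lambda>i. p (axis i 1, 0)" and ?b = "\<lambda>i. p (0, axis i 1)"
  have cs: "cos (x $ i) = wave (axis i 1) (pi / 2) x" "sin (x $ i) = wave (axis i 1) 0 x" for x i
  proof -
    have "freq (axis i 1) = axis i 1" by (simp add: freq_def vec_eq_iff axis_def)
    then show "cos (x $ i) = wave (axis i 1) (pi / 2) x" "sin (x $ i) = wave (axis i 1) 0 x"
      by (simp_all add: wave_def inner_axis' sin_add)
  qed
  have "p (cos_sin x) = (\<Sum>i\<in>UNIV. ?a i * wave (axis i 1) (pi / 2) x + ?b i * wave (axis i 1) 0 x)" for x
  proof -
    interpret bounded_linear p by (rule linear)
    have "cos_sin x = (\<Sum>i\<in>UNIV. cos (x $ i) *\<^sub>R (axis i 1, 0) + sin (x $ i) *\<^sub>R (0, axis i 1))"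
      by (rule prod_eqI)
         (auto simp: cos_sin_def fst_sum snd_sum vec_eq_iff axis_def if_distrib cong: if_cong)
    then show ?thesis
      by (simp only: sum add scaleR cs real_scaleR_def mult.commute)
  qed
  moreover have "(\<lambda>x. \<Sum>i\<in>UNIV. ?a i * (wave (axis i 1) (pi / 2) x * g x) + ?b i * (wave (axis i 1) 0 x * g x)) \<in> annihilated"
    using linear.prems by (intro annihilated_sum annihilated_add annihilated_cmult annihilated_wave) auto
  ultimately show ?case
    by (simp add: sum_distrib_left algebra_simps)
next
  case (const c)
  then show ?case by (rule annihilated_cmult)
next
  case (add p q)
  then show ?case using annihilated_add by (simp add: algebra_simps)
next
  case (mult p q)
  from mult.IH(1)[OF mult.IH(2)[OF mult.prems]] show ?case by (simp add: algebra_simps)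
qed

lemma annihilated_integral: "g \<in> annihilated \<Longrightarrow> (LINT x|torus. f x * g x) = 0"
proof -
  assume "g \<in> annihilated"
  then have "(LINT x|torus. f x * (g x * wave 0 (pi / 2) x)) = 0" unfolding annihilated_def by blast
  then show ?thesis by (simp add: wave_def)
qed

text \<open>Polynomials in \<open>cos_sin\<close> are annihilated and approximate \<open>g\<close>
  uniformly on the compact image, so the integral is at most \<open>e\<close> times the
  \<open>L^1\<close> norm of \<open>f\<close> for every \<open>e > 0\<close>.\<close>

lemma moments_continuous:
  assumes g: "continuous_on UNIV g"
  shows "(LINT x|torus. f x * g (cos_sin x)) = 0"
proof -
  let ?I = "LINT x|torus. \<bar>f x\<bar>"
  have gc: "continuous_on UNIV (\<lambda>x. g (cos_sin x))"
    by (rule continuous_on_compose2[OF g continuous_cos_sin]) auto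
  have bound: "\<bar>LINT x|torus. f x * g (cos_sin x)\<bar> \<le> e * ?I" if "e > 0" for e
  proof -
    obtain p where p: "real_polynomial_function p" "\<And>y. y \<in> cos_sin ` space torus \<Longrightarrow> \<bar>g y - p y\<bar> < e"
    proof (rule Stone_Weierstrass_real_polynomial_function[of "cos_sin ` space torus" g e])
      show "compact (cos_sin ` space torus)"
        unfolding space_torus by (intro compact_continuous_image continuous_cos_sin) auto
      show "continuous_on (cos_sin ` space torus) g" by (rule continuous_on_subset[OF g]) auto
    qed (use \<open>e > 0\<close> in auto)
    have pan: "(\<lambda>x. p (cos_sin x)) \<in> annihilated"
      using annihilated_polynomial[OF p(1) annihilated_const[of 1]] by simp
    then have pc: "continuous_on UNIV (\<lambda>x. p (cos_sin x))" by (simp add: annihilated_def)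
    have "(LINT x|torus. f x * g (cos_sin x)) = (LINT x|torus. f x * (g (cos_sin x) - p (cos_sin x)))"
      using annihilated_integral[OF pan] f gc pc
      by (simp add: right_diff_distrib integrable_torus_mult_continuous)
    also have "\<bar>\<dots>\<bar> \<le> (LINT x|torus. \<bar>f x * (g (cos_sin x) - p (cos_sin x))\<bar>)"
      by (rule integral_abs_bound)
    also have "\<dots> \<le> (LINT x|torus. e * \<bar>f x\<bar>)"
    proof (rule integral_mono)
      show "integrable torus (\<lambda>x. \<bar>f x * (g (cos_sin x) - p (cos_sin x))\<bar>)"
        by (intro integrable_abs integrable_torus_mult_continuous f continuous_intros gc pc)
      show "\<bar>f x * (g (cos_sin x) - p (cos_sin x))\<bar> \<le> e * \<bar>f x\<bar>" if "x \<in> space torus" for x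
        using p(2)[of "cos_sin x"] that by (auto simp: abs_mult mult.commute[of e] intro!: mult_left_mono)
    qed (use f in simp)
    also have "\<dots> = e * ?I" by simp
    finally show ?thesis .
  qed
  have "\<bar>LINT x|torus. f x * g (cos_sin x)\<bar> \<le> 0"
  proof (cases "?I = 0")
    case True
    then show ?thesis using bound[of 1] by simp
  next
    case False
    have I: "?I > 0" using False by (simp add: less_le)
    show ?thesis
    proof (rule field_le_epsilon)
      fix d :: real assume "0 < d"
      then show "\<bar>LINT x|torus. f x * g (cos_sin x)\<bar> \<le> 0 + d"
        using I bound[of "d / ?I"] by simp
    qed
  qed
  then show ?thesis by simp
qed

lemma moments_closed:
  assumes C: "closed C" "C \<subseteq> box 0 (\<chi> i. 2 * pi)"
  shows "(LINT x|torus. f x * indicator C x) = 0"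
proof (cases "C = {}")
  case False
  let ?K = "cos_sin ` C"
  have "bounded C" using C(2) bounded_box bounded_subset by blast
  then have "compact C" using C(1) compact_eq_bounded_closed by blast
  then have K: "closed ?K" "?K \<noteq> {}"
    using False by (auto intro!: compact_imp_closed compact_continuous_image continuous_cos_sin)
  \<comment> \<open>Tents of slope \<open>n\<close> over the image of \<open>C\<close>: equal to 1
    on it and eventually 0 at each point off it. Composed with \<open>cos_sin\<close> they converge
    to the indicator of \<open>C\<close> on the whole cell.\<close>
  define g where "g n y = max 0 (1 - real n * infdist y ?K)" for n :: nat and y
  have gc: "continuous_on UNIV (g n)" for n
    unfolding g_def by (intro continuous_intros)
  have gb: "0 \<le> g n y" "g n y \<le> 1" for n y
    by (auto simp: g_def infdist_nonneg)
  have lim: "(\<lambda>n. f x * g n (cos_sin x)) \<longlonglongrightarrow> f x * indicator C x" if x: "x \<in> space torus" for x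
  proof (cases "x \<in> C")
    case True
    then show ?thesis by (simp add: g_def)
  next
    case False
    have "cos_sin x \<notin> ?K"
      using x False cos_sin_inj C(2) unfolding space_torus by blast
    then have pos: "infdist (cos_sin x) ?K > 0"
      using K infdist_pos_not_in_closed by blast
    have "\<forall>\<^sub>F n in sequentially. 1 / infdist (cos_sin x) ?K \<le> real n"
      by (meson eventually_sequentiallyI nat_ceiling_le_eq)
    then have "\<forall>\<^sub>F n in sequentially. f x * g n (cos_sin x) = 0"
    proof eventually_elim
      case (elim n)
      then have "1 \<le> real n * infdist (cos_sin x) ?K" using pos by (simp add: field_simps)
      then show ?case by (simp add: g_def)
    qed
    then show ?thesis using False by (simp add: tendsto_eventually)
  qed
  have "(\<lambda>n. LINT x|torus. f x * g n (cos_sin x)) \<longlonglongrightarrow> (LINT x|torus. f x * indicator C x)"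
  proof (rule integral_dominated_convergence[where w = "\<lambda>x. \<bar>f x\<bar>"])
    have "C \<in> sets lebesgue" using C(1) by simp
    then have "indicator C \<in> borel_measurable torus"
      by (intro measurable_torus borel_measurable_indicator)
    then show "(\<lambda>x. f x * indicator C x) \<in> borel_measurable torus"
      using borel_measurable_integrable[OF f] by (intro borel_measurable_times)
    show "(\<lambda>x. f x * g n (cos_sin x)) \<in> borel_measurable torus" for n
      by (intro borel_measurable_integrable integrable_torus_mult_continuous f
          continuous_on_compose2[OF gc continuous_cos_sin]) auto
    show "AE x in torus. (\<lambda>n. f x * g n (cos_sin x)) \<longlonglongrightarrow> f x * indicator C x"
      using lim by (intro AE_I2) auto
    show "AE x in torus. norm (f x * g n (cos_sin x)) \<le> \<bar>f x\<bar>" for n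
      using gb by (intro AE_I2) (auto simp: abs_mult mult_left_le)
  qed (use f in simp)
  then show ?thesis by (simp add: moments_continuous[OF gc] LIMSEQ_const_iff)
qed simp

text \<open>If \<open>f\<close> were positive on a set of positive measure, inner regularity would
  give a closed subset of positive measure on which \<open>f > 0\<close> has vanishing integral. The
  faces of the cell are discarded as a null set.\<close>

lemma moments_nonpos: "AE x in torus. f x \<le> 0"
proof -
  let ?Q = "cbox (0::real^3) (\<chi> i. 2 * pi)" and ?B = "box (0::real^3) (\<chi> i. 2 * pi)"
  define P where "P = {x \<in> ?B. f x > 0}"
  have BQ: "?B \<subseteq> ?Q" by (rule box_subset_cbox)
  have "{x \<in> space torus. f x > 0} \<in> sets torus"
    using borel_measurable_integrable[OF f] by simp
  then have "{x \<in> ?Q. f x > 0} \<in> sets lebesgue"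
    unfolding space_torus unfolding torus_def by (subst (asm) sets_restrict_space_iff) auto
  moreover have "P = {x \<in> ?Q. f x > 0} \<inter> ?B" using BQ by (auto simp: P_def)
  moreover have "?B \<in> sets lebesgue" using lmeasurable_box by (rule fmeasurableD)
  ultimately have P: "P \<in> sets lebesgue" by (simp only: sets.Int)
  have null: "emeasure lebesgue C = 0" if C: "closed C" "C \<subseteq> P" for C
  proof -
    have CB: "C \<subseteq> ?B" using C by (auto simp: P_def)
    have ind: "integrable torus (\<lambda>x. f x * indicator C x)"
      using f C by (intro integrable_real_mult_indicator) (auto simp: torus_def sets_restrict_space_iff CB BQ dual_order.trans[OF BQ CB])
    have "AE x in torus. f x * indicator C x = 0"
    proof (subst integral_nonneg_eq_0_iff_AE[symmetric, OF ind])
      show "AE x in torus. 0 \<le> f x * indicator C x"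
        using C(2) by (intro AE_I2) (auto simp: P_def indicator_def)
      show "(LINT x|torus. f x * indicator C x) = 0" by (rule moments_closed[OF C(1) CB])
    qed
    then have "AE x in torus. x \<notin> C"
      by eventually_elim (use C(2) in \<open>auto simp: P_def indicator_def split: if_splits\<close>)
    then have "AE x in lebesgue. x \<in> ?Q \<longrightarrow> x \<notin> C"
      unfolding torus_def by (subst (asm) AE_restrict_space_iff) auto
    then have "AE x in lebesgue. x \<notin> C"
      by eventually_elim (use CB BQ in auto)
    then show ?thesis using AE_iff_measurable[of C lebesgue "\<lambda>x. x \<notin> C"] C(1) by simp
  qed
  have "emeasure lebesgue P \<le> 0"
  proof (rule ennreal_le_epsilon)
    fix e :: real assume "0 < e"
    then obtain T where T: "closed T" "T \<subseteq> P" "emeasure lebesgue (P - T) < ennreal e"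
      using sets_lebesgue_inner_closed[OF P] by metis
    have "emeasure lebesgue P \<le> emeasure lebesgue T + emeasure lebesgue (P - T)"
    proof -
      have Ts: "T \<in> sets lebesgue" using T(1) by simp
      moreover have "T \<union> (P - T) = P" using T(2) by blast
      ultimately show ?thesis using emeasure_subadditive[OF Ts sets.Diff[OF P Ts]] by metis
    qed
    then show "emeasure lebesgue P \<le> 0 + ennreal e"
      using T(3) null[OF T(1,2)] by simp
  qed
  then have "P \<in> null_sets lebesgue" using P by (simp add: null_setsI)
  then have "AE x in lebesgue. x \<notin> P" by (rule AE_not_in)
  moreover have "AE x in lebesgue. x \<notin> ?Q - ?B"
    using negligible_frontier_interval[of 0 "\<chi> i. 2 * pi"] by (intro AE_not_in) (simp add: negligible_iff_null_sets)
  ultimately have "AE x in lebesgue. x \<in> ?Q \<longrightarrow> f x \<le> 0"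
    by eventually_elim (auto simp: P_def)
  then show ?thesis
    unfolding torus_def by (subst AE_restrict_space_iff) auto
qed

end

lemma moments_zero_imp_AE_zero:
  assumes f: "integrable torus f" and moments: "\<And>k \<phi>. (LINT x|torus. f x * wave k \<phi> x) = 0"
  shows "AE x in torus. f x = 0"
proof -
  have "AE x in torus. f x \<le> 0" by (rule moments_nonpos[OF f moments])
  moreover have "AE x in torus. - f x \<le> 0"
    by (rule moments_nonpos) (use f moments in auto)
  ultimately show ?thesis by eventually_elim simp
qed

section \<open>Trigonometric series\<close>

lemma summable_on_comparison_real:
  fixes f :: "'a \<Rightarrow> real"
  assumes "C summable_on A" "\<And>x. x \<in> A \<Longrightarrow> \<bar>f x\<bar> \<le> C x"
  shows "f summable_on A"
proof (rule abs_summable_summable)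
  show "(\<lambda>x. norm (f x)) summable_on A"
    by (rule Infinite_Sum.abs_summable_on_comparison_test'[OF assms(1)]) (simp add: assms(2))
qed

lemma summable_on_abs:
  fixes f :: "'a \<Rightarrow> real"
  shows "f summable_on A \<Longrightarrow> (\<lambda>x. \<bar>f x\<bar>) summable_on A"
  using summable_on_iff_abs_summable_on_real[of f A] by simp

lemma infsum_abs_le:
  fixes f :: "'a \<Rightarrow> real"
  assumes "C summable_on A" "\<And>x. x \<in> A \<Longrightarrow> \<bar>f x\<bar> \<le> C x"
  shows "\<bar>\<Sum>\<^sub>\<infinity>x\<in>A. f x\<bar> \<le> (\<Sum>\<^sub>\<infinity>x\<in>A. C x)"
proof -
  have f: "f summable_on A" by (rule summable_on_comparison_real[OF assms])
  have le: "f x \<le> C x" "- f x \<le> C x" if "x \<in> A" for x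
    using assms(2)[OF that] by auto
  have "(\<Sum>\<^sub>\<infinity>x\<in>A. f x) \<le> (\<Sum>\<^sub>\<infinity>x\<in>A. C x)"
    by (rule infsum_mono[OF f assms(1) le(1)])
  moreover have "(\<Sum>\<^sub>\<infinity>x\<in>A. - f x) \<le> (\<Sum>\<^sub>\<infinity>x\<in>A. C x)"
    using f by (intro infsum_mono[OF _ assms(1) le(2)]) (simp add: summable_on_uminus)
  ultimately show ?thesis by (simp add: infsum_uminus abs_le_iff)
qed

lemma infsum_uniform_continuous:
  fixes f :: "'i \<Rightarrow> 'a::topological_space \<Rightarrow> real"
  assumes "C summable_on I" "\<And>i x. i \<in> I \<Longrightarrow> x \<in> A \<Longrightarrow> \<bar>f i x\<bar> \<le> C i" "\<And>i. i \<in> I \<Longrightarrow> continuous_on A (f i)"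
  shows "continuous_on A (\<lambda>x. \<Sum>\<^sub>\<infinity>i\<in>I. f i x)"
proof (rule uniform_limit_theorem)
  show "uniform_limit A (\<lambda>X x. \<Sum>i\<in>X. f i x) (\<lambda>x. \<Sum>\<^sub>\<infinity>i\<in>I. f i x) (finite_subsets_at_top I)"
    by (rule Weierstrass_m_test_general[where M = C]) (use assms in auto)
  show "\<forall>\<^sub>F X in finite_subsets_at_top I. continuous_on A (\<lambda>x. \<Sum>i\<in>X. f i x)"
    by (rule eventually_finite_subsets_at_top_weakI) (use assms(3) in \<open>auto intro!: continuous_on_sum\<close>)
qed (rule finite_subsets_at_top_neq_bot)

text \<open>An enumeration of the countable index type turns unordered sums into series, for which
  absolute convergence permits the exchange with the integral. The factor \<open>w\<close> admits
  domination by an integrable, possibly unbounded, function.\<close>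

lemma
  fixes f :: "'i::countable \<Rightarrow> 'a \<Rightarrow> real"
  assumes inf: "infinite (UNIV :: 'i set)"
    and meas: "\<And>i. f i \<in> borel_measurable M"
    and w: "integrable M w" "\<And>x. x \<in> space M \<Longrightarrow> 0 \<le> w x"
    and C: "C summable_on UNIV"
    and le: "\<And>i x. x \<in> space M \<Longrightarrow> \<bar>f i x\<bar> \<le> C i * w x"
  shows integral_infsum: "(LINT x|M. (\<Sum>\<^sub>\<infinity>i. f i x)) = (\<Sum>\<^sub>\<infinity>i. (LINT x|M. f i x))"
    and summable_on_integral: "(\<lambda>i. LINT x|M. f i x) summable_on UNIV"
proof -
  define e where "e = from_nat_into (UNIV :: 'i set)"
  have bij: "bij_betw e UNIV UNIV"
    unfolding e_def by (rule bij_betw_from_nat_into) (use inf in auto)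
  have to_nat: "(\<lambda>n. g (e n)) sums (\<Sum>\<^sub>\<infinity>i. g i)" if "g summable_on UNIV" for g :: "'i \<Rightarrow> real"
  proof (rule has_sum_imp_sums)
    show "((\<lambda>n. g (e n)) has_sum (\<Sum>\<^sub>\<infinity>i. g i)) UNIV"
      using that by (simp add: has_sum_reindex_bij_betw[OF bij])
  qed
  have fint: "integrable M (f i)" for i
    by (rule Bochner_Integration.integrable_bound[where f = "\<lambda>x. C i * w x"])
       (use w meas le in \<open>auto intro!: AE_I2 intro: order_trans[OF _ abs_ge_self]\<close>)
  have fsum: "(\<lambda>i. f i x) summable_on UNIV" if "x \<in> space M" for x
    by (rule summable_on_comparison_real[where C = "\<lambda>i. C i * w x"])
       (use that le C in \<open>auto intro: summable_on_cmult_left\<close>)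
  have bound: "\<bar>LINT x|M. f i x\<bar> \<le> (LINT x|M. \<bar>f i x\<bar>)" "(LINT x|M. \<bar>f i x\<bar>) \<le> C i * (LINT x|M. w x)" for i
  proof -
    show "\<bar>LINT x|M. f i x\<bar> \<le> (LINT x|M. \<bar>f i x\<bar>)" by (rule integral_abs_bound)
    have "(LINT x|M. \<bar>f i x\<bar>) \<le> (LINT x|M. C i * w x)"
      by (rule integral_mono) (use fint w le in auto)
    then show "(LINT x|M. \<bar>f i x\<bar>) \<le> C i * (LINT x|M. w x)" by simp
  qed
  have Cw: "(\<lambda>i. C i * (LINT x|M. w x)) summable_on UNIV"
    using C by (rule summable_on_cmult_left)
  show isum: "(\<lambda>i. LINT x|M. f i x) summable_on UNIV"
    by (rule summable_on_comparison_real[OF Cw]) (use bound order_trans in blast)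
  have abs1: "AE x in M. summable (\<lambda>n. norm (f (e n) x))"
  proof (rule AE_I2)
    fix x assume "x \<in> space M"
    then have "(\<lambda>i. \<bar>f i x\<bar>) summable_on UNIV"
      by (intro summable_on_abs fsum)
    from sums_summable[OF to_nat[OF this]] show "summable (\<lambda>n. norm (f (e n) x))" by simp
  qed
  have "(\<lambda>i. LINT x|M. \<bar>f i x\<bar>) summable_on UNIV"
    by (rule summable_on_comparison_real[OF Cw]) (use bound in auto)
  from sums_summable[OF to_nat[OF this]] have abs2: "summable (\<lambda>n. LINT x|M. norm (f (e n) x))" by simp
  have eq: "(\<Sum>n. f (e n) x) = (\<Sum>\<^sub>\<infinity>i. f i x)" if "x \<in> space M" for x
    using to_nat[OF fsum[OF that]] by (rule sums_unique[symmetric])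
  have "(LINT x|M. (\<Sum>\<^sub>\<infinity>i. f i x)) = (LINT x|M. (\<Sum>n. f (e n) x))"
    using eq by (intro Bochner_Integration.integral_cong) auto
  also have "\<dots> = (\<Sum>n. (LINT x|M. f (e n) x))"
    by (rule integral_suminf[OF fint abs1 abs2])
  also have "\<dots> = (\<Sum>\<^sub>\<infinity>i. (LINT x|M. f i x))"
    using to_nat[OF isum] by (rule sums_unique[symmetric])
  finally show "(LINT x|M. (\<Sum>\<^sub>\<infinity>i. f i x)) = (\<Sum>\<^sub>\<infinity>i. (LINT x|M. f i x))" .
qed

lemma infinite_int3: "infinite (UNIV :: (int^3) set)"
  by (rule infinite_UNIV_vec) (rule infinite_UNIV_int)

text \<open>Only the odd part of \<open>b\<close> is visible at phase 0; for odd \<open>b\<close>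
  the Fourier coefficient at \<open>k\<close> is \<open>- \<i> * b k\<close>, see
  \<open>fourier_coeff_series\<close>. Other phases arise from derivatives.\<close>

definition series :: "(int^3 \<Rightarrow> real) \<Rightarrow> real \<Rightarrow> real^3 \<Rightarrow> real" where
  "series b \<phi> x = (\<Sum>\<^sub>\<infinity>k. b k * wave k \<phi> x)"

lemma series_term_le: "\<bar>b k * wave k \<phi> x\<bar> \<le> \<bar>b k\<bar>"
  using mult_left_mono[OF wave_abs_le[of k \<phi> x], of "\<bar>b k\<bar>"] by (simp add: abs_mult)

lemma series_term_summable:
  assumes "b summable_on UNIV"
  shows "(\<lambda>k. b k * wave k \<phi> x) summable_on UNIV"
  by (intro summable_on_comparison_real[OF summable_on_abs[OF assms]] series_term_le)

lemma series_abs_le: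
  assumes "b summable_on UNIV"
  shows "\<bar>series b \<phi> x\<bar> \<le> (\<Sum>\<^sub>\<infinity>k. \<bar>b k\<bar>)"
  unfolding series_def by (intro infsum_abs_le summable_on_abs[OF assms] series_term_le)

lemma continuous_series:
  assumes "b summable_on UNIV"
  shows "continuous_on A (series b \<phi>)"
  unfolding series_def[abs_def]
  by (intro infsum_uniform_continuous[OF summable_on_abs[OF assms]] series_term_le continuous_intros)

lemma periodic_series: "periodic (series b \<phi>)"
  using periodic_wave by (simp add: periodic_def series_def)

lemma series_add:
  assumes "b summable_on UNIV" "c summable_on UNIV"
  shows "series (\<lambda>k. b k + c k) \<phi> x = series b \<phi> x + series c \<phi> x"
  using infsum_add[OF series_term_summable[OF assms(1)] series_term_summable[OF assms(2)]]
  by (simp add: series_def distrib_right)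

lemma series_cmult: "series (\<lambda>k. c * b k) \<phi> x = c * series b \<phi> x"
  by (simp add: series_def mult.assoc infsum_cmult_right')

lemma series_diff:
  assumes "b summable_on UNIV" "c summable_on UNIV"
  shows "series (\<lambda>k. b k - c k) \<phi> x = series b \<phi> x - series c \<phi> x"
proof -
  have "(\<lambda>k. (- 1) * c k) summable_on UNIV"
    using assms(2) by (rule summable_on_cmult_right)
  from series_add[OF assms(1) this] show ?thesis by (simp only: series_cmult) simp
qed

lemma
  assumes b: "b summable_on UNIV" and g: "integrable torus g"
  shows integral_series_mult: "(LINT x|torus. series b \<phi> x * g x) = (\<Sum>\<^sub>\<infinity>k. b k * (LINT x|torus. wave k \<phi> x * g x))"
    and summable_series_mult: "(\<lambda>k. b k * (LINT x|torus. wave k \<phi> x * g x)) summable_on UNIV"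
proof -
  let ?f = "\<lambda>k x. b k * wave k \<phi> x * g x"
  have meas: "?f k \<in> borel_measurable torus" for k
    using borel_measurable_integrable[OF g]
    by (intro borel_measurable_times borel_measurable_const continuous_measurable_torus[OF continuous_wave])
  have w: "integrable torus (\<lambda>x. \<bar>g x\<bar>)" using g by (rule integrable_abs)
  have C: "(\<lambda>k. \<bar>b k\<bar>) summable_on UNIV" using b by (rule summable_on_abs)
  have le: "\<bar>?f k x\<bar> \<le> \<bar>b k\<bar> * \<bar>g x\<bar>" for k x
    using mult_right_mono[OF series_term_le[of b k \<phi> x] abs_ge_zero[of "g x"]] by (simp add: abs_mult)
  have "(LINT x|torus. (\<Sum>\<^sub>\<infinity>k. ?f k x)) = (\<Sum>\<^sub>\<infinity>k. (LINT x|torus. ?f k x))"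
    by (rule integral_infsum[OF infinite_int3 meas w _ C le]) simp
  then show "(LINT x|torus. series b \<phi> x * g x) = (\<Sum>\<^sub>\<infinity>k. b k * (LINT x|torus. wave k \<phi> x * g x))"
    by (simp only: series_def infsum_cmult_left'[symmetric] mult.assoc integral_mult_right_zero)
  have "(\<lambda>k. LINT x|torus. ?f k x) summable_on UNIV"
    by (rule summable_on_integral[OF infinite_int3 meas w _ C le]) simp
  then show "(\<lambda>k. b k * (LINT x|torus. wave k \<phi> x * g x)) summable_on UNIV"
    by (simp add: mult.assoc)
qed

text \<open>Product-to-sum leaves the frequencies \<open>p - k\<close> and \<open>p + k\<close>, and
  only the zero frequency has a nonzero mean. For \<open>p = k = 0\<close> both conditions hold and
  the difference of cosines is still the right value.\<close>

lemma integral_wave_wave: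
  "(LINT x|torus. wave p \<phi> x * wave k \<theta> x)
    = (2 * pi) ^ 3 / 2 * ((if p = k then cos (\<phi> - \<theta>) else 0) - (if p = - k then cos (\<phi> + \<theta>) else 0))"
proof -
  have sin_shift: "sin (t + pi / 2) = cos t" for t :: real
    by (simp add: sin_add)
  have "(LINT x|torus. wave p \<phi> x * wave k \<theta> x)
     = ((LINT x|torus. wave (p - k) (\<phi> - \<theta> + pi / 2) x) - (LINT x|torus. wave (p + k) (\<phi> + \<theta> + pi / 2) x)) / 2"
    unfolding wave_mult by (simp add: integrable_torus_continuous continuous_wave)
  moreover have "(if P then c * u else 0) = c * (if P then u else 0)" for P and c u :: real
    by simp
  ultimately show ?thesis
    unfolding integral_wave sin_shift right_minus_eq eq_neg_iff_add_eq_0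
    by (simp only: right_diff_distrib diff_divide_distrib times_divide_eq_left)
qed

lemma infsum_single:
  fixes f :: "'a \<Rightarrow> real"
  assumes "\<And>x. x \<noteq> a \<Longrightarrow> f x = 0"
  shows "(f has_sum f a) UNIV"
  by (rule has_sum_finite_neutralI[of "{a}"]) (use assms in auto)

lemma integral_series_wave:
  assumes b: "b summable_on UNIV"
  shows "(LINT x|torus. series b \<phi> x * wave k \<theta> x)
    = (2 * pi) ^ 3 / 2 * (b k * cos (\<phi> - \<theta>) - b (- k) * cos (\<phi> + \<theta>))"
proof -
  let ?c = "(2 * pi) ^ 3 / 2"
  let ?f = "\<lambda>p. ?c * b p * (if p = k then cos (\<phi> - \<theta>) else 0)"
  let ?g = "\<lambda>p. - ?c * b p * (if p = - k then cos (\<phi> + \<theta>) else 0)"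
  have "((\<lambda>p. ?f p + ?g p) has_sum (?f k + ?g (- k))) UNIV"
    by (intro has_sum_add infsum_single) auto
  moreover have "?f p + ?g p = b p * (LINT x|torus. wave p \<phi> x * wave k \<theta> x)" for p
    unfolding integral_wave_wave by (simp add: algebra_simps)
  ultimately have "(\<Sum>\<^sub>\<infinity>p. b p * (LINT x|torus. wave p \<phi> x * wave k \<theta> x)) = ?f k + ?g (- k)"
    by (intro infsumI) (simp only:)
  moreover have "?f k + ?g (- k) = ?c * (b k * cos (\<phi> - \<theta>) - b (- k) * cos (\<phi> + \<theta>))"
    by (simp add: algebra_simps)
  ultimately show ?thesis
    using integral_series_mult[OF b integrable_torus_continuous[OF continuous_wave], of \<phi> k \<theta>]
    by (simp only:)
qed

lemma fourier_coeff_eq: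
  assumes f: "integrable torus f"
  shows "fourier_coeff f k = Complex ((LINT x|torus. f x * wave k (pi / 2) x) / (2 * pi) ^ 3)
     (- (LINT x|torus. f x * wave k 0 x) / (2 * pi) ^ 3)"
proof -
  have i: "integrable torus (\<lambda>x. f x * wave k \<phi> x)" for \<phi>
    by (intro integrable_torus_mult_continuous f continuous_wave)
  have "complex_of_real (f x) * cis (- (freq k \<bullet> x))
     = complex_of_real (f x * wave k (pi / 2) x) - \<i> * complex_of_real (f x * wave k 0 x)" for x
    by (simp add: complex_eq_iff wave_def sin_add)
  then have "(LINT x|torus. complex_of_real (f x) * cis (- (freq k \<bullet> x)))
     = (LINT x|torus. complex_of_real (f x * wave k (pi / 2) x) - \<i> * complex_of_real (f x * wave k 0 x))"
    by simp
  also have "\<dots> = complex_of_real (LINT x|torus. f x * wave k (pi / 2) x) - \<i> * complex_of_real (LINT x|torus. f x * wave k 0 x)"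
  proof (subst Bochner_Integration.integral_diff)
    have c: "complex_integrable torus (\<lambda>x. complex_of_real (f x * wave k \<phi> x))" for \<phi>
      by (rule integrable_of_real) (rule i)
    show "complex_integrable torus (\<lambda>x. complex_of_real (f x * wave k (pi / 2) x))" by (rule c)
    show "complex_integrable torus (\<lambda>x. \<i> * complex_of_real (f x * wave k 0 x))"
      by (rule integrable_mult_right) (rule c)
  qed (simp only: integral_mult_right_zero integral_complex_of_real)
  finally show ?thesis
    unfolding fourier_coeff_def by (simp add: complex_eq_iff)
qed

lemma fourier_coeff_series:
  assumes b: "b summable_on UNIV"
  shows "fourier_coeff (series b 0) k = Complex 0 (- (b k - b (- k)) / 2)"
  unfolding fourier_coeff_eq[OF integrable_torus_continuous[OF continuous_series[OF b]]] integral_series_wave[OF b]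
  by (simp add: field_simps)

lemma fourier_coeff_cong_AE:
  assumes "AE x in torus. f x = g x" "f \<in> borel_measurable torus" "g \<in> borel_measurable torus"
  shows "fourier_coeff f k = fourier_coeff g k"
proof -
  have c: "(\<lambda>x. cis (- (freq k \<bullet> x))) \<in> borel_measurable torus"
    by (intro continuous_measurable_torus continuous_intros)
  have "(LINT x|torus. complex_of_real (f x) * cis (- (freq k \<bullet> x)))
      = (LINT x|torus. complex_of_real (g x) * cis (- (freq k \<bullet> x)))"
  proof (rule integral_cong_AE)
    show "(\<lambda>x. complex_of_real (f x) * cis (- (freq k \<bullet> x))) \<in> borel_measurable torus"
      "(\<lambda>x. complex_of_real (g x) * cis (- (freq k \<bullet> x))) \<in> borel_measurable torus"
      using assms(2,3) c by measurable
    show "AE x in torus. complex_of_real (f x) * cis (- (freq k \<bullet> x)) = complex_of_real (g x) * cis (- (freq k \<bullet> x))"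
      using assms(1) by eventually_elim simp
  qed
  then show ?thesis by (simp add: fourier_coeff_def)
qed

section \<open>Sobolev norms of trigonometric series\<close>

text \<open>A bracket of the form \<open>1 + |k|\<close> rather than the square root of
  \<open>1 + |k|^2\<close>: it is at least 1, subadditive and submultiplicative by the triangle
  inequality alone.\<close>

definition jap :: "int^3 \<Rightarrow> real" where
  "jap k = 1 + norm (freq k)"

lemma jap_ge_1: "1 \<le> jap k"
  by (simp add: jap_def)

lemma jap_pos: "0 < jap k"
  using jap_ge_1[of k] by linarith

lemma jap_minus [simp]: "jap (- k) = jap k"
  by (simp add: jap_def)

section \<open>Lebesgue norms compared with suprema and Fourier coefficients\<close>

lemma finite_exponent_ge_1:
  assumes "1 \<le> p" "p \<noteq> \<infinity>"
  shows "1 \<le> enn2real p"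
  using enn2real_mono[of 1 p] assms by (simp add: top.not_eq_extremum)

lemma Lp_measurable: "f \<in> Lp p \<Longrightarrow> f \<in> borel_measurable torus"
  by (simp add: Lp_def measurable_torus)

text \<open>Takes the place of Hoelder's inequality: integrated with a free \<open>c > 0\<close>, it
  bounds the \<open>L^1\<close> norm by the \<open>L^q\<close> norm once \<open>c\<close> is chosen
  equal to the latter.\<close>

lemma abs_le_powr:
  fixes y c q :: real
  assumes "0 < c" "1 \<le> q"
  shows "\<bar>y\<bar> \<le> c + c powr (1 - q) * \<bar>y\<bar> powr q"
proof (cases "\<bar>y\<bar> \<le> c")
  case True
  then show ?thesis by (simp add: add_increasing2)
next
  case False
  then have y: "c < \<bar>y\<bar>" by simp
  then have "\<bar>y\<bar> = \<bar>y\<bar> powr (1 - q) * \<bar>y\<bar> powr q"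
    using assms by (simp add: powr_add[symmetric])
  also have "\<dots> \<le> c powr (1 - q) * \<bar>y\<bar> powr q"
    using y assms by (intro mult_right_mono powr_mono2') auto
  finally show ?thesis using assms by simp
qed

lemma Lp_integrable:
  assumes f: "f \<in> Lp p" and p: "1 \<le> p"
  shows "integrable torus f"
proof (cases "p = \<infinity>")
  case True
  then obtain C where "AE x in torus. \<bar>f x\<bar> \<le> C" using f by (auto simp: Lp_def)
  then show ?thesis
    using Lp_measurable[OF f] by (intro torus.integrable_const_bound[where B = C]) auto
next
  case False
  let ?q = "enn2real p"
  have q: "1 \<le> ?q" by (rule finite_exponent_ge_1[OF p False])
  have "integrable torus (\<lambda>x. 1 + 1 powr (1 - ?q) * \<bar>f x\<bar> powr ?q)"
    using f False by (simp add: Lp_def)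
  then show ?thesis
    by (rule Bochner_Integration.integrable_bound)
       (use Lp_measurable[OF f] abs_le_powr[OF zero_less_one q] in \<open>auto intro!: AE_I2\<close>)
qed

lemma continuous_in_Lp:
  assumes "periodic f" "continuous_on UNIV f" "1 \<le> p"
  shows "f \<in> Lp p"
proof -
  obtain C where C: "\<And>x. x \<in> space torus \<Longrightarrow> norm (f x) \<le> C"
    using continuous_bounded_torus[OF assms(2)] by blast
  have m: "f \<in> borel_measurable lebesgue" by (rule continuous_measurable_lebesgue[OF assms(2)])
  have "AE x in torus. \<bar>f x\<bar> \<le> C" using C by (intro AE_I2) auto
  moreover have "integrable torus (\<lambda>x. \<bar>f x\<bar> powr enn2real p)" if "p \<noteq> \<infinity>"
  proof (rule torus.integrable_const_bound[where B = "C powr enn2real p"])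
    have "1 \<le> enn2real p" by (rule finite_exponent_ge_1[OF assms(3) that])
    then show "AE x in torus. norm (\<bar>f x\<bar> powr enn2real p) \<le> C powr enn2real p"
      using C by (intro AE_I2) (auto intro!: powr_mono2)
    show "(\<lambda>x. \<bar>f x\<bar> powr enn2real p) \<in> borel_measurable torus"
      using measurable_torus[OF m] by measurable
  qed
  ultimately show ?thesis unfolding Lp_def using assms(1) m by (cases "p = \<infinity>") auto
qed

text \<open>The volume is at least 1 and so dominates its own power \<open>1 / q\<close> for every
  \<open>q \<ge> 1\<close>; one constant then serves all exponents, infinity included.\<close>

lemma Lp_norm_le:
  assumes m: "f \<in> borel_measurable torus" and C: "\<And>x. \<bar>f x\<bar> \<le> C" and p: "1 \<le> p"
  shows "Lp_norm p f \<le> (2 * pi) ^ 3 * C"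
proof -
  have C0: "0 \<le> C" using C[of 0] by linarith
  have V: "1 \<le> (2 * pi) ^ 3" using pi_gt3 by (intro one_le_power) simp
  show ?thesis
  proof (cases "p = \<infinity>")
    case True
    have "Lp_norm p f \<le> C"
      unfolding Lp_norm_def using True C C0
      by (auto intro!: cInf_lower bdd_belowI[of _ 0])
    also have "\<dots> \<le> (2 * pi) ^ 3 * C" using mult_right_mono[OF V C0] by simp
    finally show ?thesis .
  next
    case False
    let ?q = "enn2real p"
    have q: "1 \<le> ?q" by (rule finite_exponent_ge_1[OF p False])
    have le: "\<bar>f x\<bar> powr ?q \<le> C powr ?q" for x
      using C q by (intro powr_mono2) auto
    have int: "integrable torus (\<lambda>x. \<bar>f x\<bar> powr ?q)"
      by (rule torus.integrable_const_bound[where B = "C powr ?q"]) (use m le in auto)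
    have "(LINT x|torus. \<bar>f x\<bar> powr ?q) \<le> (LINT x|torus. C powr ?q)"
      by (rule integral_mono[OF int]) (use le in auto)
    also have "\<dots> = (2 * pi) ^ 3 * C powr ?q"
      by (simp add: measure_torus)
    finally have "(LINT x|torus. \<bar>f x\<bar> powr ?q) powr (1 / ?q) \<le> ((2 * pi) ^ 3 * C powr ?q) powr (1 / ?q)"
      using q by (intro powr_mono2) auto
    also have "\<dots> = ((2 * pi) ^ 3) powr (1 / ?q) * (C powr ?q) powr (1 / ?q)"
      by (rule powr_mult)
    also have "(C powr ?q) powr (1 / ?q) = C"
      using C0 q by (simp add: powr_powr)
    also have "((2 * pi) ^ 3) powr (1 / ?q) * C \<le> ((2 * pi) ^ 3) powr 1 * C"
      using V q C0 by (intro mult_right_mono powr_mono) auto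
    finally show ?thesis using False V by (simp add: Lp_norm_def)
  qed
qed

lemma cmod_fourier_coeff_le: "cmod (fourier_coeff f k) \<le> (LINT x|torus. \<bar>f x\<bar>) / (2 * pi) ^ 3"
proof -
  have "cmod (LINT x|torus. complex_of_real (f x) * cis (- (freq k \<bullet> x)))
     \<le> (LINT x|torus. cmod (complex_of_real (f x) * cis (- (freq k \<bullet> x))))"
    by (rule integral_norm_bound)
  then show ?thesis
    unfolding fourier_coeff_def by (simp add: norm_divide norm_mult norm_power divide_right_mono)
qed

text \<open>The coefficient is at most the mean of \<open>|f|\<close>, and the mean is at most
  \<open>(V + 1) / V \<le> 2\<close> times the norm, where \<open>V\<close> is the volume.\<close>

lemma fourier_coeff_le_Lp_norm:
  assumes f: "f \<in> Lp p" and p: "1 \<le> p"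
  shows "cmod (fourier_coeff f k) \<le> 2 * Lp_norm p f"
proof -
  let ?I = "LINT x|torus. \<bar>f x\<bar>" and ?V = "(2 * pi) ^ 3 :: real"
  have V: "1 \<le> ?V" using pi_gt3 by (intro one_le_power) simp
  have fi: "integrable torus (\<lambda>x. \<bar>f x\<bar>)" using Lp_integrable[OF f p] by (rule integrable_abs)
  have "?I \<le> (?V + 1) * Lp_norm p f"
  proof (cases "p = \<infinity>")
    case True
    let ?S = "{C. 0 \<le> C \<and> (AE x in torus. \<bar>f x\<bar> \<le> C)}"
    obtain C where "AE x in torus. \<bar>f x\<bar> \<le> C" using f True by (auto simp: Lp_def)
    then have "AE x in torus. \<bar>f x\<bar> \<le> max 0 C" by eventually_elim simp
    then have ne: "max 0 C \<in> ?S" by simp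
    have "?I / (?V + 1) \<le> c" if c: "c \<in> ?S" for c
    proof -
      have "?I \<le> (LINT x|torus. c)"
        using c by (intro integral_mono_AE fi) auto
      also have "\<dots> = ?V * c" by (simp add: measure_torus)
      also have "\<dots> \<le> (?V + 1) * c" using c by (intro mult_right_mono) auto
      finally show ?thesis using V by (simp add: pos_divide_le_eq mult.commute)
    qed
    then have "?I / (?V + 1) \<le> Inf ?S" using ne by (intro cInf_greatest) blast+
    then show ?thesis using V True by (simp add: Lp_norm_def pos_divide_le_eq mult.commute)
  next
    case False
    let ?q = "enn2real p" and ?J = "LINT x|torus. \<bar>f x\<bar> powr enn2real p"
    have q: "1 \<le> ?q" by (rule finite_exponent_ge_1[OF p False])
    have int: "integrable torus (\<lambda>x. \<bar>f x\<bar> powr ?q)" using f False by (simp add: Lp_def)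
    have I: "?I \<le> ?V * c + c powr (1 - ?q) * ?J" if c: "0 < c" for c
    proof -
      have "?I \<le> (LINT x|torus. c + c powr (1 - ?q) * \<bar>f x\<bar> powr ?q)"
        using int abs_le_powr[OF c q] by (intro integral_mono fi) auto
      also have "\<dots> = ?V * c + c powr (1 - ?q) * ?J"
        using int by (simp add: measure_torus)
      finally show ?thesis .
    qed
    have J0: "0 \<le> ?J" by simp
    show ?thesis
    proof (cases "?J = 0")
      case True
      \<comment> \<open>Here the norm is zero and cannot serve as \<open>c\<close>; arbitrarily
        small \<open>c\<close> are used instead.\<close>
      have "?I \<le> 0"
      proof (rule field_le_epsilon)
        fix e :: real assume e: "0 < e"
        then have "0 < e / ?V" using V by simp
        from I[OF this] show "?I \<le> 0 + e" using True V by simp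
      qed
      then show ?thesis using False True by (simp add: Lp_norm_def)
    next
      case J: False
      then have Jpos: "0 < ?J" using J0 by linarith
      \<comment> \<open>With \<open>c\<close> equal to the norm, \<open>c powr (1 - q)\<close> times
        the integral is the norm again, so both terms of the bound are multiples of it.\<close>
      let ?N = "?J powr (1 / ?q)"
      have "?N powr (1 - ?q) * ?J = ?J powr ((1 - ?q) / ?q) * ?J powr 1"
        using Jpos by (simp add: powr_powr)
      also have "\<dots> = ?J powr ((1 - ?q) / ?q + 1)"
        by (rule powr_add[symmetric])
      also have "(1 - ?q) / ?q + 1 = 1 / ?q"
        using q by (simp add: field_simps)
      finally have "?N powr (1 - ?q) * ?J = ?N" .
      moreover have "0 < ?N" using Jpos by simp
      ultimately have "?I \<le> (?V + 1) * ?N" using I[of ?N] by (simp add: algebra_simps)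
      then show ?thesis using False by (simp add: Lp_norm_def)
    qed
  qed
  moreover have "0 \<le> ?I" by simp
  ultimately have N: "0 \<le> Lp_norm p f"
    using V by (smt (verit) mult_neg_pos mult.commute)
  have "cmod (fourier_coeff f k) \<le> ?I / ?V" by (rule cmod_fourier_coeff_le)
  also have "\<dots> \<le> (?V + 1) * Lp_norm p f / ?V"
    using \<open>?I \<le> (?V + 1) * Lp_norm p f\<close> V by (intro divide_right_mono) auto
  also have "\<dots> \<le> (2 * ?V) * Lp_norm p f / ?V"
    using V N by (intro divide_right_mono mult_right_mono) auto
  also have "\<dots> = 2 * Lp_norm p f" using V by simp
  finally show ?thesis .
qed

lemma Lp_norm_cong_AE:
  assumes "AE x in torus. f x = g x" "f \<in> borel_measurable torus" "g \<in> borel_measurable torus"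
  shows "Lp_norm p f = Lp_norm p g"
proof -
  have "(AE x in torus. \<bar>f x\<bar> \<le> C) \<longleftrightarrow> (AE x in torus. \<bar>g x\<bar> \<le> C)" for C
  proof
    assume "AE x in torus. \<bar>f x\<bar> \<le> C"
    with assms(1) show "AE x in torus. \<bar>g x\<bar> \<le> C" by eventually_elim simp
  next
    assume "AE x in torus. \<bar>g x\<bar> \<le> C"
    with assms(1) show "AE x in torus. \<bar>f x\<bar> \<le> C" by eventually_elim simp
  qed
  moreover have "(LINT x|torus. \<bar>f x\<bar> powr enn2real p) = (LINT x|torus. \<bar>g x\<bar> powr enn2real p)"
  proof (rule integral_cong_AE)
    show "AE x in torus. \<bar>f x\<bar> powr enn2real p = \<bar>g x\<bar> powr enn2real p"
      using assms(1) by eventually_elim simp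
  qed (use assms in measurable)
  ultimately show ?thesis by (simp add: Lp_norm_def)
qed

lemma Lp_eq_AE:
  assumes "f \<in> Lp p" "g \<in> Lp q" "1 \<le> p" "1 \<le> q"
    and eq: "\<And>k \<phi>. (LINT x|torus. f x * wave k \<phi> x) = (LINT x|torus. g x * wave k \<phi> x)"
  shows "AE x in torus. f x = g x"
proof -
  have i: "integrable torus f" "integrable torus g" using assms Lp_integrable by blast+
  then have "AE x in torus. f x - g x = 0"
    using eq by (intro moments_zero_imp_AE_zero)
      (auto simp: left_diff_distrib integrable_torus_mult_continuous continuous_wave)
  then show ?thesis by eventually_elim simp
qed

lemma wave_decompose:
  "wave k \<phi> x = sin \<phi> * wave k (pi / 2) x + cos \<phi> * wave k 0 x"
  by (simp add: wave_def sin_add mult.commute)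

lemma moments_eq_iff_fourier_coeff:
  assumes f: "integrable torus f" and g: "integrable torus g"
  shows "fourier_coeff f k = fourier_coeff g k \<longleftrightarrow>
    (\<forall>\<phi>. (LINT x|torus. f x * wave k \<phi> x) = (LINT x|torus. g x * wave k \<phi> x))"
proof -
  have dec: "(LINT x|torus. h x * wave k \<phi> x)
      = sin \<phi> * (LINT x|torus. h x * wave k (pi / 2) x) + cos \<phi> * (LINT x|torus. h x * wave k 0 x)"
    if h: "integrable torus h" for h \<phi>
  proof -
    have "(LINT x|torus. h x * wave k \<phi> x)
      = (LINT x|torus. sin \<phi> * (h x * wave k (pi / 2) x) + cos \<phi> * (h x * wave k 0 x))"
      unfolding wave_decompose[of k \<phi>] by (simp add: algebra_simps)
    also have "\<dots> = (LINT x|torus. sin \<phi> * (h x * wave k (pi / 2) x)) + (LINT x|torus. cos \<phi> * (h x * wave k 0 x))"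
      by (intro Bochner_Integration.integral_add integrable_mult_right integrable_torus_mult_continuous continuous_wave h)
    finally show ?thesis by simp
  qed
  show ?thesis
  proof
    assume "fourier_coeff f k = fourier_coeff g k"
    then have eq: "(LINT x|torus. f x * wave k (pi / 2) x) = (LINT x|torus. g x * wave k (pi / 2) x)"
      "(LINT x|torus. f x * wave k 0 x) = (LINT x|torus. g x * wave k 0 x)"
      by (simp_all add: fourier_coeff_eq f g)
    show "\<forall>\<phi>. (LINT x|torus. f x * wave k \<phi> x) = (LINT x|torus. g x * wave k \<phi> x)"
    proof
      fix \<phi>
      show "(LINT x|torus. f x * wave k \<phi> x) = (LINT x|torus. g x * wave k \<phi> x)"
        unfolding dec[OF f, of \<phi>] dec[OF g, of \<phi>] eq ..
    qed
  next
    assume "\<forall>\<phi>. (LINT x|torus. f x * wave k \<phi> x) = (LINT x|torus. g x * wave k \<phi> x)"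
    then show "fourier_coeff f k = fourier_coeff g k"
      by (simp add: fourier_coeff_eq f g)
  qed
qed

text \<open>Removes the choice operator from the Sobolev norm: waves are test functions, so two weak
  derivatives have the same moments and agree almost everywhere.\<close>

lemma is_weak_deriv_norm_eq:
  assumes g: "is_weak_deriv p \<alpha> f g" and p: "1 \<le> p"
  shows "Lp_norm p (SOME h. is_weak_deriv p \<alpha> f h) = Lp_norm p g"
proof -
  define h where "h = (SOME h. is_weak_deriv p \<alpha> f h)"
  have h: "is_weak_deriv p \<alpha> f h" unfolding h_def by (rule someI[where P = "is_weak_deriv p \<alpha> f", OF g])
  have "(LINT x|torus. h x * wave k \<phi> x) = (LINT x|torus. g x * wave k \<phi> x)" for k \<phi>
    using g h test_function_wave[of k \<phi>] by (simp add: is_weak_deriv_def)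
  then have "AE x in torus. h x = g x"
    using g h p by (intro Lp_eq_AE[of h p g p]) (auto simp: is_weak_deriv_def)
  moreover have "h \<in> borel_measurable torus" "g \<in> borel_measurable torus"
    using g h by (auto simp: is_weak_deriv_def intro: Lp_measurable)
  ultimately show ?thesis unfolding h_def[symmetric] by (rule Lp_norm_cong_AE)
qed

lemma is_bessel_norm_eq:
  assumes g: "is_bessel p s f g" and p: "1 \<le> p"
  shows "Lp_norm p (SOME h. is_bessel p s f h) = Lp_norm p g"
proof -
  define h where "h = (SOME h. is_bessel p s f h)"
  have h: "is_bessel p s f h" unfolding h_def by (rule someI[where P = "is_bessel p s f", OF g])
  have i: "integrable torus g" "integrable torus h"
    using g h p by (auto simp: is_bessel_def intro: Lp_integrable)
  have "fourier_coeff h k = fourier_coeff g k" for k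
    using g h by (simp add: is_bessel_def)
  then have "AE x in torus. h x = g x"
    using g h p moments_eq_iff_fourier_coeff[OF i(2,1)] by (intro Lp_eq_AE[of h p g p]) (auto simp: is_bessel_def)
  moreover have "h \<in> borel_measurable torus" "g \<in> borel_measurable torus"
    using g h by (auto simp: is_bessel_def intro: Lp_measurable)
  ultimately show ?thesis unfolding h_def[symmetric] by (rule Lp_norm_cong_AE)
qed


section \<open>Absolutely convergent sine series in Sobolev spaces\<close>

definition weighted_sum :: "nat \<Rightarrow> (int^3 \<Rightarrow> real) \<Rightarrow> real" where
  "weighted_sum r b = (\<Sum>\<^sub>\<infinity>k. jap k ^ r * \<bar>b k\<bar>)"

definition weighted_summable :: "nat \<Rightarrow> (int^3 \<Rightarrow> real) \<Rightarrow> bool" where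
  "weighted_summable r b \<longleftrightarrow> (\<lambda>k. jap k ^ r * \<bar>b k\<bar>) summable_on UNIV"

lemma multiplier_summable:
  assumes b: "weighted_summable r b" and m: "\<And>k. \<bar>m k\<bar> \<le> jap k ^ r"
  shows "(\<lambda>k. m k * b k) summable_on UNIV"
    and "(\<Sum>\<^sub>\<infinity>k. \<bar>m k * b k\<bar>) \<le> weighted_sum r b"
proof -
  have le: "\<bar>m k * b k\<bar> \<le> jap k ^ r * \<bar>b k\<bar>" for k
    unfolding abs_mult by (intro mult_right_mono m) simp
  show sum: "(\<lambda>k. m k * b k) summable_on UNIV"
    using b unfolding weighted_summable_def by (rule summable_on_comparison_real) (rule le)
  show "(\<Sum>\<^sub>\<infinity>k. \<bar>m k * b k\<bar>) \<le> weighted_sum r b"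
    unfolding weighted_sum_def
    by (rule infsum_mono[OF summable_on_abs[OF sum]]) (use b le in \<open>auto simp: weighted_summable_def\<close>)
qed

lemma weighted_summable_imp_summable: "weighted_summable r b \<Longrightarrow> b summable_on UNIV"
  using multiplier_summable(1)[of r b "\<lambda>_. 1"] jap_ge_1 by (simp add: one_le_power)

lemma series_multiplier_norm:
  assumes b: "weighted_summable r b" and m: "\<And>k. \<bar>m k\<bar> \<le> jap k ^ r" and p: "1 \<le> p"
  shows "series (\<lambda>k. m k * b k) \<phi> \<in> Lp p"
    and "Lp_norm p (series (\<lambda>k. m k * b k) \<phi>) \<le> (2 * pi) ^ 3 * weighted_sum r b"
proof -
  note s = multiplier_summable[OF b m]
  show "series (\<lambda>k. m k * b k) \<phi> \<in> Lp p"
    by (intro continuous_in_Lp periodic_series continuous_series s p)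
  show "Lp_norm p (series (\<lambda>k. m k * b k) \<phi>) \<le> (2 * pi) ^ 3 * weighted_sum r b"
    by (intro Lp_norm_le continuous_measurable_torus continuous_series s p
        order_trans[OF series_abs_le[OF s(1)] s(2)])
qed

lemma freq_monomial_le: "\<bar>\<Prod>i\<in>UNIV. (freq k $ i) ^ (\<alpha> $ i)\<bar> \<le> jap k ^ multi_order \<alpha>"
proof -
  have "\<bar>\<Prod>i\<in>UNIV. (freq k $ i) ^ (\<alpha> $ i)\<bar> = (\<Prod>i\<in>UNIV. \<bar>freq k $ i\<bar> ^ (\<alpha> $ i))"
    by (simp add: abs_prod power_abs)
  also have "\<dots> \<le> (\<Prod>i\<in>UNIV. jap k ^ (\<alpha> $ i))"
    by (intro prod_mono conjI power_mono zero_le_power)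
       (use component_le_norm_cart[of "freq k"] in \<open>auto simp: jap_def intro: add_increasing\<close>)
  also have "\<dots> = jap k ^ multi_order \<alpha>"
    by (simp add: multi_order_def power_sum)
  finally show ?thesis .
qed

text \<open>The sign from moving the derivatives onto the waves is exactly the sign in the
  definition of a weak derivative, so the monomial in the frequency and the phase are all that
  remains.\<close>

lemma is_weak_deriv_series:
  assumes b: "weighted_summable r b" and \<alpha>: "multi_order \<alpha> \<le> r" and p: "1 \<le> p"
  shows "is_weak_deriv p \<alpha> (series b \<phi>)
    (series (\<lambda>k. (\<Prod>i\<in>UNIV. (freq k $ i) ^ (\<alpha> $ i)) * b k) (\<phi> + real (multi_order \<alpha>) * (pi / 2)))"
proof -
  let ?m = "\<lambda>k. \<Prod>i\<in>UNIV. (freq k $ i) ^ (\<alpha> $ i)"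
  have m: "\<bar>?m k\<bar> \<le> jap k ^ r" for k
    using freq_monomial_le[of k \<alpha>] power_increasing[OF \<alpha> jap_ge_1[of k]] by linarith
  have "(LINT x|torus. series b \<phi> x * multi_partial \<alpha> f x)
      = (- 1) ^ multi_order \<alpha> * (LINT x|torus. series (\<lambda>k. ?m k * b k) (\<phi> + real (multi_order \<alpha>) * (pi / 2)) x * f x)"
    if f: "test_function f" for f
  proof -
    have fi: "integrable torus f" "integrable torus (multi_partial \<alpha> f)"
      using f test_function_multi_partial by (auto intro!: integrable_torus_continuous test_function_continuous)
    have "(LINT x|torus. series b \<phi> x * multi_partial \<alpha> f x)
       = (\<Sum>\<^sub>\<infinity>k. (- 1) ^ multi_order \<alpha> * (?m k * b k * (LINT x|torus. wave k (\<phi> + real (multi_order \<alpha>) * (pi / 2)) x * f x)))"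
      unfolding integral_series_mult[OF weighted_summable_imp_summable[OF b] fi(2)] wave_multi_partial[OF f]
      by (simp only: mult_ac)
    then show ?thesis
      unfolding integral_series_mult[OF multiplier_summable(1)[OF b m] fi(1)] by (simp only: infsum_cmult_right')
  qed
  then show ?thesis
    unfolding is_weak_deriv_def using series_multiplier_norm(1)[OF b m p] by blast
qed

lemma bessel_symbol_le:
  assumes "0 \<le> s"
  shows "\<bar>(1 + (norm (freq k))\<^sup>2) powr (s / 2)\<bar> \<le> jap k ^ nat \<lceil>s\<rceil>"
proof -
  have "1 + (norm (freq k))\<^sup>2 \<le> (jap k)\<^sup>2"
    by (simp add: jap_def power2_eq_square algebra_simps)
  then have "(1 + (norm (freq k))\<^sup>2) powr (s / 2) \<le> ((jap k)\<^sup>2) powr (s / 2)"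
    using assms by (intro powr_mono2) auto
  also have "(jap k)\<^sup>2 = jap k powr 2"
    using jap_pos[of k] by simp
  also have "(jap k powr 2) powr (s / 2) = jap k powr s"
    by (simp add: powr_powr)
  also have "\<dots> \<le> jap k powr real (nat \<lceil>s\<rceil>)"
    using jap_ge_1[of k] by (intro powr_mono) linarith+
  also have "\<dots> = jap k ^ nat \<lceil>s\<rceil>"
    using jap_pos[of k] by (simp add: powr_realpow)
  finally show ?thesis by simp
qed

lemma is_bessel_series:
  assumes b: "weighted_summable (nat \<lceil>s\<rceil>) b" and s: "0 \<le> s" and p: "1 \<le> p"
  shows "is_bessel p s (series b 0) (series (\<lambda>k. (1 + (norm (freq k))\<^sup>2) powr (s / 2) * b k) 0)"
proof -
  note m = bessel_symbol_le[OF s]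
  show ?thesis
    unfolding is_bessel_def
    unfolding fourier_coeff_series[OF multiplier_summable(1)[OF b m]]
      fourier_coeff_series[OF weighted_summable_imp_summable[OF b]]
    using series_multiplier_norm(1)[OF b m p]
    by (simp add: complex_eq_iff algebra_simps)
qed

lemma finite_multi_order_le: "finite {\<alpha>::nat^3. multi_order \<alpha> \<le> n}"
proof (rule finite_subset)
  have "\<alpha> \<in> vec_lambda ` (UNIV \<rightarrow>\<^sub>E {..n})" if "multi_order \<alpha> \<le> n" for \<alpha> :: "nat^3"
  proof -
    have "\<alpha> $ i \<le> multi_order \<alpha>" for i
      unfolding multi_order_def by (rule member_le_sum) auto
    then have "($) \<alpha> \<in> (UNIV \<rightarrow>\<^sub>E {..n})" using that by (auto intro: order_trans)
    then show ?thesis by (intro image_eqI[of _ _ "($) \<alpha>"]) simp_all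
  qed
  then show "{\<alpha>::nat^3. multi_order \<alpha> \<le> n} \<subseteq> vec_lambda ` (UNIV \<rightarrow>\<^sub>E {..n})" by blast
qed (intro finite_imageI finite_PiE; simp)

lemma multi_order_0 [simp]: "multi_order 0 = 0"
  by (simp add: multi_order_def)

text \<open>The interface to an arbitrary admissible space from above: a weighted \<open>l^1\<close>
  norm of the coefficients controls it. Absolute convergence bounds the derivatives in the supremum
  norm, so the weight found in the proof depends on the order of the space and not on its exponent
  \<open>p\<close>.\<close>

lemma sobolev_series:
  assumes X: "admissible X"
  obtains r C where "0 < C"
    "\<And>b. weighted_summable r b \<Longrightarrow> series b 0 \<in> sobolev X"
    "\<And>b. weighted_summable r b \<Longrightarrow> sobolev_norm X (series b 0) \<le> C * weighted_sum r b"
proof (cases X)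
  case (Hsp s p)
  then have s: "0 \<le> s" and p: "1 \<le> p" using X by auto
  show ?thesis
  proof (rule that[of "(2 * pi) ^ 3" "nat \<lceil>s\<rceil>"])
    fix b assume b: "weighted_summable (nat \<lceil>s\<rceil>) b"
    note m = bessel_symbol_le[OF s]
    note bes = is_bessel_series[OF b s p]
    have "series b 0 \<in> Lp p"
      by (intro continuous_in_Lp periodic_series continuous_series weighted_summable_imp_summable[OF b] p)
    then show "series b 0 \<in> sobolev X" using bes Hsp by auto
    show "sobolev_norm X (series b 0) \<le> (2 * pi) ^ 3 * weighted_sum (nat \<lceil>s\<rceil>) b"
      using series_multiplier_norm(2)[OF b m p] Hsp by (simp add: is_bessel_norm_eq[OF bes p])
  qed simp
next
  case (Wkp n p)
  then have p: "1 \<le> p" using X by simp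
  let ?A = "{\<alpha>::nat^3. multi_order \<alpha> \<le> n}" and ?V = "(2 * pi) ^ 3 :: real"
  have A: "finite ?A" "0 \<in> ?A" by (simp_all add: finite_multi_order_le)
  then have cA: "1 \<le> card ?A" using card_gt_0_iff[of ?A] by (metis One_nat_def Suc_leI empty_iff)
  show ?thesis
  proof (rule that[of "real (card ?A) * ?V" n])
    show "0 < real (card ?A) * ?V" using cA by simp
    fix b assume b: "weighted_summable n b"
    note d = is_weak_deriv_series[OF b _ p, of _ 0]
    have "series b 0 \<in> Lp p"
      by (intro continuous_in_Lp periodic_series continuous_series weighted_summable_imp_summable[OF b] p)
    then show "series b 0 \<in> sobolev X" using d Wkp by auto
    let ?N = "\<lambda>\<alpha>. Lp_norm p (SOME g. is_weak_deriv p \<alpha> (series b 0) g)"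
    have W0: "0 \<le> weighted_sum n b" unfolding weighted_sum_def
      using jap_pos by (intro infsum_nonneg) (simp add: less_imp_le)
    have N: "?N \<alpha> \<le> ?V * weighted_sum n b" if \<alpha>: "\<alpha> \<in> ?A" for \<alpha>
    proof -
      have "\<bar>\<Prod>i\<in>UNIV. (freq k $ i) ^ (\<alpha> $ i)\<bar> \<le> jap k ^ n" for k
        using freq_monomial_le[of k \<alpha>] power_increasing[OF _ jap_ge_1[of k], of "multi_order \<alpha>" n] \<alpha> by fastforce
      from series_multiplier_norm(2)[OF b this p] show ?thesis
        using is_weak_deriv_norm_eq[OF d p] \<alpha> by simp
    qed
    show "sobolev_norm X (series b 0) \<le> real (card ?A) * ?V * weighted_sum n b"
    proof (cases "p = \<infinity>")
      case True
      then have "sobolev_norm X (series b 0) = Max (?N ` ?A)" using Wkp by simp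
      also have "\<dots> \<le> ?V * weighted_sum n b"
        using A N by (intro Max.boundedI) blast+
      also have "\<dots> \<le> real (card ?A) * (?V * weighted_sum n b)"
        using cA W0 mult_right_mono[of 1 "real (card ?A)" "?V * weighted_sum n b"] by simp
      finally show ?thesis by (simp only: mult.assoc)
    next
      case False
      let ?q = "enn2real p"
      have q: "1 \<le> ?q" by (rule finite_exponent_ge_1[OF p False])
      have N0: "0 \<le> ?N \<alpha>" for \<alpha> using False by (simp add: Lp_norm_def)
      have "sobolev_norm X (series b 0) = (\<Sum>\<alpha>\<in>?A. ?N \<alpha> powr ?q) powr (1 / ?q)"
        using Wkp False by simp
      also have "\<dots> \<le> (\<Sum>\<alpha>\<in>?A. (?V * weighted_sum n b) powr ?q) powr (1 / ?q)"
        using q N N0 by (intro powr_mono2 sum_mono sum_nonneg) auto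
      also have "\<dots> = (real (card ?A) * (?V * weighted_sum n b) powr ?q) powr (1 / ?q)"
        by simp
      also have "\<dots> = real (card ?A) powr (1 / ?q) * ((?V * weighted_sum n b) powr ?q) powr (1 / ?q)"
        by (rule powr_mult)
      also have "((?V * weighted_sum n b) powr ?q) powr (1 / ?q) = ?V * weighted_sum n b"
        using q W0 by (simp add: powr_powr)
      also have "real (card ?A) powr (1 / ?q) * (?V * weighted_sum n b) \<le> real (card ?A) powr 1 * (?V * weighted_sum n b)"
        using q cA W0 by (intro mult_right_mono powr_mono) auto
      finally show ?thesis using cA by simp
    qed
  qed
qed

text \<open>The counterpart from below. The Bessel symbol is at least 1, and for integer order the
  multi-index 0, whose weak derivative has the coefficients of \<open>f\<close>, is one of the terms
  of the norm. Growth of a single coefficient therefore forces growth in every admissible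
  space.\<close>

lemma fourier_coeff_le_sobolev_norm:
  assumes X: "admissible X" and f: "f \<in> sobolev X"
  shows "cmod (fourier_coeff f k) \<le> 2 * sobolev_norm X f"
proof (cases X)
  case (Hsp s p)
  then have s: "0 \<le> s" and p: "1 \<le> p" using X by auto
  obtain g where g: "is_bessel p s f g" using f Hsp by auto
  have "1 \<le> (1 + (norm (freq k))\<^sup>2) powr (s / 2)"
    using s by (intro ge_one_powr_ge_zero) auto
  then have "cmod (fourier_coeff f k) \<le> (1 + (norm (freq k))\<^sup>2) powr (s / 2) * cmod (fourier_coeff f k)"
    using mult_right_mono[of 1 _ "cmod (fourier_coeff f k)"] by simp
  also have "\<dots> = cmod (fourier_coeff g k)"
    using g by (simp add: is_bessel_def norm_mult)
  also have "\<dots> \<le> 2 * Lp_norm p g"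
    using g p by (intro fourier_coeff_le_Lp_norm) (auto simp: is_bessel_def)
  finally show ?thesis using Hsp by (simp add: is_bessel_norm_eq[OF g p])
next
  case (Wkp n p)
  then have p: "1 \<le> p" using X by simp
  let ?A = "{\<alpha>::nat^3. multi_order \<alpha> \<le> n}"
  let ?N = "\<lambda>\<alpha>. Lp_norm p (SOME g. is_weak_deriv p \<alpha> f g)"
  have fL: "f \<in> Lp p" using f Wkp by simp
  have "multi_order 0 \<le> n" by simp
  then obtain g where g: "is_weak_deriv p 0 f g" using f Wkp by fastforce
  have i: "integrable torus f" "integrable torus g"
    using fL g p by (auto simp: is_weak_deriv_def intro: Lp_integrable)
  have "(LINT x|torus. f x * wave k \<phi> x) = (LINT x|torus. g x * wave k \<phi> x)" for \<phi>
    using g test_function_wave[of k \<phi>] by (simp add: is_weak_deriv_def multi_partial_def)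
  then have "fourier_coeff f k = fourier_coeff g k"
    using moments_eq_iff_fourier_coeff[OF i] by blast
  then have le: "cmod (fourier_coeff f k) \<le> 2 * ?N 0"
    unfolding is_weak_deriv_norm_eq[OF g p] using g p fourier_coeff_le_Lp_norm[of g p k] by (simp add: is_weak_deriv_def)
  have A: "finite ?A" "0 \<in> ?A" by (simp_all add: finite_multi_order_le)
  have "?N 0 \<le> sobolev_norm X f"
  proof (cases "p = \<infinity>")
    case True
    then have "sobolev_norm X f = Max (?N ` ?A)" using Wkp by simp
    then show ?thesis using A by (metis (no_types, lifting) Max_ge finite_imageI imageI)
  next
    case False
    let ?q = "enn2real p"
    have q: "1 \<le> ?q" by (rule finite_exponent_ge_1[OF p False])
    have N0: "0 \<le> ?N 0" using False by (simp add: Lp_norm_def)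
    have "?N 0 = (?N 0 powr ?q) powr (1 / ?q)" using q N0 by (simp add: powr_powr)
    also have "\<dots> \<le> (\<Sum>\<alpha>\<in>?A. ?N \<alpha> powr ?q) powr (1 / ?q)"
      using q A by (intro powr_mono2 member_le_sum[of 0 ?A "\<lambda>\<alpha>. ?N \<alpha> powr ?q"]) auto
    also have "\<dots> = sobolev_norm X f" using Wkp False by simp
    finally show ?thesis .
  qed
  then show ?thesis using le by linarith
qed

text \<open>Serves to replace a solution by another one that uniqueness identifies with it only
  almost everywhere.\<close>

lemma sobolev_norm_cong_AE:
  assumes eq: "AE x in torus. f x = g x" and m: "f \<in> borel_measurable torus" "g \<in> borel_measurable torus"
  shows "sobolev_norm X f = sobolev_norm X g"
proof -
  have "is_bessel p s f = is_bessel p s g" for p s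
    using fourier_coeff_cong_AE[OF eq m] by (auto simp: is_bessel_def fun_eq_iff)
  moreover have "is_weak_deriv p \<alpha> f = is_weak_deriv p \<alpha> g" for p \<alpha>
  proof -
    have "(LINT x|torus. f x * multi_partial \<alpha> \<phi> x) = (LINT x|torus. g x * multi_partial \<alpha> \<phi> x)"
      if "test_function \<phi>" for \<phi>
    proof (rule integral_cong_AE)
      have "multi_partial \<alpha> \<phi> \<in> borel_measurable torus"
        by (intro continuous_measurable_torus test_function_continuous test_function_multi_partial that)
      then show "(\<lambda>x. f x * multi_partial \<alpha> \<phi> x) \<in> borel_measurable torus"
        "(\<lambda>x. g x * multi_partial \<alpha> \<phi> x) \<in> borel_measurable torus"
        using m by measurable
      show "AE x in torus. f x * multi_partial \<alpha> \<phi> x = g x * multi_partial \<alpha> \<phi> x"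
        using eq by eventually_elim simp
    qed
    then show ?thesis by (auto simp: is_weak_deriv_def fun_eq_iff)
  qed
  ultimately show ?thesis by (cases X) simp_all
qed

lemma sobolev_imp_Lp: "admissible X \<Longrightarrow> f \<in> sobolev X \<Longrightarrow> \<exists>p. 1 \<le> p \<and> f \<in> Lp p"
  by (cases X) (auto intro: less_imp_le)

section \<open>From coefficients to weak solutions\<close>

text \<open>The \<open>l^1\<close> length of the horizontal part: subadditive, and unchanged by
  shifts along the third axis, the two properties behind the exponential weight.\<close>

definition hfreq :: "int^3 \<Rightarrow> real" where
  "hfreq k = \<bar>freq k $ 1\<bar> + \<bar>freq k $ 2\<bar>"

lemma hfreq_nonneg: "0 \<le> hfreq k"
  by (simp add: hfreq_def)

lemma hfreq_minus [simp]: "hfreq (- k) = hfreq k"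
  by (simp add: hfreq_def)

lemma hfreq_le_jap: "hfreq k \<le> 2 * jap k"
  using component_le_norm_cart[of "freq k" 1] component_le_norm_cart[of "freq k" 2]
  by (simp add: hfreq_def jap_def)

lemma norm_vec3_sq: "(norm (x::real^3))\<^sup>2 = (x $ 1)\<^sup>2 + (x $ 2)\<^sup>2 + (x $ 3)\<^sup>2"
  unfolding power2_norm_eq_inner inner_vec_def by (simp add: sum_3 power2_eq_square)

lemma M_symbol_minus [simp]: "M_symbol \<Omega> \<mu> j (- k) = M_symbol \<Omega> \<mu> j k"
  by (simp add: M_symbol_def Let_def)

text \<open>A nonzero integer \<open>k3\<close> has modulus at least 1, so
  \<open>4 * \<Omega>^2 * k3^2 * |k|^2\<close> absorbs the rotational part of the numerators; the
  terms with \<open>\<mu>\<close> are absorbed by the geometric mean of the two parts of the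
  denominator. What is left is one horizontal derivative.\<close>

lemma M_symbol_abs_le:
  assumes "0 < \<Omega>" "0 < \<mu>"
  shows "\<bar>M_symbol \<Omega> \<mu> j k\<bar> \<le> hfreq k / \<Omega>"
proof (cases "freq k $ 3 = 0")
  case True
  then show ?thesis using hfreq_nonneg[of k] assms by (simp add: M_symbol_def)
next
  case False
  define a b c N where "a = freq k $ 1" and "b = freq k $ 2" and "c = freq k $ 3" and "N = norm (freq k)"
  define D where "D = 4 * \<Omega>\<^sup>2 * c\<^sup>2 * N\<^sup>2 + \<mu>\<^sup>2 * b ^ 4"
  have c1: "1 \<le> \<bar>c\<bar>" using False by (simp add: c_def freq_def)
  have k0: "k \<noteq> 0" using False by (auto simp: freq_def)
  have N1: "1 \<le> N" unfolding N_def by (rule norm_freq_ge_1[OF k0])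
  have NN: "N\<^sup>2 = a\<^sup>2 + b\<^sup>2 + c\<^sup>2"
    unfolding N_def a_def b_def c_def by (rule norm_vec3_sq)
  have D1: "4 * \<Omega>\<^sup>2 * c\<^sup>2 * N\<^sup>2 \<le> D" by (simp add: D_def)
  \<comment> \<open>The arithmetic-geometric mean inequality for the two squares in
    \<open>D\<close>.\<close>
  have D2: "4 * \<Omega> * \<bar>c\<bar> * N * (\<mu> * b\<^sup>2) \<le> D"
  proof -
    have "0 \<le> (2 * \<Omega> * \<bar>c\<bar> * N - \<mu> * b\<^sup>2)\<^sup>2" by simp
    also have "\<dots> = D - 4 * \<Omega> * \<bar>c\<bar> * N * (\<mu> * b\<^sup>2)"
      by (simp add: D_def power2_eq_square algebra_simps power4_eq_xxxx)
    finally show ?thesis by simp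
  qed
  have "0 < 4 * \<Omega>\<^sup>2 * c\<^sup>2 * N\<^sup>2" using assms c1 N1 by auto
  then have Dpos: "0 < D" using D1 by linarith
  have e1: "2 * \<Omega> * \<bar>y\<bar> * \<bar>c\<bar> * N\<^sup>2 \<le> \<bar>y\<bar> / (2 * \<Omega>) * D" for y
  proof -
    have "2 * \<Omega> * \<bar>y\<bar> * \<bar>c\<bar> * N\<^sup>2 * 1 \<le> 2 * \<Omega> * \<bar>y\<bar> * \<bar>c\<bar> * N\<^sup>2 * \<bar>c\<bar>"
      by (rule mult_left_mono[OF c1]) (use assms in simp)
    also have "\<dots> = \<bar>y\<bar> / (2 * \<Omega>) * (4 * \<Omega>\<^sup>2 * c\<^sup>2 * N\<^sup>2)"
      using assms by (simp add: power2_eq_square field_simps)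
    also have "\<dots> \<le> \<bar>y\<bar> / (2 * \<Omega>) * D"
      using D1 assms by (intro mult_left_mono) auto
    finally show ?thesis by simp
  qed
  have e2: "\<mu> * \<bar>y\<bar> * b\<^sup>2 * \<bar>c\<bar> \<le> \<bar>y\<bar> / (4 * \<Omega>) * D" for y
  proof -
    have "\<mu> * \<bar>y\<bar> * b\<^sup>2 * \<bar>c\<bar> * 1 \<le> \<mu> * \<bar>y\<bar> * b\<^sup>2 * \<bar>c\<bar> * N"
      by (rule mult_left_mono[OF N1]) (use assms in simp)
    also have "\<dots> = \<bar>y\<bar> / (4 * \<Omega>) * (4 * \<Omega> * \<bar>c\<bar> * N * (\<mu> * b\<^sup>2))"
      using assms by (simp add: field_simps)
    also have "\<dots> \<le> \<bar>y\<bar> / (4 * \<Omega>) * D"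
      using D2 assms by (intro mult_left_mono) auto
    finally show ?thesis by simp
  qed
  have e3: "\<mu> * b\<^sup>2 * (a\<^sup>2 + b\<^sup>2) \<le> (\<bar>a\<bar> + \<bar>b\<bar>) / (4 * \<Omega>) * D"
  proof -
    have "\<bar>a\<bar> \<le> N" "\<bar>b\<bar> \<le> N"
      using component_le_norm_cart[of "freq k" 1] component_le_norm_cart[of "freq k" 2] by (auto simp: a_def b_def N_def)
    then have "\<bar>a\<bar> * \<bar>a\<bar> + \<bar>b\<bar> * \<bar>b\<bar> \<le> \<bar>a\<bar> * N + \<bar>b\<bar> * N"
      by (intro add_mono mult_left_mono) auto
    then have "a\<^sup>2 + b\<^sup>2 \<le> (\<bar>a\<bar> + \<bar>b\<bar>) * N * 1"
      by (simp add: power2_eq_square distrib_right)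
    also have "\<dots> \<le> (\<bar>a\<bar> + \<bar>b\<bar>) * N * \<bar>c\<bar>"
      by (rule mult_left_mono[OF c1]) (use N1 in simp)
    finally have "\<mu> * b\<^sup>2 * (a\<^sup>2 + b\<^sup>2) \<le> \<mu> * b\<^sup>2 * ((\<bar>a\<bar> + \<bar>b\<bar>) * N * \<bar>c\<bar>)"
      using assms by (intro mult_left_mono) auto
    also have "\<dots> = (\<bar>a\<bar> + \<bar>b\<bar>) / (4 * \<Omega>) * (4 * \<Omega> * \<bar>c\<bar> * N * (\<mu> * b\<^sup>2))"
      using assms by (simp add: field_simps)
    also have "\<dots> \<le> (\<bar>a\<bar> + \<bar>b\<bar>) / (4 * \<Omega>) * D"
      using D2 assms by (intro mult_left_mono) auto
    finally show ?thesis .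
  qed
  have sum_le: "u / (2 * \<Omega>) * D + v / (4 * \<Omega>) * D \<le> (u + v) / \<Omega> * D" if "0 \<le> u" "0 \<le> v" for u v
  proof -
    have "0 \<le> u * D / \<Omega>" "0 \<le> v * D / \<Omega>" using that assms Dpos by auto
    moreover have "u / (2 * \<Omega>) * D = (u * D / \<Omega>) / 2" "v / (4 * \<Omega>) * D = (v * D / \<Omega>) / 4"
      "(u + v) / \<Omega> * D = u * D / \<Omega> + v * D / \<Omega>"
      by (simp_all add: add_divide_distrib distrib_right)
    moreover have "0 \<le> x \<Longrightarrow> 0 \<le> y \<Longrightarrow> x / 2 + y / 4 \<le> x + y" for x y :: real
      by linarith
    ultimately show ?thesis by (simp only:)
  qed
  have "\<exists>n. M_symbol \<Omega> \<mu> j k = n / D \<and> \<bar>n\<bar> \<le> (\<bar>a\<bar> + \<bar>b\<bar>) / \<Omega> * D"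
  proof -
    consider "j = 1" | "j = 2" | "j \<noteq> 1" "j \<noteq> 2" by blast
    then show ?thesis
    proof cases
      case 1
      have "\<bar>2 * \<Omega> * b * c * N\<^sup>2 - \<mu> * a * b\<^sup>2 * c\<bar>
          \<le> \<bar>2 * \<Omega> * b * c * N\<^sup>2\<bar> + \<bar>\<mu> * a * b\<^sup>2 * c\<bar>" by (rule abs_triangle_ineq4)
      also have "\<dots> = 2 * \<Omega> * \<bar>b\<bar> * \<bar>c\<bar> * N\<^sup>2 + \<mu> * \<bar>a\<bar> * b\<^sup>2 * \<bar>c\<bar>"
        using assms by (simp add: abs_mult)
      also have "\<dots> \<le> (\<bar>a\<bar> + \<bar>b\<bar>) / \<Omega> * D"
        using add_mono[OF e1[of b] e2[of a]] sum_le[of "\<bar>b\<bar>" "\<bar>a\<bar>"] by (simp add: add.commute)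
      finally show ?thesis using 1 False
        by (intro exI[of _ "2 * \<Omega> * b * c * N\<^sup>2 - \<mu> * a * b\<^sup>2 * c"])
           (simp add: M_symbol_def Let_def a_def b_def c_def N_def D_def)
    next
      case 2
      have "\<bar>- 2 * \<Omega> * a * c * N\<^sup>2 - \<mu> * b ^ 3 * c\<bar>
          \<le> \<bar>- 2 * \<Omega> * a * c * N\<^sup>2\<bar> + \<bar>\<mu> * b ^ 3 * c\<bar>" by (rule abs_triangle_ineq4)
      also have "\<dots> = 2 * \<Omega> * \<bar>a\<bar> * \<bar>c\<bar> * N\<^sup>2 + \<mu> * \<bar>b\<bar> * b\<^sup>2 * \<bar>c\<bar>"
        using assms by (simp add: abs_mult power3_eq_cube power2_eq_square)
      also have "\<dots> \<le> (\<bar>a\<bar> + \<bar>b\<bar>) / \<Omega> * D"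
        using add_mono[OF e1[of a] e2[of b]] sum_le[of "\<bar>a\<bar>" "\<bar>b\<bar>"] by simp
      finally show ?thesis using 2 False
        by (intro exI[of _ "- 2 * \<Omega> * a * c * N\<^sup>2 - \<mu> * b ^ 3 * c"])
           (simp add: M_symbol_def Let_def a_def b_def c_def N_def D_def)
    next
      case 3
      have "\<bar>\<mu> * b\<^sup>2 * (a\<^sup>2 + b\<^sup>2)\<bar> \<le> (\<bar>a\<bar> + \<bar>b\<bar>) / \<Omega> * D"
        using e3 sum_le[of 0 "\<bar>a\<bar> + \<bar>b\<bar>"] assms by simp
      then show ?thesis using 3 False
        by (intro exI[of _ "\<mu> * b\<^sup>2 * (a\<^sup>2 + b\<^sup>2)"])
           (simp add: M_symbol_def Let_def a_def b_def c_def N_def D_def)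
    qed
  qed
  then show ?thesis using Dpos
    by (auto simp: hfreq_def a_def[symmetric] b_def[symmetric] abs_divide pos_divide_le_eq)
qed

definition transport :: "real \<Rightarrow> real \<Rightarrow> int^3 \<Rightarrow> int^3 \<Rightarrow> real" where
  "transport \<Omega> \<mu> p q = (\<Sum>j\<in>UNIV. M_symbol \<Omega> \<mu> j p * freq q $ j)"

text \<open>Incompressibility. \<open>transport \<Omega> \<mu> p q\<close> is the velocity symbol of
  mode \<open>p\<close> dotted with the wave vector \<open>q\<close>; its vanishing at
  \<open>q = p\<close> makes \<open>k - p\<close> and \<open>k\<close> interchangeable in the second
  slot.\<close>

lemma transport_self [simp]: "transport \<Omega> \<mu> p p = 0"
  using M_symbol_divergence_free[of p \<Omega> \<mu>] by (simp add: transport_def mult.commute)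

lemma transport_add: "transport \<Omega> \<mu> p (q + q') = transport \<Omega> \<mu> p q + transport \<Omega> \<mu> p q'"
  by (simp add: transport_def distrib_left sum.distrib)

lemma transport_minus [simp]: "transport \<Omega> \<mu> p (- q) = - transport \<Omega> \<mu> p q" "transport \<Omega> \<mu> (- p) q = transport \<Omega> \<mu> p q"
  by (simp_all add: transport_def sum_negf)

lemma transport_diff: "transport \<Omega> \<mu> p (q - q') = transport \<Omega> \<mu> p q - transport \<Omega> \<mu> p q'"
  using transport_add[of \<Omega> \<mu> p q "- q'"] by simp

lemma transport_abs_le:
  assumes "0 < \<Omega>" "0 < \<mu>"
  shows "\<bar>transport \<Omega> \<mu> p q\<bar> \<le> 6 / \<Omega> * (jap p * jap q)"
proof -
  have "\<bar>transport \<Omega> \<mu> p q\<bar> \<le> (\<Sum>j\<in>(UNIV::3 set). \<bar>M_symbol \<Omega> \<mu> j p * freq q $ j\<bar>)"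
    unfolding transport_def by (rule sum_abs)
  also have "\<dots> \<le> (\<Sum>j\<in>(UNIV::3 set). (2 * jap p / \<Omega>) * jap q)"
  proof (rule sum_mono)
    fix j :: 3
    have "\<bar>M_symbol \<Omega> \<mu> j p\<bar> \<le> 2 * jap p / \<Omega>"
      using M_symbol_abs_le[OF assms, of j p] divide_right_mono[OF hfreq_le_jap[of p], of \<Omega>] assms by simp
    moreover have "\<bar>freq q $ j\<bar> \<le> jap q"
      using component_le_norm_cart[of "freq q" j] by (simp add: jap_def)
    ultimately show "\<bar>M_symbol \<Omega> \<mu> j p * freq q $ j\<bar> \<le> (2 * jap p / \<Omega>) * jap q"
      unfolding abs_mult using jap_pos[of p] assms by (intro mult_mono) auto
  qed
  also have "\<dots> = 6 / \<Omega> * (jap p * jap q)" by simp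
  finally show ?thesis .
qed

lemma product_summable:
  fixes f :: "'a \<Rightarrow> real" and g :: "'b \<Rightarrow> real"
  assumes "f summable_on UNIV" "g summable_on UNIV" "\<And>x. 0 \<le> f x" "\<And>y. 0 \<le> g y"
  shows "(\<lambda>(x, y). f x * g y) summable_on UNIV \<times> UNIV"
proof (rule summable_on_SigmaI[where g = "\<lambda>x. f x * (\<Sum>\<^sub>\<infinity>y. g y)"])
  show "((\<lambda>y. case (x, y) of (x, y) \<Rightarrow> f x * g y) has_sum f x * (\<Sum>\<^sub>\<infinity>y. g y)) UNIV" for x
    using has_sum_cmult_right[OF has_sum_infsum[OF assms(2)]] by simp
  show "(\<lambda>x. f x * (\<Sum>\<^sub>\<infinity>y. g y)) summable_on UNIV"
    using assms(1) by (rule summable_on_cmult_left)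
qed (use assms in auto)

text \<open>For odd \<open>b = c\<close> these are the sine coefficients of the advection term: the
  sum and difference frequencies of a product of waves contribute equally, which cancels the factor
  1/2. Two arguments are kept for the bilinear estimates.\<close>

definition advection :: "real \<Rightarrow> real \<Rightarrow> (int^3 \<Rightarrow> real) \<Rightarrow> (int^3 \<Rightarrow> real) \<Rightarrow> int^3 \<Rightarrow> real" where
  "advection \<Omega> \<mu> b c k = (\<Sum>\<^sub>\<infinity>p. transport \<Omega> \<mu> p (k - p) * b p * c (k - p))"

lemma bij_shear: "bij_betw (\<lambda>(p, k). (p, k - p)) (UNIV :: ((int^3) \<times> (int^3)) set) UNIV"
  by (rule bij_betw_byWitness[where f' = "\<lambda>(p, q). (p, p + q)"]) auto

lemma advection_pair_bound:
  assumes "0 < \<Omega>" "0 < \<mu>" "\<bar>b p\<bar> \<le> D p" "\<bar>c q\<bar> \<le> D q"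
  shows "\<bar>transport \<Omega> \<mu> p q * b p * c q\<bar> \<le> 6 / \<Omega> * ((jap p * D p) * (jap q * D q))"
proof -
  have "\<bar>transport \<Omega> \<mu> p q * b p * c q\<bar> \<le> 6 / \<Omega> * (jap p * jap q) * D p * D q"
  proof -
    have "0 \<le> D p" "0 \<le> D q" using assms(3,4) by linarith+
    moreover have "0 \<le> 6 / \<Omega> * (jap p * jap q)" using assms(1) jap_pos[of p] jap_pos[of q] by simp
    ultimately show ?thesis
      unfolding abs_mult using assms by (intro mult_mono transport_abs_le mult_nonneg_nonneg) (auto intro: less_imp_le[OF jap_pos])
  qed
  then show ?thesis by (simp add: mult_ac)
qed

lemma advection_majorant_summable:
  assumes D: "weighted_summable 1 D" "\<And>k. 0 \<le> D k"
  shows "(\<lambda>(p, k). (jap p * D p) * (jap (k - p) * D (k - p))) summable_on (UNIV :: (int^3) set) \<times> UNIV"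
proof -
  have "(\<lambda>(p, q). (jap p * D p) * (jap q * D q)) summable_on (UNIV :: (int^3) set) \<times> UNIV"
    using D jap_pos by (intro product_summable) (auto simp: weighted_summable_def less_imp_le)
  then show ?thesis
    using summable_on_reindex_bij_betw[OF bij_shear, of "\<lambda>(p, q). (jap p * D p) * (jap q * D q)"]
    unfolding case_prod_unfold by simp
qed

lemma infsum_neg_reindex: "(\<Sum>\<^sub>\<infinity>q. f (- q)) = (\<Sum>\<^sub>\<infinity>q::int^3. f q :: real)"
  by (rule infsum_reindex_bij_betw) (rule bij_betw_byWitness[where f' = uminus]; auto)

lemma infsum_shift_reindex: "(\<Sum>\<^sub>\<infinity>k. f (k - p)) = (\<Sum>\<^sub>\<infinity>q::int^3. f q :: real)"
  by (rule infsum_reindex_bij_betw) (rule bij_betw_byWitness[where f' = "\<lambda>q. q + p"]; auto)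

lemma summable_neg_reindex: "(\<lambda>q. f (- q)) summable_on UNIV \<longleftrightarrow> (f :: int^3 \<Rightarrow> real) summable_on UNIV"
  by (rule summable_on_reindex_bij_betw) (rule bij_betw_byWitness[where f' = uminus]; auto)

lemma wave_moment_le:
  assumes f: "integrable torus f"
  shows "\<bar>LINT x|torus. wave k \<phi> x * f x\<bar> \<le> (LINT x|torus. \<bar>f x\<bar>)"
proof -
  have "\<bar>LINT x|torus. wave k \<phi> x * f x\<bar> \<le> (LINT x|torus. \<bar>wave k \<phi> x * f x\<bar>)"
    by (rule integral_abs_bound)
  also have "\<dots> \<le> (LINT x|torus. \<bar>f x\<bar>)"
  proof (rule integral_mono)
    show "integrable torus (\<lambda>x. \<bar>wave k \<phi> x * f x\<bar>)"
      using integrable_torus_mult_continuous[OF f continuous_wave, of k \<phi>] by (simp add: mult.commute)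
    show "\<bar>wave k \<phi> x * f x\<bar> \<le> \<bar>f x\<bar>" for x
      using mult_right_mono[OF wave_abs_le[of k \<phi> x] abs_ge_zero[of "f x"]] by (simp add: abs_mult)
  qed (use f in simp)
  finally show ?thesis .
qed

text \<open>At the frequencies \<open>p - q\<close> and \<open>p + q\<close> incompressibility
  leaves the same \<open>transport \<Omega> \<mu> p q\<close> up to sign; together with the minus
  sign of the product formula the two contributions add.\<close>

lemma wave_pair_transport:
  assumes \<phi>: "test_function \<phi>"
  defines "s \<equiv> \<lambda>k. LINT x|torus. wave k 0 x * \<phi> x"
  shows "(\<Sum>j\<in>UNIV. M_symbol \<Omega> \<mu> j p * (LINT x|torus. wave p 0 x * (wave q 0 x * partial j \<phi> x)))
    = - (transport \<Omega> \<mu> p q) * (s (p - q) + s (p + q)) / 2"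
proof -
  have i: "integrable torus (\<lambda>x. wave l (pi / 2) x * partial j \<phi> x)" for l j
    by (intro integrable_torus_continuous continuous_intros test_function_continuous test_function_partial \<phi>)
  have ph: "wave l (pi / 2 + pi / 2) x = - wave l 0 x" for l x
    by (simp add: wave_def)
  have l: "(LINT x|torus. wave l (pi / 2) x * partial j \<phi> x) = freq l $ j * s l" for l j
    unfolding wave_integral_by_parts[OF \<phi>] ph s_def by simp
  have "(LINT x|torus. wave p 0 x * (wave q 0 x * partial j \<phi> x))
      = (freq (p - q) $ j * s (p - q) - freq (p + q) $ j * s (p + q)) / 2" for j
  proof -
    have "(LINT x|torus. wave p 0 x * (wave q 0 x * partial j \<phi> x))
      = (LINT x|torus. (wave (p - q) (pi / 2) x * partial j \<phi> x - wave (p + q) (pi / 2) x * partial j \<phi> x) / 2)"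
      unfolding mult.assoc[symmetric] wave_mult by (simp add: left_diff_distrib)
    also have "\<dots> = ((LINT x|torus. wave (p - q) (pi / 2) x * partial j \<phi> x) - (LINT x|torus. wave (p + q) (pi / 2) x * partial j \<phi> x)) / 2"
      using i by simp
    finally show ?thesis by (simp only: l)
  qed
  note eq = this
  have "(\<Sum>j\<in>UNIV. M_symbol \<Omega> \<mu> j p * (LINT x|torus. wave p 0 x * (wave q 0 x * partial j \<phi> x)))
     = (transport \<Omega> \<mu> p (p - q) * s (p - q) - transport \<Omega> \<mu> p (p + q) * s (p + q)) / 2"
    unfolding transport_def sum_distrib_right sum_subtractf[symmetric] sum_divide_distrib eq
    by (intro sum.cong) (simp_all add: field_simps)
  also have "\<dots> = - (transport \<Omega> \<mu> p q) * (s (p - q) + s (p + q)) / 2"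
    by (simp add: transport_add transport_diff field_simps)
  finally show ?thesis .
qed


lemma has_sum_finite_sum:
  fixes f :: "'j \<Rightarrow> 'a \<Rightarrow> real"
  assumes "finite J" "\<And>j. j \<in> J \<Longrightarrow> f j summable_on A"
  shows "((\<lambda>x. \<Sum>j\<in>J. f j x) has_sum (\<Sum>j\<in>J. infsum (f j) A)) A"
  using assms
proof (induction J rule: finite_induct)
  case (insert j J)
  then show ?case by (simp add: has_sum_add)
qed simp

text \<open>One majorant \<open>D\<close> bounds both factors, so a bound on the coefficients that
  is uniform in time yields a summable bound on the quadratic term that is uniform in time.\<close>

lemma
  assumes par: "0 < \<Omega>" "0 < \<mu>" and D: "weighted_summable 1 D" "\<And>k. 0 \<le> D k"
    and b: "\<And>k. \<bar>b k\<bar> \<le> D k" and c: "\<And>k. \<bar>c k\<bar> \<le> D k"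
  shows advection_abs_le: "\<bar>advection \<Omega> \<mu> b c k\<bar> \<le> (\<Sum>\<^sub>\<infinity>p. 6 / \<Omega> * ((jap p * D p) * (jap (k - p) * D (k - p))))"
    and advection_majorant: "(\<lambda>k. \<Sum>\<^sub>\<infinity>p. 6 / \<Omega> * ((jap p * D p) * (jap (k - p) * D (k - p)))) summable_on UNIV"
    and advection_majorant_inner: "(\<lambda>p. 6 / \<Omega> * ((jap p * D p) * (jap (k - p) * D (k - p)))) summable_on UNIV"
proof -
  have maj: "(\<lambda>(p, k). 6 / \<Omega> * ((jap p * D p) * (jap (k - p) * D (k - p)))) summable_on (UNIV :: (int^3) set) \<times> UNIV"
    using summable_on_cmult_right[OF advection_majorant_summable[OF D], of "6 / \<Omega>"] unfolding case_prod_unfold by simp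
  then have maj': "(\<lambda>(k, p). 6 / \<Omega> * ((jap p * D p) * (jap (k - p) * D (k - p)))) summable_on (UNIV :: (int^3) set) \<times> UNIV"
    using summable_on_swap[of "\<lambda>(k, p). 6 / \<Omega> * ((jap p * D p) * (jap (k - p) * D (k - p)))" UNIV UNIV]
    unfolding case_prod_unfold by simp
  show "(\<lambda>k. \<Sum>\<^sub>\<infinity>p. 6 / \<Omega> * ((jap p * D p) * (jap (k - p) * D (k - p)))) summable_on UNIV"
    using summable_on_Sigma_banach[OF maj'] .
  show inner: "(\<lambda>p. 6 / \<Omega> * ((jap p * D p) * (jap (k - p) * D (k - p)))) summable_on UNIV"
    using summable_on_SigmaD1[OF maj', of k] D par jap_pos by (simp add: less_imp_le)
  show "\<bar>advection \<Omega> \<mu> b c k\<bar> \<le> (\<Sum>\<^sub>\<infinity>p. 6 / \<Omega> * ((jap p * D p) * (jap (k - p) * D (k - p))))"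
    unfolding advection_def by (intro infsum_abs_le inner advection_pair_bound par b c)
qed

lemma M_symbol_jap_le:
  assumes "0 < \<Omega>" "0 < \<mu>"
  shows "\<bar>M_symbol \<Omega> \<mu> j k\<bar> \<le> 2 / \<Omega> * jap k"
  using M_symbol_abs_le[OF assms, of j k] divide_right_mono[OF hfreq_le_jap[of k], of \<Omega>] assms by simp

lemma M_series_summable:
  assumes par: "0 < \<Omega>" "0 < \<mu>" and b: "weighted_summable 1 b"
  shows "(\<lambda>k. M_symbol \<Omega> \<mu> j k * b k) summable_on UNIV"
proof (rule summable_on_comparison_real)
  show "(\<lambda>k. 2 / \<Omega> * (jap k ^ 1 * \<bar>b k\<bar>)) summable_on UNIV"
    using b unfolding weighted_summable_def by (rule summable_on_cmult_right)
  show "\<bar>M_symbol \<Omega> \<mu> j k * b k\<bar> \<le> 2 / \<Omega> * (jap k ^ 1 * \<bar>b k\<bar>)" for k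
    using mult_right_mono[OF M_symbol_jap_le[OF par, of j k] abs_ge_zero[of "b k"]] by (simp add: abs_mult mult.assoc)
qed

text \<open>Both series are expanded and the absolutely convergent double sum is regrouped by output
  frequency \<open>k = p + q\<close>. For fixed \<open>p\<close> the sum over the three velocity
  components is taken first, because incompressibility acts only on that sum.\<close>

lemma
  assumes par: "0 < \<Omega>" "0 < \<mu>" and b: "weighted_summable 1 b" and odd: "\<And>k. b (- k) = - b k"
    and \<phi>: "test_function \<phi>"
  defines "s \<equiv> \<lambda>k. LINT x|torus. wave k 0 x * \<phi> x"
  shows integral_transport: "(LINT x|torus. series b 0 x * (\<Sum>j\<in>UNIV. series (\<lambda>k. M_symbol \<Omega> \<mu> j k * b k) 0 x * partial j \<phi> x))
    = - (\<Sum>\<^sub>\<infinity>k. advection \<Omega> \<mu> b b k * s k)"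
proof -
  let ?M = "M_symbol \<Omega> \<mu>" and ?\<Theta> = "series b 0" and ?vd = "transport \<Omega> \<mu>"
  have bs: "b summable_on UNIV" by (rule weighted_summable_imp_summable[OF b])
  note Ms = M_series_summable[OF par b]
  have cont: "continuous_on UNIV ?\<Theta>" "continuous_on UNIV (partial j \<phi>)" "continuous_on UNIV (series (\<lambda>k. ?M j k * b k) 0)" for j
    by (intro continuous_series bs Ms test_function_continuous test_function_partial \<phi>)+
  have gi: "integrable torus (\<lambda>x. ?\<Theta> x * partial j \<phi> x)" "integrable torus (\<lambda>x. wave p 0 x * partial j \<phi> x)" for j p
    by (intro integrable_torus_continuous continuous_intros cont)+
  obtain S where S: "0 \<le> S" "\<And>k. \<bar>s k\<bar> \<le> S"
    using wave_moment_le[OF integrable_torus_continuous[OF test_function_continuous[OF \<phi>]], of _ 0]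
    unfolding s_def by (meson abs_ge_zero order_trans)
  define I where "I j p q = (LINT x|torus. wave p 0 x * (wave q 0 x * partial j \<phi> x))" for j p q
  have inner: "(LINT x|torus. wave p 0 x * (?\<Theta> x * partial j \<phi> x)) = (\<Sum>\<^sub>\<infinity>q. b q * I j p q)"
    and inner_sum: "(\<lambda>q. b q * I j p q) summable_on UNIV" for j p
  proof -
    have "(LINT x|torus. wave p 0 x * (?\<Theta> x * partial j \<phi> x)) = (LINT x|torus. ?\<Theta> x * (wave p 0 x * partial j \<phi> x))"
      by (simp only: mult.left_commute)
    also have "\<dots> = (\<Sum>\<^sub>\<infinity>q. b q * (LINT x|torus. wave q 0 x * (wave p 0 x * partial j \<phi> x)))"
      by (rule integral_series_mult[OF bs gi(2)])
    also have "\<dots> = (\<Sum>\<^sub>\<infinity>q. b q * I j p q)"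
      unfolding I_def by (simp only: mult.left_commute)
    finally show "(LINT x|torus. wave p 0 x * (?\<Theta> x * partial j \<phi> x)) = (\<Sum>\<^sub>\<infinity>q. b q * I j p q)" .
    show "(\<lambda>q. b q * I j p q) summable_on UNIV"
      using summable_series_mult[OF bs gi(2), of 0 p j] unfolding I_def by (simp only: mult.left_commute)
  qed
  have pair: "(\<lambda>q. b q * ?vd p q * s (p + q)) summable_on UNIV" for p
  proof (rule summable_on_comparison_real)
    show "(\<lambda>q. (6 / \<Omega> * jap p * S) * (jap q ^ 1 * \<bar>b q\<bar>)) summable_on UNIV"
      using b unfolding weighted_summable_def by (rule summable_on_cmult_right)
    fix q
    have "\<bar>b q * ?vd p q * s (p + q)\<bar> \<le> \<bar>b q\<bar> * (6 / \<Omega> * (jap p * jap q)) * S"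
      unfolding abs_mult using par S jap_pos[of p] jap_pos[of q]
      by (intro mult_mono transport_abs_le mult_nonneg_nonneg) auto
    then show "\<bar>b q * ?vd p q * s (p + q)\<bar> \<le> (6 / \<Omega> * jap p * S) * (jap q ^ 1 * \<bar>b q\<bar>)"
      by (simp add: mult_ac)
  qed
  have collapse: "(\<Sum>j\<in>UNIV. ?M j p * (\<Sum>\<^sub>\<infinity>q. b q * I j p q)) = - (\<Sum>\<^sub>\<infinity>k. ?vd p (k - p) * b (k - p) * s k)" for p
  proof -
    have "((\<lambda>q. \<Sum>j\<in>UNIV. ?M j p * (b q * I j p q)) has_sum (\<Sum>j\<in>UNIV. \<Sum>\<^sub>\<infinity>q. ?M j p * (b q * I j p q))) UNIV"
      by (rule has_sum_finite_sum) (auto intro: summable_on_cmult_right inner_sum)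
    from infsumI[OF this]
    have "(\<Sum>j\<in>UNIV. ?M j p * (\<Sum>\<^sub>\<infinity>q. b q * I j p q)) = (\<Sum>\<^sub>\<infinity>q. \<Sum>j\<in>UNIV. ?M j p * (b q * I j p q))"
      by (simp only: infsum_cmult_right')
    also have "\<dots> = (\<Sum>\<^sub>\<infinity>q. b q * (- (?vd p q) * (s (p - q) + s (p + q)) / 2))"
    proof (rule infsum_cong)
      fix q
      have "(\<Sum>j\<in>UNIV. ?M j p * (b q * I j p q)) = b q * (\<Sum>j\<in>UNIV. ?M j p * I j p q)"
        by (simp add: sum_distrib_left mult_ac)
      then show "(\<Sum>j\<in>UNIV. ?M j p * (b q * I j p q)) = b q * (- (?vd p q) * (s (p - q) + s (p + q)) / 2)"
        unfolding I_def wave_pair_transport[OF \<phi>] s_def .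
    qed
    \<comment> \<open>Both \<open>b\<close> and \<open>transport \<Omega> \<mu> p\<close> are odd,
      so the substitution of \<open>- q\<close> for \<open>q\<close> turns the difference
      frequencies into the sum frequencies.\<close>
    also have "\<dots> = (\<Sum>\<^sub>\<infinity>q. - (1 / 2) * (b q * ?vd p q * s (p + q)) + - (1 / 2) * (b (- q) * ?vd p (- q) * s (p + - q)))"
      by (intro infsum_cong) (simp add: odd field_simps)
    also have "\<dots> = (\<Sum>\<^sub>\<infinity>q. - (1 / 2) * (b q * ?vd p q * s (p + q))) + (\<Sum>\<^sub>\<infinity>q. - (1 / 2) * (b (- q) * ?vd p (- q) * s (p + - q)))"
      using pair[of p] summable_neg_reindex[of "\<lambda>q. b q * ?vd p q * s (p + q)"]
      by (intro infsum_add summable_on_cmult_right) auto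
    also have "\<dots> = - (\<Sum>\<^sub>\<infinity>q. b q * ?vd p q * s (p + q))"
      unfolding infsum_cmult_right' infsum_neg_reindex[of "\<lambda>q. b q * ?vd p q * s (p + q)"] by simp
    also have "(\<Sum>\<^sub>\<infinity>q. b q * ?vd p q * s (p + q)) = (\<Sum>\<^sub>\<infinity>k. b (k - p) * ?vd p (k - p) * s (p + (k - p)))"
      by (rule infsum_shift_reindex[symmetric])
    also have "\<dots> = (\<Sum>\<^sub>\<infinity>k. ?vd p (k - p) * b (k - p) * s k)"
      by (intro infsum_cong) (simp add: mult_ac)
    finally show ?thesis .
  qed
  let ?F = "\<lambda>p k. ?vd p (k - p) * b p * b (k - p) * s k"
  have D: "weighted_summable 1 (\<lambda>k. \<bar>b k\<bar>)" using b by (simp add: weighted_summable_def)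
  have Fs: "(\<lambda>(p, k). ?F p k) summable_on UNIV \<times> UNIV"
  proof (rule summable_on_comparison_real)
    show "(\<lambda>(p, k). (6 / \<Omega> * S) * ((jap p * \<bar>b p\<bar>) * (jap (k - p) * \<bar>b (k - p)\<bar>))) summable_on UNIV \<times> UNIV"
      using summable_on_cmult_right[OF advection_majorant_summable[OF D], of "6 / \<Omega> * S"] unfolding case_prod_unfold by simp
    fix x :: "(int^3) \<times> (int^3)"
    obtain p k where x: "x = (p, k)" by (cases x)
    have "\<bar>?F p k\<bar> \<le> 6 / \<Omega> * ((jap p * \<bar>b p\<bar>) * (jap (k - p) * \<bar>b (k - p)\<bar>)) * S"
      unfolding abs_mult[of _ "s k"]
      by (intro mult_mono advection_pair_bound par S mult_nonneg_nonneg) (use par jap_pos in \<open>auto intro: less_imp_le\<close>)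
    then show "\<bar>case x of (p, k) \<Rightarrow> ?F p k\<bar>
        \<le> (case x of (p, k) \<Rightarrow> (6 / \<Omega> * S) * ((jap p * \<bar>b p\<bar>) * (jap (k - p) * \<bar>b (k - p)\<bar>)))"
      by (simp add: x mult_ac)
  qed
  have "(LINT x|torus. ?\<Theta> x * (\<Sum>j\<in>UNIV. series (\<lambda>k. ?M j k * b k) 0 x * partial j \<phi> x))
     = (LINT x|torus. (\<Sum>j\<in>UNIV. series (\<lambda>k. ?M j k * b k) 0 x * (?\<Theta> x * partial j \<phi> x)))"
    by (simp add: sum_distrib_left mult_ac)
  also have "\<dots> = (\<Sum>j\<in>UNIV. (LINT x|torus. series (\<lambda>k. ?M j k * b k) 0 x * (?\<Theta> x * partial j \<phi> x)))"
    by (intro Bochner_Integration.integral_sum integrable_torus_continuous continuous_intros cont)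
  also have "\<dots> = (\<Sum>j\<in>UNIV. (\<Sum>\<^sub>\<infinity>p. (?M j p * b p) * (\<Sum>\<^sub>\<infinity>q. b q * I j p q)))"
    unfolding integral_series_mult[OF Ms gi(1)] inner ..
  also have "\<dots> = (\<Sum>\<^sub>\<infinity>p. \<Sum>j\<in>UNIV. (?M j p * b p) * (\<Sum>\<^sub>\<infinity>q. b q * I j p q))"
    using summable_series_mult[OF Ms gi(1), of _ 0]
    by (intro infsumI[symmetric] has_sum_finite_sum) (simp_all add: inner)
  also have "\<dots> = (\<Sum>\<^sub>\<infinity>p. b p * - (\<Sum>\<^sub>\<infinity>k. ?vd p (k - p) * b (k - p) * s k))"
    unfolding collapse[symmetric] by (intro infsum_cong) (simp add: sum_distrib_left mult_ac)
  also have "\<dots> = - (\<Sum>\<^sub>\<infinity>p. \<Sum>\<^sub>\<infinity>k. ?F p k)"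
    by (simp only: mult_minus_right infsum_uminus infsum_cmult_right'[symmetric] mult_ac)
  also have "(\<Sum>\<^sub>\<infinity>p. \<Sum>\<^sub>\<infinity>k. ?F p k) = (\<Sum>\<^sub>\<infinity>k. \<Sum>\<^sub>\<infinity>p. ?F p k)"
    by (rule infsum_swap_banach[OF Fs])
  also have "\<dots> = (\<Sum>\<^sub>\<infinity>k. advection \<Omega> \<mu> b b k * s k)"
    by (simp only: advection_def infsum_cmult_left')
  finally show ?thesis .
qed


section \<open>Time regularity and the weak formulation\<close>

lemma set_lint_lebesgue_on:
  fixes f :: "real \<Rightarrow> real"
  shows "(LINT \<tau>:{a..b}|lebesgue. f \<tau>) = (LINT \<tau>|lebesgue_on {a..b}. f \<tau>)"
  by (simp add: set_lebesgue_integral_def integral_restrict_space)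

lemma norm_freq_moment:
  assumes \<phi>: "test_function \<phi>" and \<psi>: "fourier_multiplier (\<lambda>k. norm (freq k)) \<phi> \<psi>"
  shows "(LINT x|torus. wave k 0 x * \<psi> x) = norm (freq k) * (LINT x|torus. wave k 0 x * \<phi> x)"
proof -
  have "integrable torus \<phi>" by (intro integrable_torus_continuous test_function_continuous \<phi>)
  moreover have "integrable torus \<psi>"
    using \<psi> Lp_integrable[of \<psi> 2] by (simp add: fourier_multiplier_def)
  moreover have "fourier_coeff \<psi> k = complex_of_real (norm (freq k)) * fourier_coeff \<phi> k"
    using \<psi> by (simp add: fourier_multiplier_def)
  ultimately show ?thesis
    by (simp add: fourier_coeff_eq complex_eq_iff mult.commute)
qed

lemma fourier_multiplier_series:
  assumes par: "0 < \<Omega>" "0 < \<mu>" and b: "weighted_summable 1 b"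
  shows "fourier_multiplier (M_symbol \<Omega> \<mu> j) (series b 0) (series (\<lambda>k. M_symbol \<Omega> \<mu> j k * b k) 0)"
  unfolding fourier_multiplier_def fourier_coeff_series[OF M_series_summable[OF par b]]
    fourier_coeff_series[OF weighted_summable_imp_summable[OF b]]
  using continuous_in_Lp[OF periodic_series continuous_series[OF M_series_summable[OF par b]], of 2]
  by (simp add: complex_eq_iff algebra_simps)

lemma weighted_summable_mono:
  assumes "weighted_summable r D" "\<And>k. \<bar>b k\<bar> \<le> D k"
  shows "weighted_summable r b"
  using assms(1) unfolding weighted_summable_def
proof (rule summable_on_comparison_real)
  show "\<bar>jap k ^ r * \<bar>b k\<bar>\<bar> \<le> jap k ^ r * \<bar>D k\<bar>" for k
    using assms(2)[of k] jap_pos[of k] by (simp add: abs_mult)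
qed

lemma weighted_summable_cmult: "weighted_summable r D \<Longrightarrow> weighted_summable r (\<lambda>k. c * D k)"
  unfolding weighted_summable_def using summable_on_cmult_right[of "\<lambda>k. jap k ^ r * \<bar>D k\<bar>" UNIV "\<bar>c\<bar>"]
  by (simp add: abs_mult mult_ac)

lemma sobolev_norm_nonneg:
  assumes "admissible X" "f \<in> sobolev X"
  shows "0 \<le> sobolev_norm X f"
  using fourier_coeff_le_sobolev_norm[OF assms, of 0] norm_ge_zero[of "fourier_coeff f 0"] by linarith

text \<open>Strong measurability is witnessed by rounding time down to a grid of mesh
  \<open>T / Suc n\<close>: finitely many values, level sets given by a floor function, and
  convergence because the weighted norm of the difference is continuous in time.\<close>

lemma series_in_Linf_time:
  assumes X: "admissible X" and C: "0 < C" and T: "0 < T"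
    and X_mem: "\<And>b. weighted_summable r b \<Longrightarrow> series b 0 \<in> sobolev X"
    and X_norm: "\<And>b. weighted_summable r b \<Longrightarrow> sobolev_norm X (series b 0) \<le> C * weighted_sum r b"
    and D: "weighted_summable r D" and B: "\<And>k t. t \<in> {0..T} \<Longrightarrow> \<bar>B k t\<bar> \<le> D k"
    and cont: "\<And>k. continuous_on {0..T} (B k)"
  shows "(\<lambda>t. series (\<lambda>k. B k t) 0) \<in> Linf_time T X"
proof -
  define q where "q n t = T / real (Suc n) * real_of_int \<lfloor>t * (real (Suc n) / T)\<rfloor>" for n :: nat and t
  define s where "s n t = series (\<lambda>k. B k (q n t)) 0" for n :: nat and t
  have ws: "weighted_summable r (\<lambda>k. B k t)" if "t \<in> {0..T}" for t
    by (rule weighted_summable_mono[OF D B[OF that]])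
  have q0: "0 \<le> q n t" and qt: "q n t \<le> t" and qd: "t - T / real (Suc n) \<le> q n t" if "0 \<le> t" for n t
  proof -
    let ?c = "real (Suc n) / T"
    have c: "0 < ?c" and Tc: "T / real (Suc n) = 1 / ?c" using T by auto
    have q: "q n t = real_of_int \<lfloor>t * ?c\<rfloor> / ?c" by (simp add: q_def)
    have "0 \<le> t * ?c" by (rule mult_nonneg_nonneg[OF that less_imp_le[OF c]])
    then show "0 \<le> q n t" unfolding q using c by (intro divide_nonneg_pos) auto
    have "real_of_int \<lfloor>t * ?c\<rfloor> \<le> t * ?c" by linarith
    then show "q n t \<le> t" unfolding q using c by (simp only: pos_divide_le_eq)
    have "t * ?c - 1 \<le> real_of_int \<lfloor>t * ?c\<rfloor>" by linarith
    then have "(t * ?c - 1) / ?c \<le> q n t" unfolding q using c by (intro divide_right_mono) auto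
    moreover have "(t * d - 1) / d = t - 1 / d" if "0 < d" for d
      using that by (simp add: diff_divide_distrib)
    note this[OF c]
    ultimately show "t - T / real (Suc n) \<le> q n t" unfolding Tc by (simp only:)
  qed
  have qT: "q n t \<in> {0..T}" if "t \<in> {0..T}" for n t
    using q0[of t n] qt[of t n] that by auto
  have qlim: "(\<lambda>n. q n t) \<longlonglongrightarrow> t" if "t \<in> {0..T}" for t
  proof (rule tendsto_sandwich)
    show "(\<lambda>n. t - T / real (Suc n)) \<longlonglongrightarrow> t"
      using tendsto_diff[OF tendsto_const LIMSEQ_Suc[OF lim_const_over_n[of T]], of t] by simp
    show "\<forall>\<^sub>F n in sequentially. t - T / real (Suc n) \<le> q n t" "\<forall>\<^sub>F n in sequentially. q n t \<le> t"
      using qt qd that by auto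
  qed simp
  have fin: "finite (s n ` {0..T})" for n
  proof (rule finite_subset)
    have "\<lfloor>t * (real (Suc n) / T)\<rfloor> \<in> {0..int (Suc n)}" if "t \<in> {0..T}" for t
    proof -
      have "t * (real (Suc n) / T) \<le> T * (real (Suc n) / T)" "0 \<le> t * (real (Suc n) / T)"
        using that T by (intro mult_right_mono mult_nonneg_nonneg; simp)+
      moreover have "T * (real (Suc n) / T) = real (Suc n)" using T by simp
      ultimately have "0 \<le> t * (real (Suc n) / T)" "t * (real (Suc n) / T) \<le> real (Suc n)" by (simp_all only:)
      then show ?thesis by (simp add: floor_le_iff)
    qed
    then show "s n ` {0..T} \<subseteq> (\<lambda>i. series (\<lambda>k. B k (T / real (Suc n) * real_of_int i)) 0) ` {0..int (Suc n)}"
      unfolding s_def q_def by blast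
  qed simp
  have meas: "{t \<in> {0..T}. s n t = f} \<in> sets lebesgue" for n f
  proof -
    let ?J = "{i. series (\<lambda>k. B k (T / real (Suc n) * real_of_int i)) 0 = f}"
    have "(\<lambda>t. \<lfloor>t * (real (Suc n) / T)\<rfloor>) \<in> measurable lborel (count_space UNIV)"
      by measurable
    then have "(\<lambda>t. \<lfloor>t * (real (Suc n) / T)\<rfloor>) \<in> measurable lebesgue (count_space UNIV)"
      by (rule measurable_completion)
    then have "(\<lambda>t. \<lfloor>t * (real (Suc n) / T)\<rfloor>) -` ?J \<inter> space lebesgue \<in> sets lebesgue"
      by (rule measurable_sets) simp
    then have "{0..T} \<inter> ((\<lambda>t. \<lfloor>t * (real (Suc n) / T)\<rfloor>) -` ?J \<inter> space lebesgue) \<in> sets lebesgue"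
      by (intro sets.Int) auto
    moreover have "{t \<in> {0..T}. s n t = f} = {0..T} \<inter> ((\<lambda>t. \<lfloor>t * (real (Suc n) / T)\<rfloor>) -` ?J \<inter> space lebesgue)"
      by (auto simp: s_def q_def)
    ultimately show ?thesis by (simp only:)
  qed
  have conv: "(\<lambda>n. sobolev_norm X (\<lambda>x. s n t x - series (\<lambda>k. B k t) 0 x)) \<longlonglongrightarrow> 0" if t: "t \<in> {0..T}" for t
  proof -
    \<comment> \<open>Continuity of \<open>V\<close> follows from the uniform majorant
      \<open>2 * D\<close>; since \<open>V t = 0\<close>, evaluation at the rounded times gives
      convergence in \<open>X\<close>.\<close>
    define V where "V u = weighted_sum r (\<lambda>k. B k u - B k t)" for u
    have D2: "weighted_summable r (\<lambda>k. 2 * D k)" by (rule weighted_summable_cmult[OF D])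
    have le: "\<bar>B k u - B k t\<bar> \<le> 2 * D k" if "u \<in> {0..T}" for k u
      using B[OF that, of k] B[OF t, of k] by linarith
    have wd: "weighted_summable r (\<lambda>k. B k u - B k t)" if "u \<in> {0..T}" for u
      by (rule weighted_summable_mono[OF D2 le[OF that]])
    have "continuous_on {0..T} V"
      unfolding V_def weighted_sum_def
    proof (rule infsum_uniform_continuous)
      show "(\<lambda>k. jap k ^ r * \<bar>2 * D k\<bar>) summable_on UNIV" using D2 by (simp add: weighted_summable_def)
      show "\<bar>jap k ^ r * \<bar>B k u - B k t\<bar>\<bar> \<le> jap k ^ r * \<bar>2 * D k\<bar>" if "u \<in> {0..T}" for k u
        using le[OF that, of k] jap_pos[of k] by (simp add: abs_mult)
    qed (intro continuous_intros cont)
    then have "(\<lambda>n. V (q n t)) \<longlonglongrightarrow> V t"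
      by (rule continuous_on_tendsto_compose[OF _ qlim[OF t] t]) (use qT[OF t] in auto)
    moreover have "V t = 0" by (simp add: V_def weighted_sum_def)
    ultimately have "(\<lambda>n. C * V (q n t)) \<longlonglongrightarrow> C * 0" by (intro tendsto_intros) simp
    then have lim: "(\<lambda>n. C * V (q n t)) \<longlonglongrightarrow> 0" by simp
    have eq: "(\<lambda>x. s n t x - series (\<lambda>k. B k t) 0 x) = series (\<lambda>k. B k (q n t) - B k t) 0" for n
      unfolding s_def by (rule ext, rule series_diff[symmetric])
        (use ws qT[OF t] t weighted_summable_imp_summable in blast)+
    show ?thesis
      unfolding eq
    proof (rule tendsto_sandwich[OF _ _ tendsto_const lim])
      show "\<forall>\<^sub>F n in sequentially. 0 \<le> sobolev_norm X (series (\<lambda>k. B k (q n t) - B k t) 0)"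
        by (intro always_eventually allI sobolev_norm_nonneg X X_mem wd qT t)
      show "\<forall>\<^sub>F n in sequentially. sobolev_norm X (series (\<lambda>k. B k (q n t) - B k t) 0) \<le> C * V (q n t)"
        unfolding V_def by (intro always_eventually allI X_norm wd qT t)
    qed
  qed
  have bnd: "sobolev_norm X (series (\<lambda>k. B k t) 0) \<le> C * weighted_sum r D" if t: "t \<in> {0..T}" for t
  proof -
    have "weighted_sum r (\<lambda>k. B k t) \<le> weighted_sum r D"
      unfolding weighted_sum_def
    proof (rule infsum_mono)
      show "jap k ^ r * \<bar>B k t\<bar> \<le> jap k ^ r * \<bar>D k\<bar>" for k
        using B[OF t, of k] jap_pos[of k] by simp
    qed (use ws[OF t] D in \<open>auto simp: weighted_summable_def\<close>)
    then have "C * weighted_sum r (\<lambda>k. B k t) \<le> C * weighted_sum r D" using C by simp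
    then show ?thesis using X_norm[OF ws[OF t]] by linarith
  qed
  have smem: "s n ` {0..T} \<subseteq> sobolev X" for n
    using X_mem ws qT by (auto simp: s_def)
  show ?thesis
    unfolding Linf_time_def mem_Collect_eq
  proof (intro conjI exI[of _ s] exI[of _ "C * weighted_sum r D"] allI)
    show "AE t in lebesgue_on {0..T}. series (\<lambda>k. B k t) 0 \<in> sobolev X \<and>
        (\<lambda>n. sobolev_norm X (\<lambda>x. s n t x - series (\<lambda>k. B k t) 0 x)) \<longlonglongrightarrow> 0"
      using conv X_mem ws by (intro AE_I2) auto
    show "AE t in lebesgue_on {0..T}. sobolev_norm X (series (\<lambda>k. B k t) 0) \<le> C * weighted_sum r D"
      using bnd by (intro AE_I2) auto
  qed (fact fin smem meas)+
qed


text \<open>Each mode is integrated in time, multiplied by the corresponding moment of the test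
  function and summed. The order \<open>r\<close> of \<open>D\<close> serves the space
  \<open>X\<close>; order 1 pays for the derivative in the dissipation and in the transport
  term.\<close>

lemma weak_solution_series:
  assumes X: "admissible X" and C: "0 < C" and T: "0 < T" and par: "0 < \<Omega>" "0 < \<mu>"
    and X_mem: "\<And>b. weighted_summable r b \<Longrightarrow> series b 0 \<in> sobolev X"
    and X_norm: "\<And>b. weighted_summable r b \<Longrightarrow> sobolev_norm X (series b 0) \<le> C * weighted_sum r b"
    and D: "weighted_summable r D" "weighted_summable 1 D"
    and B: "\<And>k t. t \<in> {0..T} \<Longrightarrow> \<bar>B k t\<bar> \<le> D k"
    and odd: "\<And>k t. t \<in> {0..T} \<Longrightarrow> B (- k) t = - B k t"
    and S: "S summable_on UNIV"
    and ode: "\<And>k t. t \<in> {0..T} \<Longrightarrow> (B k has_vector_derivative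
        (S k - \<kappa> * norm (freq k) * B k t - advection \<Omega> \<mu> (\<lambda>k. B k t) (\<lambda>k. B k t) k)) (at t within {0..T})"
  shows "weak_solution \<kappa> \<mu> \<Omega> (series S 0) X T (series (\<lambda>k. B k 0) 0) (\<lambda>t. series (\<lambda>k. B k t) 0)"
  unfolding weak_solution_def
proof (intro conjI ballI)
  have cont: "continuous_on {0..T} (B k)" for k
    unfolding continuous_on_eq_continuous_within by (intro ballI has_vector_derivative_continuous[OF ode])
  show "(\<lambda>t. series (\<lambda>k. B k t) 0) \<in> Linf_time T X"
    by (rule series_in_Linf_time[OF X C T X_mem X_norm D(1) B cont])
  have ws1: "weighted_summable 1 (\<lambda>k. B k t)" and wsr: "weighted_summable r (\<lambda>k. B k t)" if "t \<in> {0..T}" for t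
    by (rule weighted_summable_mono[OF _ B[OF that]], rule D)+
  show "series (\<lambda>k. B k t) 0 \<in> sobolev X" if "t \<in> {0..T}" for t
    by (rule X_mem[OF wsr[OF that]])
  define N where "N t k = advection \<Omega> \<mu> (\<lambda>k. B k t) (\<lambda>k. B k t) k" for t k
  define A where "A k = (\<Sum>\<^sub>\<infinity>p. 6 / \<Omega> * ((jap p * D p) * (jap (k - p) * D (k - p))))" for k
  have T0: "0 \<in> {0..T}" using T by simp
  have D0: "0 \<le> D k" for k using B[OF T0, of k] by linarith
  have NA: "\<bar>N t k\<bar> \<le> A k" if "t \<in> {0..T}" for t k
    unfolding N_def A_def by (rule advection_abs_le[OF par D(2) D0 B[OF that] B[OF that]])
  have As: "A summable_on UNIV"
    unfolding A_def by (rule advection_majorant[OF par D(2) D0 B[OF T0] B[OF T0]])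
  have Ncont: "continuous_on {0..T} (\<lambda>t. N t k)" for k
    unfolding N_def advection_def
    by (rule infsum_uniform_continuous[OF advection_majorant_inner[OF par D(2) D0 B[OF T0] B[OF T0], of k]])
       (intro advection_pair_bound par B continuous_intros cont; assumption)+
  show "\<exists>U. (\<forall>j. \<forall>t\<in>{0..T}. fourier_multiplier (M_symbol \<Omega> \<mu> j) (series (\<lambda>k. B k t) 0) (U j t)) \<and>
      (\<forall>\<phi> \<psi>. test_function \<phi> \<and> fourier_multiplier (\<lambda>k. norm (freq k)) \<phi> \<psi> \<longrightarrow>
        (\<forall>t\<in>{0..T}.
          (LINT x|torus. (series (\<lambda>k. B k t) 0 x - series (\<lambda>k. B k 0) 0 x) * \<phi> x)
          + \<kappa> * (LINT \<tau>:{0..t}|lebesgue. (LINT x|torus. series (\<lambda>k. B k \<tau>) 0 x * \<psi> x))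
          - (LINT \<tau>:{0..t}|lebesgue.
               (LINT x|torus. series (\<lambda>k. B k \<tau>) 0 x * (\<Sum>j\<in>UNIV. U j \<tau> x * partial j \<phi> x)))
          = (LINT \<tau>:{0..t}|lebesgue. (LINT x|torus. series S 0 x * \<phi> x))))"
  proof (intro exI[of _ "\<lambda>j t. series (\<lambda>k. M_symbol \<Omega> \<mu> j k * B k t) 0"] conjI allI impI ballI)
    fix j t assume "t \<in> {0..T}"
    then show "fourier_multiplier (M_symbol \<Omega> \<mu> j) (series (\<lambda>k. B k t) 0) (series (\<lambda>k. M_symbol \<Omega> \<mu> j k * B k t) 0)"
      by (intro fourier_multiplier_series par ws1)
  next
    fix \<phi> \<psi> t
    assume test: "test_function \<phi> \<and> fourier_multiplier (\<lambda>k. norm (freq k)) \<phi> \<psi>" and t: "t \<in> {0..T}"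
    then have \<phi>: "test_function \<phi>" and \<psi>: "fourier_multiplier (\<lambda>k. norm (freq k)) \<phi> \<psi>" by auto
    have sub: "\<tau> \<in> {0..T}" if "\<tau> \<in> {0..t}" for \<tau> using t that by auto
    define s where "s k = (LINT x|torus. wave k 0 x * \<phi> x)" for k
    define F where "F k \<tau> = S k - \<kappa> * norm (freq k) * B k \<tau> - N \<tau> k" for k \<tau>
    have \<phi>i: "integrable torus \<phi>" by (intro integrable_torus_continuous test_function_continuous \<phi>)
    have \<psi>i: "integrable torus \<psi>" using \<psi> Lp_integrable[of \<psi> 2] by (simp add: fourier_multiplier_def)
    \<comment> \<open>A bound on the moments of the test function is enough; all decay in
      \<open>k\<close> comes from the coefficients.\<close>
    obtain \<sigma> where \<sigma>: "0 \<le> \<sigma>" "\<And>k. \<bar>s k\<bar> \<le> \<sigma>"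
      using wave_moment_le[OF \<phi>i, of _ 0] unfolding s_def by (meson abs_ge_zero order_trans)
    have bs: "(\<lambda>k. B k \<tau>) summable_on UNIV" if "\<tau> \<in> {0..T}" for \<tau>
      by (rule weighted_summable_imp_summable[OF ws1[OF that]])
    define I2 where "I2 \<tau> = (LINT x|torus. series (\<lambda>k. B k \<tau>) 0 x * \<psi> x)" for \<tau>
    define I3 where "I3 \<tau> = (LINT x|torus. series (\<lambda>k. B k \<tau>) 0 x *
        (\<Sum>j\<in>UNIV. series (\<lambda>k. M_symbol \<Omega> \<mu> j k * B k \<tau>) 0 x * partial j \<phi> x))" for \<tau>
    define I4 where "I4 = (LINT x|torus. series S 0 x * \<phi> x)"
    have e1: "(LINT x|torus. (series (\<lambda>k. B k t) 0 x - series (\<lambda>k. B k 0) 0 x) * \<phi> x) = (\<Sum>\<^sub>\<infinity>k. (B k t - B k 0) * s k)"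
      unfolding s_def series_diff[OF bs[OF t] bs[OF T0], symmetric]
      by (rule integral_series_mult[OF _ \<phi>i])
         (rule weighted_summable_imp_summable[OF weighted_summable_mono[OF weighted_summable_cmult[OF D(2), of 2]]],
          use B[OF t] B[OF T0] in \<open>smt (verit)\<close>)
    have e2: "I2 \<tau> = (\<Sum>\<^sub>\<infinity>k. norm (freq k) * B k \<tau> * s k)"
      and s2: "(\<lambda>k. norm (freq k) * B k \<tau> * s k) summable_on UNIV" if \<tau>: "\<tau> \<in> {0..T}" for \<tau>
    proof -
      have eq: "B k \<tau> * (LINT x|torus. wave k 0 x * \<psi> x) = norm (freq k) * B k \<tau> * s k" for k
        unfolding norm_freq_moment[OF \<phi> \<psi>] s_def by simp
      show "I2 \<tau> = (\<Sum>\<^sub>\<infinity>k. norm (freq k) * B k \<tau> * s k)"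
        unfolding I2_def integral_series_mult[OF bs[OF \<tau>] \<psi>i] eq ..
      show "(\<lambda>k. norm (freq k) * B k \<tau> * s k) summable_on UNIV"
        using summable_series_mult[OF bs[OF \<tau>] \<psi>i, of 0] unfolding eq .
    qed
    have e3: "I3 \<tau> = - (\<Sum>\<^sub>\<infinity>k. N \<tau> k * s k)" if \<tau>: "\<tau> \<in> {0..T}" for \<tau>
      unfolding I3_def N_def s_def by (rule integral_transport[OF par ws1[OF \<tau>] odd[OF \<tau>] \<phi>])
    have As\<sigma>: "(\<lambda>k. A k * \<sigma>) summable_on UNIV" by (rule summable_on_cmult_left[OF As])
    have N\<sigma>: "\<bar>N \<tau> k * s k\<bar> \<le> A k * \<sigma>" if \<tau>: "\<tau> \<in> {0..T}" for \<tau> k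
      unfolding abs_mult by (intro mult_mono NA[OF \<tau>] \<sigma> order_trans[OF abs_ge_zero NA[OF \<tau>]]) auto
    have s3: "(\<lambda>k. N \<tau> k * s k) summable_on UNIV" if \<tau>: "\<tau> \<in> {0..T}" for \<tau>
      by (rule summable_on_comparison_real[OF As\<sigma> N\<sigma>[OF \<tau>]])
    have e4: "I4 = (\<Sum>\<^sub>\<infinity>k. S k * s k)" and s4: "(\<lambda>k. S k * s k) summable_on UNIV"
      unfolding I4_def s_def by (rule integral_series_mult[OF S \<phi>i], rule summable_series_mult[OF S \<phi>i])
    have G: "(\<Sum>\<^sub>\<infinity>k. F k \<tau> * s k) = I4 - \<kappa> * I2 \<tau> + I3 \<tau>" if \<tau>: "\<tau> \<in> {0..T}" for \<tau>
    proof -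
      have "((\<lambda>k. (S k * s k + (- \<kappa>) * (norm (freq k) * B k \<tau> * s k)) + (- 1) * (N \<tau> k * s k)) has_sum
          (I4 + (- \<kappa>) * I2 \<tau>) + (- 1) * (\<Sum>\<^sub>\<infinity>k. N \<tau> k * s k)) UNIV"
        unfolding e4 e2[OF \<tau>] by (intro has_sum_add has_sum_cmult_right has_sum_infsum s2 s3 s4 \<tau>)
      moreover have "(S k * s k + (- \<kappa>) * (norm (freq k) * B k \<tau> * s k)) + (- 1) * (N \<tau> k * s k) = F k \<tau> * s k" for k
        by (simp add: F_def algebra_simps)
      ultimately show ?thesis unfolding e3[OF \<tau>] by (intro infsumI) simp
    qed
    let ?m = "lebesgue_on {0..t}"
    have bc: "continuous_on {0..t} (B k)" "continuous_on {0..t} (\<lambda>\<tau>. N \<tau> k)" for k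
      using continuous_on_subset[OF cont] continuous_on_subset[OF Ncont] sub by (auto simp: subset_iff)
    have Fc: "continuous_on {0..t} (F k)" for k
      unfolding F_def by (intro continuous_intros bc)
    have Fint: "(LINT \<tau>|?m. F k \<tau> * s k) = (B k t - B k 0) * s k" for k
    proof -
      have "(F k has_integral (B k t - B k 0)) {0..t}"
      proof (rule fundamental_theorem_of_calculus)
        show "(B k has_vector_derivative F k \<tau>) (at \<tau> within {0..t})" if "\<tau> \<in> {0..t}" for \<tau>
          unfolding F_def N_def using ode[OF sub[OF that], of k]
          by (rule has_vector_derivative_within_subset) (use sub in auto)
      qed (use t in auto)
      then have "integral {0..t} (F k) = B k t - B k 0" by (rule integral_unique)
      moreover have "integrable ?m (F k)" by (rule continuous_imp_integrable_real[OF Fc])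
      ultimately show ?thesis by (simp add: lebesgue_integral_eq_integral)
    qed
    have fm: "finite_measure ?m" by (rule finite_measure_lebesgue_on) simp
    have one: "integrable ?m (\<lambda>_. 1::real)" by (rule finite_measure.integrable_const[OF fm])
    let ?C = "\<lambda>k. (\<bar>S k\<bar> + \<bar>\<kappa>\<bar> * (jap k ^ 1 * \<bar>D k\<bar>) + A k) * \<sigma>"
    have Cs: "?C summable_on UNIV"
      using D(2) unfolding weighted_summable_def
      by (intro summable_on_cmult_left summable_on_add summable_on_cmult_right summable_on_abs[OF S] As)
    have Fle: "\<bar>F k \<tau> * s k\<bar> \<le> ?C k * 1" if \<tau>: "\<tau> \<in> space ?m" for k \<tau>
    proof -
      have \<tau>T: "\<tau> \<in> {0..T}" using \<tau> sub by simp
      have "\<bar>F k \<tau>\<bar> \<le> \<bar>S k\<bar> + \<bar>\<kappa> * norm (freq k) * B k \<tau>\<bar> + \<bar>N \<tau> k\<bar>" unfolding F_def by linarith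
      moreover have "\<bar>\<kappa> * norm (freq k) * B k \<tau>\<bar> \<le> \<bar>\<kappa>\<bar> * (jap k ^ 1 * \<bar>D k\<bar>)"
        using B[OF \<tau>T, of k] unfolding abs_mult mult.assoc by (intro mult_left_mono mult_mono) (auto simp: jap_def)
      ultimately have "\<bar>F k \<tau>\<bar> \<le> \<bar>S k\<bar> + \<bar>\<kappa>\<bar> * (jap k ^ 1 * \<bar>D k\<bar>) + A k" using NA[OF \<tau>T, of k] by linarith
      then show ?thesis unfolding abs_mult using \<sigma> by (simp add: mult_mono)
    qed
    have meas: "(\<lambda>\<tau>. F k \<tau> * s k) \<in> borel_measurable ?m" for k
      by (intro continuous_imp_measurable_on_sets_lebesgue continuous_intros Fc) simp
    have Gint: "(LINT \<tau>|?m. (\<Sum>\<^sub>\<infinity>k. F k \<tau> * s k)) = (\<Sum>\<^sub>\<infinity>k. (B k t - B k 0) * s k)"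
      using integral_infsum[OF infinite_int3 meas one _ Cs Fle] by (simp only: Fint zero_le_one)
    have c2: "continuous_on {0..t} (\<lambda>\<tau>. \<Sum>\<^sub>\<infinity>k. norm (freq k) * B k \<tau> * s k)"
    proof (rule infsum_uniform_continuous)
      show "(\<lambda>k. (jap k ^ 1 * \<bar>D k\<bar>) * \<sigma>) summable_on UNIV"
        using D(2) unfolding weighted_summable_def by (rule summable_on_cmult_left)
      show "\<bar>norm (freq k) * B k \<tau> * s k\<bar> \<le> (jap k ^ 1 * \<bar>D k\<bar>) * \<sigma>" if "\<tau> \<in> {0..t}" for k \<tau>
        using B[OF sub[OF that], of k] \<sigma> jap_pos[of k] unfolding abs_mult
        by (intro mult_mono mult_nonneg_nonneg) (auto simp: jap_def)
    qed (intro continuous_intros bc)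
    have c3: "continuous_on {0..t} (\<lambda>\<tau>. - (\<Sum>\<^sub>\<infinity>k. N \<tau> k * s k))"
      by (rule continuous_on_minus, rule infsum_uniform_continuous[OF As\<sigma> N\<sigma>])
         (use t in \<open>auto intro!: continuous_intros bc\<close>)
    \<comment> \<open>Integrability in time of the spatial integrals is read off from their series,
      which are continuous by the uniform majorants.\<close>
    have i2: "integrable ?m I2"
      using continuous_imp_integrable_real[OF c2] by (subst Bochner_Integration.integrable_cong[OF refl e2]) (use t in auto)
    have i3: "integrable ?m I3"
      using continuous_imp_integrable_real[OF c3] by (subst Bochner_Integration.integrable_cong[OF refl e3]) (use t in auto)
    have i4: "integrable ?m (\<lambda>_. I4)" by (rule finite_measure.integrable_const[OF fm])
    have "(LINT \<tau>|?m. (\<Sum>\<^sub>\<infinity>k. F k \<tau> * s k)) = (LINT \<tau>|?m. I4 - \<kappa> * I2 \<tau> + I3 \<tau>)"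
      by (rule Bochner_Integration.integral_cong[OF refl G]) (use t in auto)
    also have "\<dots> = (LINT \<tau>|?m. I4 - \<kappa> * I2 \<tau>) + (LINT \<tau>|?m. I3 \<tau>)"
      by (intro Bochner_Integration.integral_add Bochner_Integration.integrable_diff integrable_mult_right i2 i3 i4)
    also have "(LINT \<tau>|?m. I4 - \<kappa> * I2 \<tau>) = (LINT \<tau>|?m. I4) - (LINT \<tau>|?m. \<kappa> * I2 \<tau>)"
      by (intro Bochner_Integration.integral_diff integrable_mult_right i2 i4)
    finally have "(LINT x|torus. (series (\<lambda>k. B k t) 0 x - series (\<lambda>k. B k 0) 0 x) * \<phi> x)
       = (LINT \<tau>|?m. I4) - \<kappa> * (LINT \<tau>|?m. I2 \<tau>) + (LINT \<tau>|?m. I3 \<tau>)"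
      unfolding e1 Gint by simp
    then show "(LINT x|torus. (series (\<lambda>k. B k t) 0 x - series (\<lambda>k. B k 0) 0 x) * \<phi> x)
          + \<kappa> * (LINT \<tau>:{0..t}|lebesgue. (LINT x|torus. series (\<lambda>k. B k \<tau>) 0 x * \<psi> x))
          - (LINT \<tau>:{0..t}|lebesgue.
               (LINT x|torus. series (\<lambda>k. B k \<tau>) 0 x * (\<Sum>j\<in>UNIV. series (\<lambda>k. M_symbol \<Omega> \<mu> j k * B k \<tau>) 0 x * partial j \<phi> x)))
          = (LINT \<tau>:{0..t}|lebesgue. (LINT x|torus. series S 0 x * \<phi> x))"
      unfolding set_lint_lebesgue_on I2_def[symmetric] I3_def[symmetric] I4_def[symmetric] by simp
  qed
qed simp

section \<open>Duhamel estimates\<close>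

lemma jap_add_le: "jap (p + q) \<le> jap p + jap q"
  using norm_triangle_ineq[of "freq p" "freq q"] by (simp add: jap_def)

lemma jap_add_le_mult: "jap (p + q) \<le> jap p * jap q"
proof -
  have "norm (freq (p + q)) \<le> norm (freq p) + norm (freq q)"
    using norm_triangle_ineq[of "freq p" "freq q"] by simp
  moreover have "0 \<le> norm (freq p) * norm (freq q)" by simp
  moreover have "jap p * jap q = 1 + norm (freq p) + norm (freq q) + norm (freq p) * norm (freq q)"
    by (simp add: jap_def algebra_simps)
  ultimately show ?thesis unfolding jap_def[of "p + q"] by linarith
qed

lemma hfreq_add_le: "hfreq (p + q) \<le> hfreq p + hfreq q"
  unfolding hfreq_def freq_simps vector_add_component by linarith

lemma summable_int_inverse_square: "(\<lambda>j::int. 1 / (1 + \<bar>real_of_int j\<bar>) ^ 2) summable_on UNIV"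
proof -
  let ?f = "\<lambda>j::int. 1 / (1 + \<bar>real_of_int j\<bar>) ^ 2"
  have s: "summable (\<lambda>n. 1 / (1 + real n) ^ 2)"
    using summable_Suc_iff[of "\<lambda>n. inverse (real n ^ 2)"] inverse_power_summable[of 2, where 'a = real]
    by (simp add: inverse_eq_divide)
  then have n: "(\<lambda>n::nat. 1 / (1 + real n) ^ 2) summable_on UNIV"
    by (intro summable_nonneg_imp_summable_on) auto
  have "?f summable_on (int ` UNIV)"
    by (subst summable_on_reindex) (use n in \<open>auto simp: o_def\<close>)
  moreover have "?f summable_on ((\<lambda>n. - int n) ` UNIV)"
    by (subst summable_on_reindex) (use n in \<open>auto simp: o_def inj_on_def\<close>)
  ultimately have "?f summable_on (int ` UNIV \<union> (\<lambda>n. - int n) ` UNIV)"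
    by (rule summable_on_union)
  moreover have "int ` UNIV \<union> (\<lambda>n. - int n) ` UNIV = UNIV"
  proof -
    have "j \<in> int ` UNIV \<union> (\<lambda>n. - int n) ` UNIV" for j
      by (cases j rule: int_cases2) auto
    then show ?thesis by blast
  qed
  ultimately show ?thesis by simp
qed

text \<open>\<open>jap k\<close> dominates each \<open>1 + |k $ i|\<close>, so
  \<open>jap k ^ 6\<close> dominates a product of three squares and the sum factorises into
  one-dimensional ones.\<close>

lemma summable_jap:
  assumes "6 \<le> n"
  shows "(\<lambda>k. 1 / jap k ^ n) summable_on UNIV"
proof -
  let ?f = "\<lambda>j::int. 1 / (1 + \<bar>real_of_int j\<bar>) ^ 2"
  have f0: "0 \<le> ?f j" for j by simp
  have "(\<lambda>(x, y). ?f x * ?f y) summable_on UNIV \<times> UNIV"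
    by (intro product_summable summable_int_inverse_square f0)
  then have two: "(\<lambda>z. case z of (x, y) \<Rightarrow> ?f x * ?f y) summable_on UNIV" by simp
  have "(\<lambda>(x, z). ?f x * (case z of (x, y) \<Rightarrow> ?f x * ?f y)) summable_on UNIV \<times> UNIV"
    by (intro product_summable summable_int_inverse_square two) auto
  then have three: "(\<lambda>(x, y, z). ?f x * (?f y * ?f z)) summable_on UNIV"
    unfolding case_prod_unfold by simp
  let ?g = "\<lambda>k::int^3. (k $ 1, k $ 2, k $ 3)"
  have bij: "bij_betw ?g UNIV UNIV"
    by (rule bij_betw_byWitness[where f' = "\<lambda>(x, y, z). vector [x, y, z]"]) (auto simp: vec_eq_iff forall_3)
  have sum: "(\<lambda>k::int^3. ?f (k $ 1) * (?f (k $ 2) * ?f (k $ 3))) summable_on UNIV"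
    using three summable_on_reindex_bij_betw[OF bij, of "\<lambda>(x, y, z). ?f x * (?f y * ?f z)"] by simp
  show ?thesis
  proof (rule summable_on_comparison_real[OF sum])
    fix k :: "int^3"
    have c: "1 + \<bar>real_of_int (k $ i)\<bar> \<le> jap k" for i
      using component_le_norm_cart[of "freq k" i] by (simp add: jap_def freq_def)
    have "(1 + \<bar>real_of_int (k $ 1)\<bar>) ^ 2 * ((1 + \<bar>real_of_int (k $ 2)\<bar>) ^ 2 * (1 + \<bar>real_of_int (k $ 3)\<bar>) ^ 2)
       \<le> jap k ^ 2 * (jap k ^ 2 * jap k ^ 2)"
      by (intro mult_mono power_mono c mult_nonneg_nonneg) auto
    also have "\<dots> = jap k ^ 6" by (simp add: power_add[symmetric])
    also have "\<dots> \<le> jap k ^ n" by (rule power_increasing[OF assms jap_ge_1])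
    finally have le: "(1 + \<bar>real_of_int (k $ 1)\<bar>) ^ 2 * ((1 + \<bar>real_of_int (k $ 2)\<bar>) ^ 2 * (1 + \<bar>real_of_int (k $ 3)\<bar>) ^ 2) \<le> jap k ^ n" .
    have "1 / jap k ^ n \<le> 1 / ((1 + \<bar>real_of_int (k $ 1)\<bar>) ^ 2 * ((1 + \<bar>real_of_int (k $ 2)\<bar>) ^ 2 * (1 + \<bar>real_of_int (k $ 3)\<bar>) ^ 2))"
      by (rule divide_left_mono[OF le]) (use jap_pos[of k] in \<open>auto intro!: mult_pos_pos zero_less_power add_pos_nonneg\<close>)
    then show "\<bar>1 / jap k ^ n\<bar> \<le> ?f (k $ 1) * (?f (k $ 2) * ?f (k $ 3))"
      using jap_pos[of k] by simp
  qed
qed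

lemma weighted_summable_jap:
  assumes "n + 6 \<le> r"
  shows "weighted_summable n (\<lambda>k. c / jap k ^ r)"
proof -
  have eq: "jap k ^ n * \<bar>c / jap k ^ r\<bar> = \<bar>c\<bar> * (1 / jap k ^ (r - n))" for k
    using jap_pos[of k] assms by (simp add: power_diff field_simps)
  show ?thesis
    unfolding weighted_summable_def eq using assms by (intro summable_on_cmult_right summable_jap) simp
qed

text \<open>One of \<open>p\<close> and \<open>q\<close> has a bracket at least half that of
  \<open>p + q\<close>. Summed over \<open>p + q = k\<close>, this shows that decay of order
  \<open>n\<close> survives convolution.\<close>

lemma jap_convolution_term:
  "1 / (jap p ^ n * jap q ^ n) \<le> 2 ^ n * (1 / jap p ^ n + 1 / jap q ^ n) / jap (p + q) ^ n"
proof -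
  have "jap (p + q) \<le> 2 * max (jap p) (jap q)"
    using jap_add_le[of p q] by (auto simp: max_def)
  then have "jap (p + q) ^ n \<le> (2 * max (jap p) (jap q)) ^ n"
    using jap_pos[of "p + q"] by (intro power_mono) auto
  also have "\<dots> = 2 ^ n * max (jap p) (jap q) ^ n" by (rule power_mult_distrib)
  also have "max (jap p) (jap q) ^ n \<le> jap p ^ n + jap q ^ n"
    using jap_pos[of p] jap_pos[of q] by (auto simp: max_def)
  finally have "jap (p + q) ^ n \<le> 2 ^ n * (jap p ^ n + jap q ^ n)" by simp
  then show ?thesis
    using jap_pos[of p] jap_pos[of q] jap_pos[of "p + q"] by (simp add: field_simps)
qed

text \<open>After multiplication by \<open>exp (\<nu> * s)\<close> the difference between
  \<open>f\<close> and the claimed bound is nonincreasing. The bound on the forcing grows like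
  \<open>exp (\<eta> * s)\<close>, so the denominator is \<open>\<nu> + \<eta>\<close> instead of
  \<open>\<nu>\<close>: the shrinking weight acts as additional damping. The estimate is one-sided,
  the form required by a comparison argument.\<close>

lemma comparison_ode:
  fixes f F :: "real \<Rightarrow> real"
  assumes d: "\<And>t. t \<in> {0..T} \<Longrightarrow> (f has_vector_derivative (F t - \<nu> * f t)) (at t within {0..T})"
    and f0: "f 0 \<le> 0" and F: "\<And>t. t \<in> {0..T} \<Longrightarrow> F t \<le> G * exp (- (\<eta> * (T - t)))"
    and c: "0 < \<nu> + \<eta>" and G: "0 \<le> G" and t: "t \<in> {0..T}"
  shows "f t \<le> G / (\<nu> + \<eta>) * exp (- (\<eta> * (T - t)))"
proof -
  let ?c = "\<nu> + \<eta>"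
  define \<psi> where "\<psi> s = exp (\<nu> * s) * f s - G / ?c * exp (- (\<eta> * T)) * exp (?c * s)" for s
  have d\<psi>: "(\<psi> has_derivative (\<lambda>y. (exp (\<nu> * s) * F s - G * exp (- (\<eta> * T)) * exp (?c * s)) * y)) (at s within {0..t})"
    if s: "s \<in> {0..t}" for s
  proof -
    have "s \<in> {0..T}" using s t by auto
    then have "(f has_real_derivative (F s - \<nu> * f s)) (at s within {0..T})"
      using d[of s] by (simp add: has_real_derivative_iff_has_vector_derivative)
    then have "(f has_real_derivative (F s - \<nu> * f s)) (at s within {0..t})"
      by (rule DERIV_subset) (use t in auto)
    then have "(\<psi> has_real_derivative (exp (\<nu> * s) * F s - G / ?c * exp (- (\<eta> * T)) * (exp (?c * s) * ?c))) (at s within {0..t})"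
    proof -
      assume fd: "(f has_real_derivative (F s - \<nu> * f s)) (at s within {0..t})"
      define K c where "K = G / ?c * exp (- (\<eta> * T))" and "c = ?c"
      have "((\<lambda>s. exp (\<nu> * s) * f s - K * exp (c * s)) has_real_derivative (exp (\<nu> * s) * F s - K * (exp (c * s) * c))) (at s within {0..t})"
        using fd by (auto intro!: derivative_eq_intros simp: algebra_simps)
      then show ?thesis
        unfolding K_def c_def \<psi>_def .
    qed
    moreover have "G / ?c * exp (- (\<eta> * T)) * (exp (?c * s) * ?c) = G * exp (- (\<eta> * T)) * exp (?c * s)"
      using c by simp
    ultimately have "(\<psi> has_real_derivative (exp (\<nu> * s) * F s - G * exp (- (\<eta> * T)) * exp (?c * s))) (at s within {0..t})"
      by (simp only:)
    then show ?thesis by (simp add: has_field_derivative_def)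
  qed
  have "\<psi> t \<le> \<psi> 0"
  proof (cases "t = 0")
    case False
    then have "0 < t" using t by simp
    then have "\<exists>s\<in>{0<..<t}. \<psi> t - \<psi> 0 = (exp (\<nu> * s) * F s - G * exp (- (\<eta> * T)) * exp (?c * s)) * (t - 0)"
      by (rule mvt_simple) (use d\<psi> in auto)
    then obtain s where s: "s \<in> {0<..<t}"
      and eq: "\<psi> t - \<psi> 0 = (exp (\<nu> * s) * F s - G * exp (- (\<eta> * T)) * exp (?c * s)) * (t - 0)" by blast
    have "exp (\<nu> * s) * F s \<le> exp (\<nu> * s) * (G * exp (- (\<eta> * (T - s))))"
      using F[of s] s t by (intro mult_left_mono) auto
    also have "\<dots> = G * exp (- (\<eta> * T)) * exp (?c * s)"
    proof -
      have "exp (\<nu> * s) * exp (- (\<eta> * (T - s))) = exp (- (\<eta> * T)) * exp (?c * s)"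
        unfolding exp_add[symmetric] by (simp add: algebra_simps)
      then show ?thesis by (simp add: mult.assoc mult.left_commute)
    qed
    finally have "(exp (\<nu> * s) * F s - G * exp (- (\<eta> * T)) * exp (?c * s)) * (t - 0) \<le> 0"
      using \<open>0 < t\<close> by (intro mult_nonpos_nonneg) auto
    then show ?thesis using eq by linarith
  qed simp
  also have "\<psi> 0 \<le> 0"
    using f0 G c by (simp add: \<psi>_def) (smt (verit) divide_nonneg_pos exp_ge_zero mult_nonneg_nonneg)
  finally have "exp (\<nu> * t) * f t \<le> G / ?c * (exp (- (\<eta> * T)) * exp (?c * t))"
    by (simp add: \<psi>_def)
  also have "exp (- (\<eta> * T)) * exp (?c * t) = exp (\<nu> * t) * exp (- (\<eta> * (T - t)))"
    unfolding exp_add[symmetric] by (simp add: algebra_simps)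
  finally have "exp (\<nu> * t) * f t \<le> exp (\<nu> * t) * (G / ?c * exp (- (\<eta> * (T - t))))"
    by (simp add: mult.left_commute)
  then show ?thesis by (rule mult_left_le_imp_le) simp
qed

definition duhamel :: "real \<Rightarrow> (real \<Rightarrow> real) \<Rightarrow> real \<Rightarrow> real" where
  "duhamel \<nu> F t = exp (- \<nu> * t) * integral {0..t} (\<lambda>s. exp (\<nu> * s) * F s)"

lemma duhamel_0 [simp]: "duhamel \<nu> F 0 = 0"
  by (simp add: duhamel_def)

lemma duhamel_has_derivative:
  assumes F: "continuous_on {0..T} F" and t: "t \<in> {0..T}"
  shows "(duhamel \<nu> F has_vector_derivative (F t - \<nu> * duhamel \<nu> F t)) (at t within {0..T})"
proof -
  have c: "continuous_on {0..T} (\<lambda>s. exp (\<nu> * s) * F s)" by (intro continuous_intros F)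
  have "((\<lambda>u. integral {0..u} (\<lambda>s. exp (\<nu> * s) * F s)) has_vector_derivative (exp (\<nu> * t) * F t)) (at t within {0..T})"
    by (rule integral_has_vector_derivative[OF c t])
  then have "((\<lambda>u. integral {0..u} (\<lambda>s. exp (\<nu> * s) * F s)) has_real_derivative (exp (\<nu> * t) * F t)) (at t within {0..T})"
    by (simp add: has_real_derivative_iff_has_vector_derivative)
  then have "(duhamel \<nu> F has_real_derivative (exp (- \<nu> * t) * (exp (\<nu> * t) * F t)
       + (- \<nu> * exp (- \<nu> * t)) * integral {0..t} (\<lambda>s. exp (\<nu> * s) * F s))) (at t within {0..T})"
    unfolding duhamel_def[abs_def] by (auto intro!: derivative_eq_intros)
  moreover have "exp (- \<nu> * t) * (exp (\<nu> * t) * F t) = F t"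
    unfolding mult.assoc[symmetric] exp_add[symmetric] by simp
  then have "exp (- \<nu> * t) * (exp (\<nu> * t) * F t) + (- \<nu> * exp (- \<nu> * t)) * integral {0..t} (\<lambda>s. exp (\<nu> * s) * F s)
      = F t - \<nu> * duhamel \<nu> F t"
    unfolding duhamel_def by (simp only: mult_minus_left mult_minus_right mult.assoc)
  ultimately have "(duhamel \<nu> F has_real_derivative (F t - \<nu> * duhamel \<nu> F t)) (at t within {0..T})"
    by (simp only:)
  then show ?thesis by (simp add: has_real_derivative_iff_has_vector_derivative)
qed

text \<open>Telescopes through the mixed term \<open>advection \<Omega> \<mu> c b k\<close>, so that
  each product on the right has the difference as one factor.\<close>

lemma advection_diff:
  assumes s: "(\<lambda>p. transport \<Omega> \<mu> p (k - p) * b p * b (k - p)) summable_on UNIV"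
      "(\<lambda>p. transport \<Omega> \<mu> p (k - p) * c p * b (k - p)) summable_on UNIV"
      "(\<lambda>p. transport \<Omega> \<mu> p (k - p) * c p * c (k - p)) summable_on UNIV"
  shows "advection \<Omega> \<mu> b b k - advection \<Omega> \<mu> c c k
    = advection \<Omega> \<mu> (\<lambda>k. b k - c k) b k + advection \<Omega> \<mu> c (\<lambda>k. b k - c k) k"
proof -
  let ?v = "\<lambda>p. transport \<Omega> \<mu> p (k - p)"
  have "advection \<Omega> \<mu> (\<lambda>k. b k - c k) b k = advection \<Omega> \<mu> b b k - advection \<Omega> \<mu> c b k"
    using infsum_add[OF s(1) summable_on_uminus[THEN iffD2, OF s(2)]]
    by (simp add: advection_def infsum_uminus algebra_simps)
  moreover have "advection \<Omega> \<mu> c (\<lambda>k. b k - c k) k = advection \<Omega> \<mu> c b k - advection \<Omega> \<mu> c c k"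
    using infsum_add[OF s(2) summable_on_uminus[THEN iffD2, OF s(3)]]
    by (simp add: advection_def infsum_uminus algebra_simps)
  ultimately show ?thesis by simp
qed

lemma advection_0 [simp]: "advection \<Omega> \<mu> b c 0 = 0"
  by (simp add: advection_def)

lemma advection_odd:
  assumes "\<And>k. b (- k) = - b k"
  shows "advection \<Omega> \<mu> b b (- k) = - advection \<Omega> \<mu> b b k"
proof -
  have "advection \<Omega> \<mu> b b (- k) = (\<Sum>\<^sub>\<infinity>p. transport \<Omega> \<mu> (- p) (- k - - p) * b (- p) * b (- k - - p))"
    unfolding advection_def by (rule infsum_neg_reindex[symmetric])
  also have "\<dots> = (\<Sum>\<^sub>\<infinity>p. - (transport \<Omega> \<mu> p (k - p) * b p * b (k - p)))"
  proof (rule infsum_cong)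
    fix p
    have "- k - - p = - (k - p)" by simp
    then show "transport \<Omega> \<mu> (- p) (- k - - p) * b (- p) * b (- k - - p) = - (transport \<Omega> \<mu> p (k - p) * b p * b (k - p))"
      by (simp only: transport_minus assms minus_mult_minus mult_minus_right mult_minus_left minus_minus)
  qed
  finally show ?thesis by (simp add: advection_def infsum_uminus)
qed


lemma open_singleton_int3: "open {k :: int^3}"
  unfolding open_vec_def
proof (intro ballI exI[of _ "\<lambda>i. {k $ i}"] conjI allI impI)
  fix x :: "int^3" and i assume "x \<in> {k}"
  then show "open {k $ i}" "x $ i \<in> {k $ i}" by (auto intro: open_discrete)
next
  fix x y :: "int^3" assume "x \<in> {k}" "\<forall>i. y $ i \<in> {k $ i}"
  then show "y \<in> {k}" by (simp add: vec_eq_iff)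
qed

text \<open>Coefficient families become elements of a space of continuous functions on frequencies
  times time; the frequencies being discrete, this means continuity in time for each
  \<open>k\<close>.\<close>

lemma continuous_on_discrete_times:
  fixes f :: "(int^3) \<times> real \<Rightarrow> real"
  assumes "\<And>k. continuous_on UNIV (\<lambda>t. f (k, t))"
  shows "continuous_on UNIV f"
proof -
  have "continuous_on (\<Union>k. {k} \<times> (UNIV :: real set)) f"
  proof (rule continuous_on_open_UN)
    show "open ({k :: int^3} \<times> (UNIV :: real set))" for k
      by (intro open_Times open_singleton_int3 open_UNIV)
    show "continuous_on ({k} \<times> UNIV) f" for k
    proof -
      have "continuous_on ({k} \<times> UNIV) (\<lambda>x. f (k, snd x))"
        by (rule continuous_on_compose2[OF assms[of k]]) (auto intro!: continuous_intros)
      then show ?thesis by (rule continuous_on_eq) auto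
    qed
  qed
  moreover have "(\<Union>k. {k :: int^3} \<times> (UNIV :: real set)) = UNIV" by auto
  ultimately show ?thesis by simp
qed

section \<open>Weighted bounds for perturbations of the steady state\<close>

locale perturbation =
  fixes \<kappa> \<mu> \<Omega> a T :: real and m r :: nat
  assumes pos: "0 < \<kappa>" "0 < \<mu>" "0 < \<Omega>" "0 < a" "0 < T" and m: "1 \<le> m" and r: "7 \<le> r"
begin

definition base_freq :: "int^3" where
  "base_freq = axis 3 (int m)"

text \<open>The linearisation at the steady state: the vertical velocity of the perturbation times
  \<open>a * m * cos (m * x $ 3)\<close>, a product that shifts frequencies by
  \<open>base_freq\<close> up and down. The steady state itself has zero velocity and contributes no
  further term.\<close>

definition coupling :: "(int^3 \<Rightarrow> real) \<Rightarrow> int^3 \<Rightarrow> real" where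
  "coupling b k = - (a * real m / 2) * (M_symbol \<Omega> \<mu> 3 (k - base_freq) * b (k - base_freq)
      + M_symbol \<Omega> \<mu> 3 (k + base_freq) * b (k + base_freq))"

text \<open>The decay rate \<open>rate\<close> of the analyticity radius in the horizontal frequencies makes the
  linear coupling, which loses one horizontal derivative, a contraction with constant \<open>1/4\<close>.\<close>

definition rate :: real where
  "rate = 4 * a * real m * (1 + real m) ^ r / \<Omega>"

definition weight :: "int^3 \<Rightarrow> real \<Rightarrow> real" where
  "weight k t = jap k ^ r * exp (rate * hfreq k * (T - t))"

text \<open>\<open>6 / \<Omega>\<close> bounds the transport symbol, \<open>2 ^ (r - 1)\<close> is
  the convolution constant at exponent \<open>r - 1\<close>, and a further 2 counts the two
  symmetric sums.\<close>

definition quad_const :: real where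
  "quad_const = 6 / \<Omega> * 2 ^ r * (\<Sum>\<^sub>\<infinity>k. 1 / jap k ^ (r - 1))"

lemma rate_pos: "0 < rate"
  unfolding rate_def using pos m by auto

lemma weight_pos: "0 < weight k t"
  by (simp add: weight_def jap_pos)

lemma weight_minus [simp]: "weight (- k) t = weight k t"
  by (simp add: weight_def)

lemma weight_ge_jap: "t \<le> T \<Longrightarrow> jap k ^ r \<le> weight k t"
  using mult_left_mono[of 1 "exp (rate * hfreq k * (T - t))" "jap k ^ r"] rate_pos hfreq_nonneg[of k] jap_pos[of k]
  by (simp add: weight_def)

lemma quad_const_nonneg: "0 \<le> quad_const"
  unfolding quad_const_def using pos jap_pos
  by (intro mult_nonneg_nonneg infsum_nonneg) (auto intro: less_imp_le)

lemma freq_base [simp]: "freq base_freq $ 1 = 0" "freq base_freq $ 2 = 0" "freq base_freq $ 3 = real m"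
  by (simp_all add: base_freq_def freq_def axis_def)

lemma norm_freq_base: "norm (freq base_freq) = real m"
proof -
  have "(norm (freq base_freq))\<^sup>2 = (real m)\<^sup>2" by (simp add: norm_vec3_sq)
  then show ?thesis by simp
qed

lemma hfreq_base [simp]: "hfreq (k + base_freq) = hfreq k" "hfreq (k - base_freq) = hfreq k"
  by (simp_all add: hfreq_def)

lemma jap_base: "jap k \<le> jap (k + base_freq) * (1 + real m)" "jap k \<le> jap (k - base_freq) * (1 + real m)"
  using jap_add_le_mult[of "k + base_freq" "- base_freq"] jap_add_le_mult[of "k - base_freq" "base_freq"]
  by (simp_all add: jap_def[of base_freq] norm_freq_base)

text \<open>The shift changes only the vertical frequency, so the exponential factors coincide and
  only the polynomial weight costs a constant.\<close>

lemma weight_base: "weight k t \<le> (1 + real m) ^ r * weight (k + base_freq) t"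
  "weight k t \<le> (1 + real m) ^ r * weight (k - base_freq) t"
  using power_mono[OF jap_base(1)[of k], of r] power_mono[OF jap_base(2)[of k], of r] jap_pos[of k]
  by (simp_all add: weight_def power_mult_distrib mult.commute mult.left_commute)

lemma divide_weight: "N / weight k s = N / jap k ^ r * exp (- (rate * hfreq k * (T - s)))"
  unfolding weight_def exp_minus by (simp add: divide_inverse)

text \<open>Symbol and shift of the weight together produce \<open>hfreq k\<close> times
  \<open>a * m * (1 + m) ^ r / \<Omega>\<close>, which is \<open>rate / 4\<close>. The lost
  horizontal derivative is thus a quarter of the rate at which the exponential weight decays in
  time.\<close>

lemma coupling_bound:
  assumes b: "\<And>l. \<bar>b l\<bar> \<le> N / weight l s"
  shows "\<bar>coupling b k\<bar> \<le> rate * hfreq k / 4 * N / jap k ^ r * exp (- (rate * hfreq k * (T - s)))"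
proof -
  have N: "0 \<le> N"
    using b[of 0] weight_pos[of 0 s] by (meson abs_ge_zero order_trans zero_le_divide_iff not_le order.asym)
  have one: "\<bar>M_symbol \<Omega> \<mu> 3 l * b l\<bar> \<le> hfreq k / \<Omega> * ((1 + real m) ^ r * N / weight k s)"
    if l: "hfreq l = hfreq k" "weight k s \<le> (1 + real m) ^ r * weight l s" for l
  proof -
    have "N * weight k s \<le> N * ((1 + real m) ^ r * weight l s)" using l(2) N by (rule mult_left_mono)
    then have "N / weight l s \<le> (1 + real m) ^ r * N / weight k s"
      using weight_pos[of k s] weight_pos[of l s] by (simp add: field_simps)
    then have "\<bar>b l\<bar> \<le> (1 + real m) ^ r * N / weight k s" using b[of l] by linarith
    moreover have "\<bar>M_symbol \<Omega> \<mu> 3 l\<bar> \<le> hfreq k / \<Omega>" using M_symbol_abs_le[of \<Omega> \<mu> 3 l] pos l(1) by simp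
    ultimately show ?thesis
      unfolding abs_mult using hfreq_nonneg[of k] pos by (intro mult_mono) auto
  qed
  have "\<bar>coupling b k\<bar> \<le> a * real m / 2 * (\<bar>M_symbol \<Omega> \<mu> 3 (k - base_freq) * b (k - base_freq)\<bar>
      + \<bar>M_symbol \<Omega> \<mu> 3 (k + base_freq) * b (k + base_freq)\<bar>)"
    unfolding coupling_def abs_mult[of "- (a * real m / 2)"] using pos by (intro mult_mono abs_triangle_ineq) auto
  also have "\<dots> \<le> a * real m / 2 * (hfreq k / \<Omega> * ((1 + real m) ^ r * N / weight k s) + hfreq k / \<Omega> * ((1 + real m) ^ r * N / weight k s))"
    using pos by (intro mult_left_mono add_mono one weight_base hfreq_base) auto
  also have "\<dots> = rate * hfreq k / 4 * N / weight k s"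
    using pos by (simp add: rate_def field_simps)
  also have "\<dots> = rate * hfreq k / 4 * N / jap k ^ r * exp (- (rate * hfreq k * (T - s)))"
    by (simp only: divide_weight)
  finally show ?thesis .
qed

text \<open>Since \<open>hfreq\<close> is subadditive, the exponential factors of \<open>p\<close>
  and \<open>k - p\<close> combine into that of \<open>k\<close>. The symbol costs one bracket in
  each factor, which leaves exponent \<open>r - 1 \<ge> 6\<close> for the convolution; relative to
  the weight one full, not merely horizontal, derivative is lost.\<close>

lemma
  assumes b: "\<And>l. \<bar>b l\<bar> \<le> N1 / weight l s" and c: "\<And>l. \<bar>c l\<bar> \<le> N2 / weight l s" and s: "s \<le> T"
  shows advection_bound: "\<bar>advection \<Omega> \<mu> b c k\<bar>
      \<le> quad_const * N1 * N2 * jap k / jap k ^ r * exp (- (rate * hfreq k * (T - s)))"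
    and advection_terms_summable: "(\<lambda>p. transport \<Omega> \<mu> p (k - p) * b p * c (k - p)) summable_on UNIV"
proof -
  have N: "0 \<le> N1" "0 \<le> N2"
    using b[of 0] c[of 0] weight_pos[of 0 s] by (meson abs_ge_zero order_trans zero_le_divide_iff not_le order.asym)+
  define n where "n = r - 1"
  have rn: "r = Suc n" and n6: "6 \<le> n" using r by (auto simp: n_def)
  let ?e = "exp (- (rate * hfreq k * (T - s)))"
  let ?K = "6 / \<Omega> * N1 * N2 * ?e * 2 ^ n / jap k ^ n"
  have sj: "(\<lambda>p. 1 / jap p ^ n) summable_on UNIV" by (rule summable_jap[OF n6])
  have bij: "bij_betw (\<lambda>p. k - p) UNIV UNIV"
    by (rule bij_betw_byWitness[where f' = "\<lambda>p. k - p"]) auto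
  have sj': "(\<lambda>p. 1 / jap (k - p) ^ n) summable_on UNIV"
    using sj summable_on_reindex_bij_betw[OF bij, of "\<lambda>p. 1 / jap p ^ n"] by simp
  have ij': "(\<Sum>\<^sub>\<infinity>p. 1 / jap (k - p) ^ n) = (\<Sum>\<^sub>\<infinity>p. 1 / jap p ^ n)"
    by (rule infsum_reindex_bij_betw[OF bij])
  have le: "\<bar>transport \<Omega> \<mu> p (k - p) * b p * c (k - p)\<bar> \<le> ?K * (1 / jap p ^ n + 1 / jap (k - p) ^ n)" for p
  proof -
    define q where "q = k - p"
    have pq: "p + q = k" by (simp add: q_def)
    have "\<bar>transport \<Omega> \<mu> p q * b p * c q\<bar> \<le> 6 / \<Omega> * (jap p * jap q) * (N1 / weight p s) * (N2 / weight q s)"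
      unfolding abs_mult using pos N weight_pos
      by (intro mult_mono transport_abs_le b c mult_nonneg_nonneg divide_nonneg_pos) (auto intro: less_imp_le[OF jap_pos])
    also have "\<dots> = 6 / \<Omega> * N1 * N2 * (1 / (jap p ^ n * jap q ^ n)) * (exp (- (rate * hfreq p * (T - s))) * exp (- (rate * hfreq q * (T - s))))"
    proof -
      have "jap l / jap l ^ r = 1 / jap l ^ n" for l
        using jap_pos[of l] unfolding rn by simp
      then have "1 / (jap p ^ n * jap q ^ n) = (jap p / jap p ^ r) * (jap q / jap q ^ r)" by simp
      then show ?thesis unfolding divide_weight by (simp only: times_divide_eq_left times_divide_eq_right mult_ac divide_divide_eq_left)
    qed
    also have "\<dots> \<le> 6 / \<Omega> * N1 * N2 * (2 ^ n * (1 / jap p ^ n + 1 / jap q ^ n) / jap k ^ n) * ?e"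
    proof (intro mult_mono mult_left_mono)
      show "1 / (jap p ^ n * jap q ^ n) \<le> 2 ^ n * (1 / jap p ^ n + 1 / jap q ^ n) / jap k ^ n"
        using jap_convolution_term[of p n q] by (simp only: pq)
      have "hfreq k * (rate * (T - s)) \<le> (hfreq p + hfreq q) * (rate * (T - s))"
        using hfreq_add_le[of p q] rate_pos s unfolding pq by (intro mult_right_mono) auto
      then show "exp (- (rate * hfreq p * (T - s))) * exp (- (rate * hfreq q * (T - s))) \<le> ?e"
        unfolding exp_add[symmetric] exp_le_cancel_iff by (simp add: algebra_simps)
    qed (use pos N jap_pos in \<open>auto intro!: mult_nonneg_nonneg divide_nonneg_pos add_nonneg_nonneg zero_less_power zero_le_power less_imp_le[OF jap_pos]\<close>)
    also have "\<dots> = ?K * (1 / jap p ^ n + 1 / jap q ^ n)" by (simp add: field_simps)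
    finally show ?thesis by (simp only: q_def)
  qed
  have maj: "(\<lambda>p. ?K * (1 / jap p ^ n + 1 / jap (k - p) ^ n)) summable_on UNIV"
    by (intro summable_on_cmult_right summable_on_add sj sj')
  show "(\<lambda>p. transport \<Omega> \<mu> p (k - p) * b p * c (k - p)) summable_on UNIV"
    by (rule summable_on_comparison_real[OF maj le])
  have "\<bar>advection \<Omega> \<mu> b c k\<bar> \<le> (\<Sum>\<^sub>\<infinity>p. ?K * (1 / jap p ^ n + 1 / jap (k - p) ^ n))"
    unfolding advection_def by (rule infsum_abs_le[OF maj le])
  also have "\<dots> = ?K * (2 * (\<Sum>\<^sub>\<infinity>p. 1 / jap p ^ n))"
    unfolding infsum_cmult_right' infsum_add[OF sj sj'] ij' by simp
  also have "\<dots> = quad_const * N1 * N2 * jap k / jap k ^ r * ?e"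
  proof -
    have "quad_const = 6 / \<Omega> * (2 * 2 ^ n) * (\<Sum>\<^sub>\<infinity>p. 1 / jap p ^ n)"
      unfolding quad_const_def n_def[symmetric] by (simp add: rn)
    moreover have "jap k / jap k ^ r = 1 / jap k ^ n" using jap_pos[of k] by (simp add: rn)
    moreover have "quad_const * N1 * N2 * jap k / jap k ^ r = quad_const * N1 * N2 * (jap k / jap k ^ r)" by simp
    ultimately show ?thesis by (simp only:) simp
  qed
  finally show "\<bar>advection \<Omega> \<mu> b c k\<bar> \<le> quad_const * N1 * N2 * jap k / jap k ^ r * ?e" .
qed

end

text \<open>The library has this only for metric domains, and \<open>int\<close> carries no metric.\<close>

lemma complete_bcontfun: "complete (UNIV :: ('a::topological_space \<Rightarrow>\<^sub>C 'b::complete_space) set)"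
proof (rule completeI)
  fix f :: "nat \<Rightarrow> ('a, 'b) bcontfun"
  assume "Cauchy f"
  then have "\<forall>e>0. \<exists>N. \<forall>m n x. N \<le> m \<and> N \<le> n \<and> True \<longrightarrow> dist (f m x) (f n x) < e"
    unfolding Cauchy_def by (meson dist_bounded le_less_trans)
  then obtain g where g: "\<forall>e>0. \<exists>N. \<forall>n x. N \<le> n \<and> True \<longrightarrow> dist (f n x) (g x) < e"
    using uniformly_convergent_eq_cauchy[of "\<lambda>_. True" f] by auto
  have "uniform_limit UNIV f g sequentially"
    unfolding uniform_limit_sequentially_iff
  proof (intro allI impI)
    fix e :: real assume "0 < e"
    with g obtain N where "\<forall>n x. N \<le> n \<and> True \<longrightarrow> dist (f n x) (g x) < e" by presburger
    then show "\<exists>N. \<forall>n\<ge>N. \<forall>x\<in>UNIV. dist (f n x) (g x) < e" by (intro exI[of _ N]) simp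
  qed
  from uniform_limit_bcontfunE[OF this sequentially_bot]
  obtain l where "f \<longlonglongrightarrow> l" .
  then show "\<exists>l\<in>UNIV. f \<longlonglongrightarrow> l" by (intro bexI[of _ l]) simp_all
qed

section \<open>The fixed point for small analytic data\<close>

context perturbation
begin

definition forcing :: "(int^3 \<Rightarrow> real) \<Rightarrow> int^3 \<Rightarrow> real" where
  "forcing b k = coupling b k - advection \<Omega> \<mu> b b k"

text \<open>The two terms of the denominator beat the two lost derivatives separately:
  \<open>rate * hfreq k\<close> reduces the coupling to \<open>N1 / 4\<close>, and
  \<open>\<kappa> * norm (freq k)\<close> reduces the quadratic part to
  \<open>2 * N2 / \<kappa>\<close>, because \<open>jap k \<le> 2 * norm (freq k)\<close> for
  \<open>k \<noteq> 0\<close>.\<close>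

lemma response_bound:
  assumes k: "k \<noteq> 0" and N: "0 \<le> N1" "0 \<le> N2"
  defines "G \<equiv> (rate * hfreq k / 4 * N1 + N2 * jap k) / jap k ^ r"
  shows "0 < \<kappa> * norm (freq k) + rate * hfreq k" "0 \<le> G"
    "G / (\<kappa> * norm (freq k) + rate * hfreq k) \<le> (N1 / 4 + 2 * N2 / \<kappa>) / jap k ^ r"
proof -
  let ?n = "norm (freq k)" and ?h = "rate * hfreq k"
  have n: "1 \<le> ?n" by (rule norm_freq_ge_1[OF k])
  have h: "0 \<le> ?h" using rate_pos hfreq_nonneg[of k] by simp
  have kn: "0 < \<kappa> * ?n" using pos(1) n by (intro mult_pos_pos) auto
  show c: "0 < \<kappa> * ?n + ?h" using kn h by linarith
  show "0 \<le> G" unfolding G_def using rate_pos hfreq_nonneg[of k] N jap_pos[of k]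
    by (intro divide_nonneg_pos add_nonneg_nonneg mult_nonneg_nonneg) auto
  have "?h / 4 * N1 \<le> N1 / 4 * (\<kappa> * ?n + ?h)"
    using kn N by (simp add: algebra_simps)
  moreover have "N2 * jap k \<le> 2 * N2 / \<kappa> * (\<kappa> * ?n + ?h)"
  proof -
    have "N2 * jap k \<le> N2 * (2 * ?n)" using N n by (intro mult_left_mono) (auto simp: jap_def)
    also have "\<dots> = 2 * N2 / \<kappa> * (\<kappa> * ?n)" using pos by simp
    also have "\<dots> \<le> 2 * N2 / \<kappa> * (\<kappa> * ?n + ?h)" using h N pos by (intro mult_left_mono) auto
    finally show ?thesis .
  qed
  ultimately have "?h / 4 * N1 + N2 * jap k \<le> (N1 / 4 + 2 * N2 / \<kappa>) * (\<kappa> * ?n + ?h)"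
    by (simp only: distrib_right)
  then have "(?h / 4 * N1 + N2 * jap k) / (\<kappa> * ?n + ?h) \<le> N1 / 4 + 2 * N2 / \<kappa>"
    using c by (simp only: pos_divide_le_eq)
  then have "(?h / 4 * N1 + N2 * jap k) / (\<kappa> * ?n + ?h) / jap k ^ r \<le> (N1 / 4 + 2 * N2 / \<kappa>) / jap k ^ r"
    using jap_pos[of k] by (intro divide_right_mono) auto
  then show "G / (\<kappa> * ?n + ?h) \<le> (N1 / 4 + 2 * N2 / \<kappa>) / jap k ^ r"
    unfolding G_def by (simp only: divide_divide_eq_left mult.commute)
qed

lemma response_le:
  assumes k: "k \<noteq> 0" and N: "0 \<le> N1" "0 \<le> N2"
    and d: "\<And>t. t \<in> {0..T} \<Longrightarrow> (e has_vector_derivative (F t - \<kappa> * norm (freq k) * e t)) (at t within {0..T})"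
    and e0: "e 0 \<le> 0"
    and F: "\<And>s. s \<in> {0..T} \<Longrightarrow>
      F s \<le> (rate * hfreq k / 4 * N1 + N2 * jap k) / jap k ^ r * exp (- (rate * hfreq k * (T - s)))"
    and t: "t \<in> {0..T}"
  shows "e t \<le> (N1 / 4 + 2 * N2 / \<kappa>) / weight k t"
proof -
  note R = response_bound[OF k N]
  have "e t \<le> (rate * hfreq k / 4 * N1 + N2 * jap k) / jap k ^ r / (\<kappa> * norm (freq k) + rate * hfreq k)
      * exp (- (rate * hfreq k * (T - t)))"
    by (rule comparison_ode[OF d e0 F R(1,2) t])
  also have "\<dots> \<le> (N1 / 4 + 2 * N2 / \<kappa>) / jap k ^ r * exp (- (rate * hfreq k * (T - t)))"
    by (intro mult_right_mono R(3)) simp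
  also have "\<dots> = (N1 / 4 + 2 * N2 / \<kappa>) / weight k t" by (rule divide_weight[symmetric])
  finally show ?thesis .
qed

lemma response_abs_le:
  assumes k: "k \<noteq> 0" and N: "0 \<le> N1" "0 \<le> N2"
    and d: "\<And>t. t \<in> {0..T} \<Longrightarrow> (e has_vector_derivative (F t - \<kappa> * norm (freq k) * e t)) (at t within {0..T})"
    and e0: "e 0 = 0"
    and F: "\<And>s. s \<in> {0..T} \<Longrightarrow>
      \<bar>F s\<bar> \<le> (rate * hfreq k / 4 * N1 + N2 * jap k) / jap k ^ r * exp (- (rate * hfreq k * (T - s)))"
    and t: "t \<in> {0..T}"
  shows "\<bar>e t\<bar> \<le> (N1 / 4 + 2 * N2 / \<kappa>) / weight k t"
proof -
  let ?G = "(rate * hfreq k / 4 * N1 + N2 * jap k) / jap k ^ r"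
  have "e t \<le> (N1 / 4 + 2 * N2 / \<kappa>) / weight k t"
  proof (rule response_le[OF k N d _ _ t])
    show "F s \<le> ?G * exp (- (rate * hfreq k * (T - s)))" if "s \<in> {0..T}" for s
      using F[OF that] by linarith
  qed (use e0 in simp_all)
  moreover have "- e t \<le> (N1 / 4 + 2 * N2 / \<kappa>) / weight k t"
  proof (rule response_le[where e = "\<lambda>t. - e t" and F = "\<lambda>t. - F t", OF k N _ _ _ t])
    show "((\<lambda>t. - e t) has_vector_derivative (- F s - \<kappa> * norm (freq k) * - e s)) (at s within {0..T})"
      if "s \<in> {0..T}" for s
      using has_vector_derivative_minus[OF d[OF that]] by simp
    show "- F s \<le> ?G * exp (- (rate * hfreq k * (T - s)))" if "s \<in> {0..T}" for s
      using F[OF that] by linarith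
  qed (use e0 in simp_all)
  ultimately show ?thesis by linarith
qed

lemma forcing_bound:
  assumes b: "\<And>l. \<bar>b l\<bar> \<le> N / weight l s" and s: "s \<le> T"
  shows "\<bar>forcing b k\<bar> \<le> (rate * hfreq k / 4 * N + quad_const * N * N * jap k) / jap k ^ r * exp (- (rate * hfreq k * (T - s)))"
  using coupling_bound[OF b, of k] advection_bound[OF b b s, of k]
  by (simp add: forcing_def add_divide_distrib distrib_right)

lemma coupling_diff: "coupling b k - coupling c k = coupling (\<lambda>l. b l - c l) k"
  by (simp add: coupling_def algebra_simps)

lemma forcing_diff_bound:
  assumes b: "\<And>l. \<bar>b l\<bar> \<le> N / weight l s" and c: "\<And>l. \<bar>c l\<bar> \<le> N / weight l s"
    and bc: "\<And>l. \<bar>b l - c l\<bar> \<le> M / weight l s" and s: "s \<le> T"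
  shows "\<bar>forcing b k - forcing c k\<bar>
    \<le> (rate * hfreq k / 4 * M + 2 * quad_const * N * M * jap k) / jap k ^ r * exp (- (rate * hfreq k * (T - s)))"
proof -
  have "forcing b k - forcing c k = coupling (\<lambda>l. b l - c l) k
      - (advection \<Omega> \<mu> (\<lambda>l. b l - c l) b k + advection \<Omega> \<mu> c (\<lambda>l. b l - c l) k)"
    using advection_diff[OF advection_terms_summable[OF b b s] advection_terms_summable[OF c b s] advection_terms_summable[OF c c s], of k]
    by (simp add: forcing_def coupling_diff[symmetric])
  then have "\<bar>forcing b k - forcing c k\<bar> \<le> \<bar>coupling (\<lambda>l. b l - c l) k\<bar>
      + (\<bar>advection \<Omega> \<mu> (\<lambda>l. b l - c l) b k\<bar> + \<bar>advection \<Omega> \<mu> c (\<lambda>l. b l - c l) k\<bar>)"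
    by linarith
  also have "\<dots> \<le> rate * hfreq k / 4 * M / jap k ^ r * exp (- (rate * hfreq k * (T - s)))
      + (quad_const * M * N * jap k / jap k ^ r * exp (- (rate * hfreq k * (T - s)))
       + quad_const * N * M * jap k / jap k ^ r * exp (- (rate * hfreq k * (T - s))))"
    by (intro add_mono coupling_bound advection_bound b c bc s)
  also have "\<dots> = (rate * hfreq k / 4 * M + 2 * quad_const * N * M * jap k) / jap k ^ r * exp (- (rate * hfreq k * (T - s)))"
    by (simp add: add_divide_distrib distrib_right)
  finally show ?thesis .
qed

lemma weight_antimono: "s \<le> t \<Longrightarrow> weight k t \<le> weight k s"
  unfolding weight_def using rate_pos hfreq_nonneg[of k] jap_pos[of k]
  by (intro mult_left_mono) (auto intro!: mult_left_mono)

text \<open>At \<open>k = 0\<close> there is neither damping nor decay of the exponential weight, so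
  the mean must not be forced at all: the coupling vanishes with \<open>hfreq 0\<close>, the
  advection by incompressibility.\<close>

lemma forcing_0: "forcing b 0 = 0" if "\<And>l. \<bar>b l\<bar> \<le> N / weight l s" for b
proof -
  have "hfreq 0 = 0" by (simp add: hfreq_def)
  then show ?thesis using coupling_bound[OF that, of 0] by (simp add: forcing_def)
qed

lemma forcing_odd: "(\<And>l. b (- l) = - b l) \<Longrightarrow> forcing b (- k) = - forcing b k"
proof -
  assume odd: "\<And>l. b (- l) = - b l"
  have "- k - base_freq = - (k + base_freq)" "- k + base_freq = - (k - base_freq)" by simp_all
  then have "coupling b (- k) = - coupling b k"
    unfolding coupling_def by (simp only: odd M_symbol_minus) (simp add: algebra_simps)
  then show ?thesis using advection_odd[where b = b and k = k, OF odd, of \<Omega> \<mu>] by (simp add: forcing_def)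
qed

lemma forcing_continuous:
  assumes c: "\<And>l. continuous_on {0..T} (b l)" and b: "\<And>l t. t \<in> {0..T} \<Longrightarrow> \<bar>b l t\<bar> \<le> N / weight l t"
  shows "continuous_on {0..T} (\<lambda>t. forcing (\<lambda>l. b l t) k)"
proof -
  have D: "weighted_summable 1 (\<lambda>l. N / jap l ^ r)" using r by (intro weighted_summable_jap) simp
  have T0: "0 \<in> {0..T}" using pos by simp
  have N: "0 \<le> N"
    using b[OF T0, of 0] weight_pos[of 0 0] by (meson abs_ge_zero order_trans zero_le_divide_iff not_le order.asym)
  have bD: "\<bar>b l t\<bar> \<le> N / jap l ^ r" if "t \<in> {0..T}" for l t
    using b[OF that, of l] divide_left_mono[OF weight_ge_jap[of t l] N] that jap_pos[of l] weight_pos[of l t] by force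
  have D0: "0 \<le> N / jap l ^ r" for l using N jap_pos[of l] by simp
  have "continuous_on {0..T} (\<lambda>t. advection \<Omega> \<mu> (\<lambda>l. b l t) (\<lambda>l. b l t) k)"
    unfolding advection_def
    by (rule infsum_uniform_continuous[OF advection_majorant_inner[OF pos(3,2) D D0 bD[OF T0] bD[OF T0], of k]])
       (intro advection_pair_bound pos bD continuous_intros c; assumption)+
  then show ?thesis unfolding forcing_def coupling_def by (intro continuous_intros c)
qed

text \<open>A contraction in the ball of radius \<open>2 * \<delta>\<close> of the weighted supremum
  norm. The bound \<open>32 * quad_const * \<delta> \<le> \<kappa>\<close> is what makes the
  quadratic part contribute \<open>\<delta> / 4\<close> to the size and a factor
  \<open>1 / 4\<close> to differences. With the coupling the sizes add up to at most
  \<open>\<delta> + \<delta> / 2 + \<delta> / 4\<close>, and the Lipschitz constants to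
  \<open>1 / 2\<close>.\<close>

lemma small_data_solution:
  assumes odd: "\<And>k. b0 (- k) = - b0 k" and \<delta>: "0 \<le> \<delta>" "32 * quad_const * \<delta> \<le> \<kappa>"
    and b0: "\<And>k. weight k 0 * \<bar>b0 k\<bar> \<le> \<delta>"
  shows "\<exists>b. (\<forall>k. b k 0 = b0 k) \<and> (\<forall>k t. b (- k) t = - b k t) \<and>
    (\<forall>k. \<forall>t\<in>{0..T}. \<bar>b k t\<bar> \<le> 2 * \<delta> / weight k t) \<and>
    (\<forall>k. \<forall>t\<in>{0..T}.
      (b k has_vector_derivative (forcing (\<lambda>l. b l t) k - \<kappa> * norm (freq k) * b k t)) (at t within {0..T}))"
proof -
  \<comment> \<open>The bounded continuous functions live on all real times, so time is clamped to
    \<open>{0..T}\<close>.\<close>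
  define cl where "cl t = max 0 (min T t)" for t
  have cl: "cl t \<in> {0..T}" for t using pos by (auto simp: cl_def)
  have cl_id: "cl t = t" if "t \<in> {0..T}" for t using that by (auto simp: cl_def)
  have cl_cont: "continuous_on A cl" for A unfolding cl_def by (intro continuous_intros)
  \<comment> \<open>The unknown is the coefficient multiplied by its weight, which turns the
    weighted norm into the plain supremum norm; \<open>co\<close> undoes the multiplication.\<close>
  define co where "co \<beta> k t = apply_bcontfun \<beta> (k, cl t) / weight k (cl t)"
    for \<beta> :: "((int^3) \<times> real) \<Rightarrow>\<^sub>C real" and k t
  have weight_cont: "continuous_on A (weight k)" for A k
    unfolding weight_def by (intro continuous_intros)
  have co_cont: "continuous_on A (co \<beta> k)" for A \<beta> k
    unfolding co_def
    by (intro continuous_on_divide continuous_on_compose2[OF continuous_on_apply_bcontfun] continuous_on_compose2[OF weight_cont cl_cont]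
        continuous_intros cl_cont) (use weight_pos in \<open>auto simp: less_imp_neq[symmetric]\<close>)
  have co_le: "\<bar>co \<beta> k t\<bar> \<le> norm \<beta> / weight k t" if "t \<in> {0..T}" for \<beta> k t
    unfolding co_def cl_id[OF that] using norm_bounded[of \<beta> "(k, t)"] weight_pos[of k t]
    by (simp add: divide_right_mono)
  define pre where "pre \<beta> k t = exp (- (\<kappa> * norm (freq k)) * t) * b0 k
      + duhamel (\<kappa> * norm (freq k)) (\<lambda>s. forcing (\<lambda>l. co \<beta> l s) k) t" for \<beta> k t
  have F_cont: "continuous_on {0..T} (\<lambda>s. forcing (\<lambda>l. co \<beta> l s) k)" for \<beta> k
    by (rule forcing_continuous[OF co_cont co_le])
  note duh = duhamel_has_derivative[OF F_cont]
  have duh_cont: "continuous_on {0..T} (duhamel (\<kappa> * norm (freq k)) (\<lambda>s. forcing (\<lambda>l. co \<beta> l s) k))" for \<beta> k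
    unfolding continuous_on_eq_continuous_within by (intro ballI has_vector_derivative_continuous[OF duh])
  have pre_cont: "continuous_on {0..T} (pre \<beta> k)" for \<beta> k
    unfolding pre_def by (intro continuous_intros duh_cont)
  have duh_le: "\<bar>duhamel (\<kappa> * norm (freq k)) (\<lambda>s. forcing (\<lambda>l. co \<beta> l s) k) t\<bar>
      \<le> (norm \<beta> / 4 + 2 * (quad_const * norm \<beta> * norm \<beta>) / \<kappa>) / weight k t" if t: "t \<in> {0..T}" for \<beta> k t
  proof (cases "k = 0")
    case True
    have "integral {0..t} (\<lambda>s. exp (\<kappa> * norm (freq k) * s) * forcing (\<lambda>l. co \<beta> l s) k) = integral {0..t} (\<lambda>_. 0)"
      by (rule integral_cong) (use True forcing_0[OF co_le] t in auto)
    then show ?thesis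
      using quad_const_nonneg pos weight_pos[of k t] by (simp add: duhamel_def)
  next
    case False
    show ?thesis
      by (rule response_abs_le[OF False _ _ duh _ _ t])
         (use forcing_bound[OF co_le] quad_const_nonneg in auto)
  qed
  have init_le: "\<bar>exp (- (\<kappa> * norm (freq k)) * t) * b0 k\<bar> \<le> \<delta> / weight k t" if t: "t \<in> {0..T}" for k t
  proof -
    have "exp (- (\<kappa> * norm (freq k)) * t) \<le> 1" using pos t by simp
    then have "\<bar>exp (- (\<kappa> * norm (freq k)) * t) * b0 k\<bar> \<le> \<bar>b0 k\<bar>"
      by (simp add: abs_mult mult_left_le_one_le)
    moreover have "weight k t * \<bar>b0 k\<bar> \<le> weight k 0 * \<bar>b0 k\<bar>"
      using weight_antimono[of 0 t k] t by (intro mult_right_mono) auto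
    then have "weight k t * \<bar>b0 k\<bar> \<le> \<delta>" using b0[of k] by linarith
    then have "\<bar>b0 k\<bar> \<le> \<delta> / weight k t" using weight_pos[of k t] by (simp add: pos_le_divide_eq mult.commute)
    ultimately show ?thesis by linarith
  qed
  have pre_le: "weight k t * \<bar>pre \<beta> k t\<bar> \<le> \<delta> + (norm \<beta> / 4 + 2 * (quad_const * norm \<beta> * norm \<beta>) / \<kappa>)"
    if t: "t \<in> {0..T}" for \<beta> k t
  proof -
    have "\<bar>pre \<beta> k t\<bar> \<le> \<delta> / weight k t + (norm \<beta> / 4 + 2 * (quad_const * norm \<beta> * norm \<beta>) / \<kappa>) / weight k t"
      unfolding pre_def using abs_triangle_ineq init_le[OF t, of k] duh_le[OF t, of k \<beta>] by (meson add_mono order_trans)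
    then have "weight k t * \<bar>pre \<beta> k t\<bar> \<le> weight k t * ((\<delta> + (norm \<beta> / 4 + 2 * (quad_const * norm \<beta> * norm \<beta>) / \<kappa>)) / weight k t)"
      using weight_pos[of k t] by (intro mult_left_mono) (auto simp: add_divide_distrib)
    then show ?thesis using weight_pos[of k t] by simp
  qed
  define \<Phi> where "\<Phi> \<beta> = Bcontfun (\<lambda>(k, t). weight k (cl t) * pre \<beta> k (cl t))" for \<beta>
  have \<Phi>_apply: "apply_bcontfun (\<Phi> \<beta>) (k, t) = weight k (cl t) * pre \<beta> k (cl t)" for \<beta> k t
  proof -
    have "(\<lambda>(k, t). weight k (cl t) * pre \<beta> k (cl t)) \<in> bcontfun"
    proof (rule bcontfun_normI)
      show "continuous_on UNIV (\<lambda>(k, t). weight k (cl t) * pre \<beta> k (cl t))"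
      proof (rule continuous_on_discrete_times)
        fix k
        have "continuous_on UNIV (\<lambda>t. weight k (cl t) * pre \<beta> k (cl t))"
          by (intro continuous_on_mult continuous_on_compose2[OF weight_cont cl_cont] continuous_on_compose2[OF pre_cont cl_cont])
             (use cl in auto)
        then show "continuous_on UNIV (\<lambda>t. case (k, t) of (k, t) \<Rightarrow> weight k (cl t) * pre \<beta> k (cl t))" by simp
      qed
      show "norm (case x of (k, t) \<Rightarrow> weight k (cl t) * pre \<beta> k (cl t))
          \<le> \<delta> + (norm \<beta> / 4 + 2 * (quad_const * norm \<beta> * norm \<beta>) / \<kappa>)" for x
        using pre_le[OF cl, of "fst x" "snd x" \<beta>] weight_pos[of "fst x" "cl (snd x)"]
        by (cases x) (simp add: abs_mult)
    qed
    then show ?thesis unfolding \<Phi>_def by (simp add: Bcontfun_inverse)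
  qed
  have \<Phi>_norm: "norm (\<Phi> \<beta>) \<le> \<delta> + (norm \<beta> / 4 + 2 * (quad_const * norm \<beta> * norm \<beta>) / \<kappa>)" for \<beta>
  proof (rule norm_bound)
    fix x :: "(int^3) \<times> real"
    show "norm (apply_bcontfun (\<Phi> \<beta>) x) \<le> \<delta> + (norm \<beta> / 4 + 2 * (quad_const * norm \<beta> * norm \<beta>) / \<kappa>)"
      using pre_le[OF cl, of "fst x" "snd x" \<beta>] weight_pos[of "fst x" "cl (snd x)"]
      by (cases x) (simp add: \<Phi>_apply abs_mult)
  qed
  \<comment> \<open>Oddness is a closed condition preserved by the map, so it is built into the set
    and inherited by the fixed point.\<close>
  define S where "S = {\<beta> :: ((int^3) \<times> real) \<Rightarrow>\<^sub>C real. norm \<beta> \<le> 2 * \<delta> \<and> (\<forall>k t. apply_bcontfun \<beta> (- k, t) = - apply_bcontfun \<beta> (k, t))}"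
  have eval_cont: "continuous_on UNIV (\<lambda>\<beta> :: ((int^3) \<times> real) \<Rightarrow>\<^sub>C real. apply_bcontfun \<beta> x)" for x
  proof (rule continuous_onI)
    fix \<beta> :: "((int^3) \<times> real) \<Rightarrow>\<^sub>C real" and e :: real
    assume "0 < e"
    then show "\<exists>d>0. \<forall>\<gamma>\<in>UNIV. dist \<gamma> \<beta> < d \<longrightarrow> dist (apply_bcontfun \<gamma> x) (apply_bcontfun \<beta> x) \<le> e"
      using dist_bounded[of _ x \<beta>] by (meson less_imp_le order_trans)
  qed
  have "closed S"
  proof -
    have "S = cball 0 (2 * \<delta>) \<inter> (\<Inter>k. \<Inter>t. {\<beta>. apply_bcontfun \<beta> (- k, t) = - apply_bcontfun \<beta> (k, t)})"
      by (auto simp: S_def)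
    moreover have "closed {\<beta> :: ((int^3) \<times> real) \<Rightarrow>\<^sub>C real. apply_bcontfun \<beta> (- k, t) = - apply_bcontfun \<beta> (k, t)}" for k t
      by (rule closed_Collect_eq[OF eval_cont continuous_on_minus[OF eval_cont]])
    ultimately show ?thesis
      by (simp only:) (intro closed_Int closed_cball closed_INT ballI)
  qed
  then have S_complete: "complete S" by (rule complete_closed_subset[OF _ subset_UNIV complete_bcontfun])
  have S_ne: "S \<noteq> {}"
  proof -
    have "0 \<in> S" using \<delta> by (simp add: S_def)
    then show ?thesis by blast
  qed
  have \<Phi>S: "\<Phi> ` S \<subseteq> S"
  proof safe
    fix \<beta> assume \<beta>: "\<beta> \<in> S"
    then have n: "norm \<beta> \<le> 2 * \<delta>" by (simp add: S_def)
    have "2 * (quad_const * norm \<beta> * norm \<beta>) / \<kappa> \<le> 2 * (quad_const * (2 * \<delta>) * (2 * \<delta>)) / \<kappa>"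
      using n quad_const_nonneg pos \<delta> by (intro divide_right_mono mult_left_mono mult_mono) auto
    also have "\<dots> = (32 * quad_const * \<delta>) * (\<delta> / 4) / \<kappa>" by simp
    also have "\<dots> \<le> \<kappa> * (\<delta> / 4) / \<kappa>"
      using \<delta> pos by (intro divide_right_mono mult_right_mono) auto
    also have "\<dots> = \<delta> / 4" using pos by simp
    finally have "norm (\<Phi> \<beta>) \<le> 2 * \<delta>" using \<Phi>_norm[of \<beta>] n \<delta> by linarith
    moreover have "apply_bcontfun (\<Phi> \<beta>) (- k, t) = - apply_bcontfun (\<Phi> \<beta>) (k, t)" for k t
    proof -
      have "co \<beta> (- l) s = - co \<beta> l s" for l s using \<beta> by (simp add: S_def co_def)
      then have "forcing (\<lambda>l. co \<beta> l s) (- k) = - forcing (\<lambda>l. co \<beta> l s) k" for s by (rule forcing_odd)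
      then have "pre \<beta> (- k) u = - pre \<beta> k u" for u by (simp add: pre_def duhamel_def odd)
      then show ?thesis by (simp add: \<Phi>_apply)
    qed
    ultimately show "\<Phi> \<beta> \<in> S" by (simp add: S_def)
  qed
  have \<Phi>_contr: "dist (\<Phi> \<beta>) (\<Phi> \<gamma>) \<le> 1 / 2 * dist \<beta> \<gamma>" if \<beta>: "\<beta> \<in> S" and \<gamma>: "\<gamma> \<in> S" for \<beta> \<gamma>
  proof (rule dist_bound)
    fix x :: "(int^3) \<times> real"
    obtain k t' where x: "x = (k, t')" by (cases x)
    define t where "t = cl t'"
    have t: "t \<in> {0..T}" using cl by (simp add: t_def)
    define d where "d = dist \<beta> \<gamma>"
    have d0: "0 \<le> d" by (simp add: d_def)
    let ?F = "\<lambda>\<beta> s. forcing (\<lambda>l. co \<beta> l s) k"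
    let ?D = "\<lambda>\<beta>. duhamel (\<kappa> * norm (freq k)) (?F \<beta>)"
    have n: "norm \<beta> \<le> 2 * \<delta>" "norm \<gamma> \<le> 2 * \<delta>" using \<beta> \<gamma> by (auto simp: S_def)
    have le: "\<bar>co \<beta> l s\<bar> \<le> 2 * \<delta> / weight l s" "\<bar>co \<gamma> l s\<bar> \<le> 2 * \<delta> / weight l s" if "s \<in> {0..T}" for l s
      using co_le[OF that, of \<beta> l] co_le[OF that, of \<gamma> l] divide_right_mono[OF n(1), of "weight l s"]
        divide_right_mono[OF n(2), of "weight l s"] weight_pos[of l s] by force+
    have diff: "\<bar>co \<beta> l s - co \<gamma> l s\<bar> \<le> d / weight l s" if "s \<in> {0..T}" for l s
    proof -
      have "\<bar>apply_bcontfun \<beta> (l, s) - apply_bcontfun \<gamma> (l, s)\<bar> \<le> d"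
        using dist_bounded[of \<beta> "(l, s)" \<gamma>] by (simp add: d_def dist_real_def)
      then have "\<bar>apply_bcontfun \<beta> (l, s) - apply_bcontfun \<gamma> (l, s)\<bar> / weight l s \<le> d / weight l s"
        using weight_pos[of l s] by (intro divide_right_mono) auto
      moreover have "\<bar>co \<beta> l s - co \<gamma> l s\<bar> = \<bar>apply_bcontfun \<beta> (l, s) - apply_bcontfun \<gamma> (l, s)\<bar> / weight l s"
        using weight_pos[of l s] by (simp add: co_def cl_id[OF that] diff_divide_distrib[symmetric])
      ultimately show ?thesis by (simp only:)
    qed
    have "\<bar>?D \<beta> t - ?D \<gamma> t\<bar> \<le> (d / 4 + 2 * (2 * quad_const * (2 * \<delta>) * d) / \<kappa>) / weight k t"
    proof (cases "k = 0")
      case True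
      have "integral {0..t} (\<lambda>s. exp (\<kappa> * norm (freq k) * s) * ?F \<beta> s) = integral {0..t} (\<lambda>_. 0)" for \<beta>
        by (rule integral_cong) (use True forcing_0[OF co_le] t in auto)
      then show ?thesis
        using quad_const_nonneg pos \<delta> d0 weight_pos[of k t] by (simp add: duhamel_def)
    next
      case False
      show ?thesis
      proof (rule response_abs_le[OF False, where e = "\<lambda>t. ?D \<beta> t - ?D \<gamma> t" and F = "\<lambda>s. ?F \<beta> s - ?F \<gamma> s", OF _ _ _ _ _ t])
        show "((\<lambda>t. ?D \<beta> t - ?D \<gamma> t) has_vector_derivative
            (?F \<beta> s - ?F \<gamma> s - \<kappa> * norm (freq k) * (?D \<beta> s - ?D \<gamma> s))) (at s within {0..T})" if "s \<in> {0..T}" for s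
        proof -
          have "(?D \<beta> has_vector_derivative (?F \<beta> s - \<kappa> * norm (freq k) * ?D \<beta> s)) (at s within {0..T})" for \<beta>
            by (rule duh[OF that])
          from has_vector_derivative_diff[OF this[of \<beta>] this[of \<gamma>]]
          show ?thesis by (simp add: algebra_simps)
        qed
        show "\<bar>?F \<beta> s - ?F \<gamma> s\<bar> \<le> (rate * hfreq k / 4 * d + (2 * quad_const * (2 * \<delta>) * d) * jap k) / jap k ^ r
            * exp (- (rate * hfreq k * (T - s)))" if "s \<in> {0..T}" for s
          by (rule forcing_diff_bound[OF le(1)[OF that] le(2)[OF that] diff[OF that]]) (use that in simp)
      qed (use d0 \<delta> quad_const_nonneg in auto)
    qed
    then have "weight k t * \<bar>?D \<beta> t - ?D \<gamma> t\<bar> \<le> weight k t * ((d / 4 + 2 * (2 * quad_const * (2 * \<delta>) * d) / \<kappa>) / weight k t)"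
      using weight_pos[of k t] by (intro mult_left_mono) auto
    also have "\<dots> = d / 4 + (32 * quad_const * \<delta>) * (d / 4) / \<kappa>"
      using weight_pos[of k t] by simp
    also have "\<dots> \<le> d / 4 + \<kappa> * (d / 4) / \<kappa>"
      using \<delta> pos d0 by (intro add_mono divide_right_mono mult_right_mono order_refl) auto
    also have "\<dots> = 1 / 2 * d" using pos by simp
    finally have "weight k t * \<bar>?D \<beta> t - ?D \<gamma> t\<bar> \<le> 1 / 2 * d" .
    moreover have "dist (apply_bcontfun (\<Phi> \<beta>) x) (apply_bcontfun (\<Phi> \<gamma>) x) = weight k t * \<bar>?D \<beta> t - ?D \<gamma> t\<bar>"
    proof -
      have "apply_bcontfun (\<Phi> \<beta>) x - apply_bcontfun (\<Phi> \<gamma>) x = weight k t * (?D \<beta> t - ?D \<gamma> t)"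
        unfolding x \<Phi>_apply t_def[symmetric] pre_def by (simp add: algebra_simps)
      then show ?thesis using weight_pos[of k t] by (simp add: dist_real_def abs_mult)
    qed
    ultimately show "dist (apply_bcontfun (\<Phi> \<beta>) x) (apply_bcontfun (\<Phi> \<gamma>) x) \<le> 1 / 2 * dist \<beta> \<gamma>"
      unfolding d_def by (simp only:)
  qed
  have "\<exists>!\<beta>. \<beta> \<in> S \<and> \<Phi> \<beta> = \<beta>"
    by (rule Banach_fix[OF S_complete S_ne _ _ \<Phi>S, of "1 / 2"]) (use \<Phi>_contr in auto)
  then obtain \<beta> where \<beta>: "\<beta> \<in> S" "\<Phi> \<beta> = \<beta>" by blast
  have fix_eq: "co \<beta> k t = pre \<beta> k t" if "t \<in> {0..T}" for k t
    using \<Phi>_apply[of \<beta> k t] weight_pos[of k t] by (simp add: \<beta>(2) co_def cl_id[OF that])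
  show ?thesis
  proof (intro exI[of _ "co \<beta>"] conjI allI ballI)
    have "0 \<in> {0..T}" using pos by simp
    then show "co \<beta> k 0 = b0 k" for k by (simp add: fix_eq pre_def)
    show "co \<beta> (- k) t = - co \<beta> k t" for k t using \<beta>(1) by (simp add: S_def co_def)
    show "\<bar>co \<beta> k t\<bar> \<le> 2 * \<delta> / weight k t" if "t \<in> {0..T}" for k t
    proof -
      have "norm \<beta> / weight k t \<le> 2 * \<delta> / weight k t"
        using \<beta>(1) weight_pos[of k t] by (intro divide_right_mono) (auto simp: S_def)
      then show ?thesis using co_le[OF that, of \<beta> k] by linarith
    qed
    fix k t assume t: "t \<in> {0..T}"
    have "((\<lambda>t. exp (- (\<kappa> * norm (freq k)) * t) * b0 k) has_vector_derivative
        (- (\<kappa> * norm (freq k)) * exp (- (\<kappa> * norm (freq k)) * t) * b0 k)) (at t within {0..T})"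
      unfolding has_real_derivative_iff_has_vector_derivative[symmetric] by (auto intro!: derivative_eq_intros)
    moreover have "(duhamel (\<kappa> * norm (freq k)) (\<lambda>s. forcing (\<lambda>l. co \<beta> l s) k) has_vector_derivative
        (forcing (\<lambda>l. co \<beta> l t) k - \<kappa> * norm (freq k) * duhamel (\<kappa> * norm (freq k)) (\<lambda>s. forcing (\<lambda>l. co \<beta> l s) k) t)) (at t within {0..T})"
      by (rule duh[OF t])
    ultimately have sum: "((\<lambda>t. exp (- (\<kappa> * norm (freq k)) * t) * b0 k + duhamel (\<kappa> * norm (freq k)) (\<lambda>s. forcing (\<lambda>l. co \<beta> l s) k) t) has_vector_derivative
        (- (\<kappa> * norm (freq k)) * exp (- (\<kappa> * norm (freq k)) * t) * b0 k + (forcing (\<lambda>l. co \<beta> l t) k - \<kappa> * norm (freq k) * duhamel (\<kappa> * norm (freq k)) (\<lambda>s. forcing (\<lambda>l. co \<beta> l s) k) t))) (at t within {0..T})"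
      by (rule has_vector_derivative_add)
    moreover have "- (\<kappa> * norm (freq k)) * exp (- (\<kappa> * norm (freq k)) * t) * b0 k + (forcing (\<lambda>l. co \<beta> l t) k - \<kappa> * norm (freq k) * duhamel (\<kappa> * norm (freq k)) (\<lambda>s. forcing (\<lambda>l. co \<beta> l s) k) t)
       = forcing (\<lambda>l. co \<beta> l t) k - \<kappa> * norm (freq k) * pre \<beta> k t"
      by (simp add: pre_def algebra_simps)
    ultimately have "(pre \<beta> k has_vector_derivative (forcing (\<lambda>l. co \<beta> l t) k - \<kappa> * norm (freq k) * pre \<beta> k t)) (at t within {0..T})"
      unfolding pre_def[abs_def] by (simp only:)
    note this[folded fix_eq[OF t, of k]]
    moreover have "\<And>x. x \<in> {0..T} \<Longrightarrow> co \<beta> k x = pre \<beta> k x" by (rule fix_eq)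
    ultimately show "(co \<beta> k has_vector_derivative (forcing (\<lambda>l. co \<beta> l t) k - \<kappa> * norm (freq k) * co \<beta> k t)) (at t within {0..T})"
      using t by (metis (no_types, lifting) has_vector_derivative_transform)
  qed
qed

end

section \<open>Growth of unstable modes\<close>

text \<open>The source of cooperativity: with the minus sign of \<open>coupling\<close> removed by
  alternating signs, the off-diagonal entries of the linear system are nonnegative.\<close>

lemma M_symbol_3_nonneg: "0 < \<mu> \<Longrightarrow> 0 \<le> M_symbol \<Omega> \<mu> 3 k"
  by (simp add: M_symbol_def Let_def)

context perturbation
begin

text \<open>The third component is a multiple of \<open>m\<close>, so a shift by
  \<open>base_freq\<close> moves \<open>j\<close> by one and the coupling leaves each such line
  invariant.\<close>

definition line :: "int \<Rightarrow> int \<Rightarrow> int \<Rightarrow> int^3" where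
  "line q1 q2 j = (\<chi> i. if i = 1 then q1 else if i = 2 then q2 else int m * j)"

lemma freq_line [simp]:
  "freq (line q1 q2 j) $ 1 = real_of_int q1" "freq (line q1 q2 j) $ 2 = real_of_int q2"
  "freq (line q1 q2 j) $ 3 = real m * real_of_int j"
  by (simp_all add: line_def freq_def)

lemma line_base:
  "line q1 q2 j + base_freq = line q1 q2 (j + 1)" "line q1 q2 j - base_freq = line q1 q2 (j - 1)"
  by (simp_all add: line_def base_freq_def axis_def vec_eq_iff forall_3 algebra_simps)

lemma line_nonzero: "q1 \<noteq> 0 \<Longrightarrow> line q1 q2 j \<noteq> 0"
  by (auto simp: line_def vec_eq_iff intro!: exI[of _ 1])

lemma line_eq_iff [simp]: "line q1 q2 i = line q1 q2 j \<longleftrightarrow> i = j"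
  using m by (auto simp: line_def vec_eq_iff forall_3)

lemma weight_ge_1: "t \<le> T \<Longrightarrow> 1 \<le> weight k t"
  using weight_ge_jap[of t k] one_le_power[OF jap_ge_1[of k], of r] by linarith

text \<open>The signs \<open>(-1)\<^sup>j\<close> turn the coupling along a line of frequencies into a cooperative system.
  There \<open>z\<close>, supported on the modes \<open>1\<close> and \<open>2\<close>, is a subsolution of the linear part. Inserting a bound
  \<open>U / weight\<close> for the positive part of the error \<open>z - y\<close> into the equation improves it to
  \<open>(U / 4 + R) / weight\<close>, so only the quadratic contribution \<open>R\<close> survives.\<close>

lemma growth:
  assumes q: "q1 \<noteq> 0" and \<epsilon>: "0 \<le> \<epsilon>" and \<delta>: "0 \<le> \<delta>"
    and init: "\<And>j. b (line q1 q2 j) 0 = (if j = 1 then - \<epsilon> else if j = 2 then \<epsilon> else 0)"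
    and bound: "\<And>k t. t \<in> {0..T} \<Longrightarrow> \<bar>b k t\<bar> \<le> 2 * \<delta> / weight k t"
    and ode: "\<And>k t. t \<in> {0..T} \<Longrightarrow>
      (b k has_vector_derivative (forcing (\<lambda>l. b l t) k - \<kappa> * norm (freq k) * b k t)) (at t within {0..T})"
    and g1: "g + \<kappa> * norm (freq (line q1 q2 1)) \<le> a * real m / 2 * M_symbol \<Omega> \<mu> 3 (line q1 q2 2)"
    and g2: "g + \<kappa> * norm (freq (line q1 q2 2)) \<le> a * real m / 2 * M_symbol \<Omega> \<mu> 3 (line q1 q2 1)"
    and t: "t \<in> {0..T}"
  shows "\<epsilon> * exp (g * t) - 32 / 3 * quad_const * \<delta>\<^sup>2 / \<kappa> \<le> - b (line q1 q2 1) t"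
proof -
  define L where "L = line q1 q2"
  define M3 where "M3 j = M_symbol \<Omega> \<mu> 3 (L j)" for j
  define \<sigma> where "\<sigma> j = (if even j then 1 else - 1 :: real)" for j :: int
  define y where "y j t = \<sigma> j * b (L j) t" for j t
  define z where "z j t = (if j = 1 \<or> j = 2 then \<epsilon> * exp (g * t) else 0)" for j :: int and t
  define \<nu> where "\<nu> j = \<kappa> * norm (freq (L j))" for j
  define A where "A = a * real m / 2"
  define adv where "adv j t = \<sigma> j * advection \<Omega> \<mu> (\<lambda>l. b l t) (\<lambda>l. b l t) (L j)" for j t
  define e where "e j t = z j t - y j t" for j t
  \<comment> \<open>The damping of \<open>z\<close> is put into the forcing so that each
    \<open>e j\<close> solves a scalar equation with damping \<open>\<nu> j\<close>; the coupling in
    \<open>F\<close> still acts on \<open>y\<close>.\<close>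
  define F where "F j t = (g + \<nu> j) * z j t - A * (M3 (j - 1) * y (j - 1) t + M3 (j + 1) * y (j + 1) t) + adv j t" for j t
  define N2 where "N2 = quad_const * (2 * \<delta>) * (2 * \<delta>)"
  define R where "R = 2 * N2 / \<kappa>"
  have A0: "0 \<le> A" using pos m by (simp add: A_def)
  have M0: "0 \<le> M3 j" for j using pos by (simp add: M3_def M_symbol_3_nonneg)
  have \<sigma>: "\<sigma> j * \<sigma> j = 1" "\<sigma> (j - 1) = - \<sigma> j" "\<sigma> (j + 1) = - \<sigma> j" "\<bar>\<sigma> j\<bar> = 1" for j by (auto simp: \<sigma>_def)
  have N20: "0 \<le> N2" using quad_const_nonneg \<delta> by (simp add: N2_def)
  have R0: "0 \<le> R" using N20 pos by (simp add: R_def)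
  \<comment> \<open>Off the modes 1 and 2 the left side is zero and the right side nonnegative; at 1
    and 2 the other member of the pair supplies the growth through the two assumptions on
    \<open>g\<close>.\<close>
  have sub: "(g + \<nu> j) * z j s \<le> A * (M3 (j - 1) * z (j - 1) s + M3 (j + 1) * z (j + 1) s)" for j s
  proof -
    have E: "0 \<le> \<epsilon> * exp (g * s)" using \<epsilon> by simp
    have z0: "0 \<le> z i s" for i using E by (simp add: z_def)
    have rhs: "0 \<le> A * (M3 (j - 1) * z (j - 1) s + M3 (j + 1) * z (j + 1) s)"
      using A0 M0 z0 by (intro mult_nonneg_nonneg add_nonneg_nonneg)
    consider "j = 1" | "j = 2" | "j \<noteq> 1" "j \<noteq> 2" by blast
    then show ?thesis
    proof cases
      case 1
      have "(g + \<nu> 1) * (\<epsilon> * exp (g * s)) \<le> (A * M3 2) * (\<epsilon> * exp (g * s))"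
        using g1 E by (intro mult_right_mono) (simp_all add: \<nu>_def L_def A_def M3_def)
      then show ?thesis using 1 by (simp add: z_def mult.assoc)
    next
      case 2
      have "(g + \<nu> 2) * (\<epsilon> * exp (g * s)) \<le> (A * M3 1) * (\<epsilon> * exp (g * s))"
        using g2 E by (intro mult_right_mono) (simp_all add: \<nu>_def L_def A_def M3_def)
      then show ?thesis using 2 by (simp add: z_def mult.assoc)
    next
      case 3
      then show ?thesis using rhs by (simp add: z_def)
    qed
  qed
  have de: "(e j has_vector_derivative (F j s - \<kappa> * norm (freq (L j)) * e j s)) (at s within {0..T})"
    if s: "s \<in> {0..T}" for j s
  proof -
    have dz: "(z j has_vector_derivative (g * z j s)) (at s within {0..T})"
      unfolding z_def has_real_derivative_iff_has_vector_derivative[symmetric]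
      by (cases "j = 1 \<or> j = 2") (auto intro!: derivative_eq_intros)
    have "(b (L j) has_real_derivative (forcing (\<lambda>l. b l s) (L j) - \<kappa> * norm (freq (L j)) * b (L j) s)) (at s within {0..T})"
      using ode[OF s, of "L j"] by (simp add: has_real_derivative_iff_has_vector_derivative)
    then have "((\<lambda>t. \<sigma> j * b (L j) t) has_real_derivative \<sigma> j * (forcing (\<lambda>l. b l s) (L j) - \<kappa> * norm (freq (L j)) * b (L j) s)) (at s within {0..T})"
      by (rule DERIV_cmult)
    then have dy: "(y j has_vector_derivative (\<sigma> j * (forcing (\<lambda>l. b l s) (L j) - \<kappa> * norm (freq (L j)) * b (L j) s))) (at s within {0..T})"
      unfolding y_def by (simp add: has_real_derivative_iff_has_vector_derivative)
    have "(e j has_vector_derivative (g * z j s - \<sigma> j * (forcing (\<lambda>l. b l s) (L j) - \<kappa> * norm (freq (L j)) * b (L j) s))) (at s within {0..T})"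
      unfolding e_def by (rule has_vector_derivative_diff[OF dz dy])
    moreover have "\<sigma> j * coupling (\<lambda>l. b l s) (L j) = A * (M3 (j - 1) * y (j - 1) s + M3 (j + 1) * y (j + 1) s)"
      unfolding coupling_def L_def line_base unfolding L_def[symmetric] y_def M3_def A_def \<sigma> by (simp add: algebra_simps)
    then have "g * z j s - \<sigma> j * (forcing (\<lambda>l. b l s) (L j) - \<kappa> * norm (freq (L j)) * b (L j) s)
        = F j s - \<kappa> * norm (freq (L j)) * e j s"
      unfolding F_def forcing_def right_diff_distrib adv_def e_def y_def[of j] \<nu>_def by (simp add: algebra_simps)
    ultimately show ?thesis by (simp only:)
  qed
  have e0: "e j 0 \<le> 0" for j
    unfolding e_def z_def y_def using init[of j] by (auto simp: L_def \<sigma>_def)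
  have step: "e j s \<le> (U / 4 + R) / weight (L j) s"
    if U: "0 \<le> U" and IH: "\<And>j s. s \<in> {0..T} \<Longrightarrow> e j s \<le> U / weight (L j) s" and s: "s \<in> {0..T}" for U j s
  proof -
    have "e j s \<le> (U / 4 + 2 * N2 / \<kappa>) / weight (L j) s"
    proof (rule response_le[OF _ U N20 de e0 _ s])
      show "L j \<noteq> 0" unfolding L_def by (rule line_nonzero[OF q])
      fix s assume s: "s \<in> {0..T}"
      \<comment> \<open>Nonnegative symbols allow an upper bound on the neighbours to be inserted.
        The resulting sum is the \<open>coupling\<close> of this negative profile, so
        \<open>coupling_bound\<close> applies once more.\<close>
      let ?c = "\<lambda>l. - (U / weight l s)"
      have "F j s \<le> A * (M3 (j - 1) * z (j - 1) s + M3 (j + 1) * z (j + 1) s)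
          - A * (M3 (j - 1) * y (j - 1) s + M3 (j + 1) * y (j + 1) s) + \<bar>adv j s\<bar>"
        unfolding F_def using sub[of j s] by linarith
      also have "\<dots> = A * (M3 (j - 1) * e (j - 1) s + M3 (j + 1) * e (j + 1) s) + \<bar>adv j s\<bar>"
        by (simp add: e_def algebra_simps)
      also have "\<dots> \<le> A * (M3 (j - 1) * (U / weight (L (j - 1)) s) + M3 (j + 1) * (U / weight (L (j + 1)) s)) + \<bar>adv j s\<bar>"
        using A0 M0 IH[OF s] by (intro add_mono mult_left_mono order_refl)
      also have "A * (M3 (j - 1) * (U / weight (L (j - 1)) s) + M3 (j + 1) * (U / weight (L (j + 1)) s)) = coupling ?c (L j)"
        unfolding coupling_def L_def line_base unfolding L_def[symmetric] M3_def A_def by (simp add: algebra_simps)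
      also have "coupling ?c (L j) \<le> rate * hfreq (L j) / 4 * U / jap (L j) ^ r * exp (- (rate * hfreq (L j) * (T - s)))"
        using coupling_bound[of ?c U s "L j"] U weight_pos by (simp add: abs_le_iff less_imp_le)
      also have "\<bar>adv j s\<bar> = \<bar>advection \<Omega> \<mu> (\<lambda>l. b l s) (\<lambda>l. b l s) (L j)\<bar>"
        by (simp add: adv_def abs_mult \<sigma>)
      also have "\<dots> \<le> N2 * jap (L j) / jap (L j) ^ r * exp (- (rate * hfreq (L j) * (T - s)))"
        unfolding N2_def by (rule advection_bound[OF bound[OF s] bound[OF s]]) (use s in simp)
      finally show "F j s \<le> (rate * hfreq (L j) / 4 * U + N2 * jap (L j)) / jap (L j) ^ r * exp (- (rate * hfreq (L j) * (T - s)))"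
        by (simp add: add_divide_distrib distrib_right)
    qed
    then show ?thesis by (simp add: R_def)
  qed
  define W where "W = weight (L 1) 0 + weight (L 2) 0"
  \<comment> \<open>A crude first bound. Its size is immaterial, since each round of the iteration
    divides it by 4.\<close>
  define U0 where "U0 = 2 * \<delta> + \<epsilon> * exp (\<bar>g\<bar> * T) * W"
  have W0: "0 \<le> W" using weight_pos[of "L 1" 0] weight_pos[of "L 2" 0] by (simp add: W_def)
  have U00: "0 \<le> U0" using \<delta> \<epsilon> W0 by (simp add: U0_def)
  have base: "e j s \<le> U0 / weight (L j) s" if s: "s \<in> {0..T}" for j s
  proof -
    have "- y j s \<le> 2 * \<delta> / weight (L j) s"
      using bound[OF s, of "L j"] abs_ge_minus_self[of "y j s"] by (simp add: y_def abs_mult \<sigma>)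
    moreover have "z j s \<le> \<epsilon> * exp (\<bar>g\<bar> * T) * W / weight (L j) s"
    proof (cases "j = 1 \<or> j = 2")
      case True
      have "g * s \<le> \<bar>g\<bar> * s" using s by (intro mult_right_mono) auto
      also have "\<dots> \<le> \<bar>g\<bar> * T" using s by (intro mult_left_mono) auto
      finally have "exp (g * s) \<le> exp (\<bar>g\<bar> * T)" by simp
      then have "z j s \<le> \<epsilon> * exp (\<bar>g\<bar> * T)" using True \<epsilon> by (simp add: z_def mult_left_mono)
      moreover have "weight (L j) s \<le> W"
        using True weight_antimono[of 0 s "L j"] s weight_pos[of "L 1" 0] weight_pos[of "L 2" 0] by (auto simp: W_def)
      ultimately have "z j s * weight (L j) s \<le> \<epsilon> * exp (\<bar>g\<bar> * T) * W"
        using \<epsilon> weight_pos[of "L j" s] by (intro mult_mono) auto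
      then show ?thesis using weight_pos[of "L j" s] by (simp add: pos_le_divide_eq)
    next
      case False
      then show ?thesis using \<epsilon> W0 weight_pos[of "L j" s] by (simp add: z_def)
    qed
    ultimately show ?thesis by (simp add: e_def U0_def add_divide_distrib)
  qed
  \<comment> \<open>\<open>4 / 3 * R\<close> is the fixed point of the map from \<open>U\<close> to
    \<open>U / 4 + R\<close>.\<close>
  have iter: "s \<in> {0..T} \<Longrightarrow> e j s \<le> (U0 / 4 ^ n + 4 / 3 * R) / weight (L j) s" for n j s
  proof (induction n arbitrary: j s)
    case 0
    have "U0 / weight (L j) s \<le> (U0 / 4 ^ 0 + 4 / 3 * R) / weight (L j) s"
      using R0 weight_pos[of "L j" s] by (intro divide_right_mono) auto
    then show ?case using base[OF 0, of j] by (rule order_trans[rotated])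
  next
    case (Suc n)
    have "e j s \<le> ((U0 / 4 ^ n + 4 / 3 * R) / 4 + R) / weight (L j) s"
      by (rule step[OF _ Suc.IH Suc.prems]) (use U00 R0 in auto)
    then show ?case by (simp add: field_simps)
  qed
  have "e 1 t \<le> (0 + 4 / 3 * R) / weight (L 1) t"
  proof (rule tendsto_lowerbound)
    show "(\<lambda>n. (U0 / 4 ^ n + 4 / 3 * R) / weight (L 1) t) \<longlonglongrightarrow> (0 + 4 / 3 * R) / weight (L 1) t"
      using weight_pos[of "L 1" t]
      by (intro tendsto_intros LIMSEQ_divide_realpow_zero) auto
    show "\<forall>\<^sub>F n in sequentially. e 1 t \<le> (U0 / 4 ^ n + 4 / 3 * R) / weight (L 1) t"
      using iter[OF t, of 1] by (intro always_eventually allI)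
  qed simp
  also have "\<dots> \<le> 4 / 3 * R"
    using weight_ge_1[of t "L 1"] t R0 divide_left_mono[of 1 "weight (L 1) t" "4 / 3 * R"] by simp
  also have "\<dots> = 32 / 3 * quad_const * \<delta>\<^sup>2 / \<kappa>"
    by (simp add: R_def N2_def power2_eq_square)
  finally show ?thesis by (simp add: e_def z_def y_def \<sigma>_def L_def)
qed

end

section \<open>Unstable perturbations of the steady state\<close>

text \<open>The exponent is \<open>\<tau>\<close> times the growth rate of the mode with frequency
  \<open>(n^2, n, M)\<close>. Divided by \<open>n^2\<close> the rate tends to
  \<open>\<alpha> * \<mu> / P - \<kappa> > 0\<close>, so the right side grows like an exponential of
  \<open>n^2\<close> and wins against any power.\<close>

lemma growth_beats_powers:
  fixes \<alpha> \<mu> P \<kappa> p M C \<tau> :: real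
  assumes pos: "0 < \<alpha>" "0 < \<mu>" "0 < P" "0 < \<kappa>" "0 < M" "0 < p" "0 \<le> C" "0 < \<tau>"
    and gap: "\<kappa> < \<alpha> * \<mu> / P"
  obtains n :: nat where "1 \<le> n"
    "1 + C * (1 + sqrt (real n ^ 4 + (real n)\<^sup>2 + M\<^sup>2)) ^ R
      \<le> exp ((\<alpha> * (\<mu> * (real n)\<^sup>2 * (real n ^ 4 + (real n)\<^sup>2) / (P * real n ^ 4 + p * ((real n)\<^sup>2 + M\<^sup>2)))
              - \<kappa> * sqrt (real n ^ 4 + (real n)\<^sup>2 + M\<^sup>2)) * \<tau>)"
proof -
  define G where "G x = \<alpha> * (\<mu> * x\<^sup>2 * (x ^ 4 + x\<^sup>2) / (P * x ^ 4 + p * (x\<^sup>2 + M\<^sup>2))) - \<kappa> * sqrt (x ^ 4 + x\<^sup>2 + M\<^sup>2)" for x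
  define c where "c = \<alpha> * \<mu> / P - \<kappa>"
  have c: "0 < c" using gap by (simp add: c_def)
  have "((\<lambda>x. G x / x\<^sup>2) \<longlongrightarrow> \<alpha> * (\<mu> * inverse P) - \<kappa>) at_top"
    unfolding G_def using pos by real_asymp
  moreover have "\<alpha> * (\<mu> * inverse P) - \<kappa> = c" by (simp add: c_def divide_inverse)
  ultimately have "\<forall>\<^sub>F x in at_top. c / 2 < G x / x\<^sup>2"
    using c by (intro order_tendstoD(1)) auto
  \<comment> \<open>The exponent 3, above the true order 2, absorbs the constants.\<close>
  moreover have "\<forall>\<^sub>F x in at_top. 1 + sqrt (x ^ 4 + x\<^sup>2 + M\<^sup>2) \<le> x ^ 3"
    using pos by real_asymp
  moreover have "\<forall>\<^sub>F x in at_top. 1 + (C + 1) * x powr real (3 * R) \<le> exp ((c / 2 * \<tau>) * x\<^sup>2)"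
  proof -
    have ev: "\<forall>\<^sub>F x in at_top. 1 + K * x powr real (3 * R) \<le> exp (e * x\<^sup>2)" if "0 < e" "0 < K" for e K :: real
      using that by real_asymp
    show ?thesis by (rule ev) (use c pos in auto)
  qed
  moreover have "\<forall>\<^sub>F x :: real in at_top. 1 \<le> x" by (rule eventually_ge_at_top)
  ultimately have "\<forall>\<^sub>F x in at_top. 1 \<le> x \<and> 1 + C * (1 + sqrt (x ^ 4 + x\<^sup>2 + M\<^sup>2)) ^ R \<le> exp (G x * \<tau>)"
  proof eventually_elim
    case (elim x)
    have "(1 + sqrt (x ^ 4 + x\<^sup>2 + M\<^sup>2)) ^ R \<le> (x ^ 3) ^ R"
      using elim(2) by (intro power_mono) auto
    also have "(x ^ 3) ^ R = x powr real (3 * R)"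
      using elim(4) powr_realpow[of x "3 * R"] by (simp add: power_mult)
    finally have "C * (1 + sqrt (x ^ 4 + x\<^sup>2 + M\<^sup>2)) ^ R \<le> (C + 1) * x powr real (3 * R)"
      using pos by (intro mult_mono) auto
    then have "1 + C * (1 + sqrt (x ^ 4 + x\<^sup>2 + M\<^sup>2)) ^ R \<le> exp ((c / 2 * \<tau>) * x\<^sup>2)"
      using elim(3) by linarith
    also have "(c / 2 * \<tau>) * x\<^sup>2 \<le> G x * \<tau>"
    proof -
      have "c / 2 * x\<^sup>2 \<le> G x" using elim(1,4) by (simp add: pos_less_divide_eq)
      then have "c / 2 * x\<^sup>2 * \<tau> \<le> G x * \<tau>" using pos by (intro mult_right_mono) auto
      then show ?thesis by (simp add: mult_ac)
    qed
    finally show ?case using elim(4) by simp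
  qed
  then obtain x0 where x0: "\<And>x. x0 \<le> x \<Longrightarrow> 1 \<le> x \<and> 1 + C * (1 + sqrt (x ^ 4 + x\<^sup>2 + M\<^sup>2)) ^ R \<le> exp (G x * \<tau>)"
    by (auto simp: eventually_at_top_linorder)
  have "x0 \<le> real (nat \<lceil>x0\<rceil>)" by linarith
  from x0[OF this] show ?thesis
    by (intro that[of "nat \<lceil>x0\<rceil>"]) (simp_all add: G_def)
qed

text \<open>Each sign of the frequency carries half of the amplitude, since the sine series runs
  over all of \<open>int^3\<close> and its coefficients are to be odd.\<close>

definition base_coeff :: "real \<Rightarrow> nat \<Rightarrow> int^3 \<Rightarrow> real" where
  "base_coeff a m k = (if k = axis 3 (int m) then a / 2 else if k = - axis 3 (int m) then - a / 2 else 0)"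

lemma weighted_summable_finite:
  assumes "finite {k. c k \<noteq> 0}"
  shows "weighted_summable r c"
  unfolding weighted_summable_def
  by (rule finite_nonzero_values_imp_summable_on) (use assms in \<open>auto elim!: rev_finite_subset\<close>)

lemma weighted_summable_base: "weighted_summable r (base_coeff a m)"
  by (rule weighted_summable_finite, rule finite_subset[of _ "{axis 3 (int m), - axis 3 (int m)}"])
     (auto simp: base_coeff_def split: if_splits)

lemma weighted_summable_add:
  assumes "weighted_summable r b" "weighted_summable r c"
  shows "weighted_summable r (\<lambda>k. b k + c k)" "weighted_sum r (\<lambda>k. b k + c k) \<le> weighted_sum r b + weighted_sum r c"
proof -
  have s: "(\<lambda>k. jap k ^ r * \<bar>b k\<bar>) summable_on UNIV" "(\<lambda>k. jap k ^ r * \<bar>c k\<bar>) summable_on UNIV"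
    using assms by (auto simp: weighted_summable_def)
  have le: "jap k ^ r * \<bar>b k + c k\<bar> \<le> jap k ^ r * \<bar>b k\<bar> + jap k ^ r * \<bar>c k\<bar>" for k
    using mult_left_mono[OF abs_triangle_ineq[of "b k" "c k"], of "jap k ^ r"] jap_pos[of k] by (simp add: distrib_left)
  have sum: "(\<lambda>k. jap k ^ r * \<bar>b k + c k\<bar>) summable_on UNIV"
    by (rule summable_on_comparison_real[OF summable_on_add[OF s]]) (use le jap_pos in \<open>simp add: abs_mult less_imp_le\<close>)
  then show "weighted_summable r (\<lambda>k. b k + c k)" by (simp add: weighted_summable_def)
  show "weighted_sum r (\<lambda>k. b k + c k) \<le> weighted_sum r b + weighted_sum r c"
    unfolding weighted_sum_def infsum_add[OF s, symmetric]
    by (rule infsum_mono[OF sum summable_on_add[OF s] le])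
qed

section \<open>The steady state as a background of the evolution\<close>

context perturbation
begin

lemma base_coeff_eq: "base_coeff a m k = (if k = base_freq then a / 2 else if k = - base_freq then - a / 2 else 0)"
  by (simp add: base_coeff_def base_freq_def)

lemma base_freq_neq: "base_freq \<noteq> - base_freq"
  using m by (auto simp: base_freq_def vec_eq_iff axis_def)

lemma base_coeff_odd: "base_coeff a m (- k) = - base_coeff a m k"
  using base_freq_neq by (auto simp: base_coeff_eq minus_equation_iff[of k])

lemma series_base: "series (base_coeff a m) 0 x = a * sin (real m * x $ 3)"
proof -
  have "freq base_freq \<bullet> x = real m * x $ 3" by (simp add: inner_vec_def sum_3)
  then have w: "wave base_freq 0 x = sin (real m * x $ 3)" "wave (- base_freq) 0 x = - sin (real m * x $ 3)"
    by (simp_all add: wave_def)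
  have "((\<lambda>k. base_coeff a m k * wave k 0 x) has_sum (a * sin (real m * x $ 3))) UNIV"
    by (rule has_sum_finite_neutralI[of "{base_freq, - base_freq}"])
       (use base_freq_neq w in \<open>auto simp: base_coeff_eq\<close>)
  then show ?thesis by (simp add: series_def infsumI)
qed

lemma base_dissipation: "norm (freq k) * base_coeff a m k = real m * base_coeff a m k"
  using norm_freq_base by (auto simp: base_coeff_eq)

text \<open>The steady state depends on the third variable alone, so its horizontal frequency and
  hence its velocity vanish. It transports nothing, itself included.\<close>

lemma transport_base:
  "transport \<Omega> \<mu> base_freq q = 0" "transport \<Omega> \<mu> (- base_freq) q = 0" "transport \<Omega> \<mu> p base_freq = M_symbol \<Omega> \<mu> 3 p * real m"
proof -
  have "hfreq base_freq = 0" by (simp add: hfreq_def)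
  then have "M_symbol \<Omega> \<mu> j base_freq = 0" for j
    using M_symbol_abs_le[OF pos(3,2), of j base_freq] by simp
  then show "transport \<Omega> \<mu> base_freq q = 0" "transport \<Omega> \<mu> (- base_freq) q = 0"
    by (simp_all add: transport_def)
  show "transport \<Omega> \<mu> p base_freq = M_symbol \<Omega> \<mu> 3 p * real m"
    by (simp add: transport_def sum_3)
qed

text \<open>Of the four bilinear terms the two with the steady state as transporting field vanish.
  Transport of the steady state by the perturbation picks out \<open>p = k - base_freq\<close> and
  \<open>p = k + base_freq\<close> and is the negative of the coupling.\<close>

lemma advection_base:
  assumes s: "(\<lambda>p. transport \<Omega> \<mu> p (k - p) * b p * b (k - p)) summable_on UNIV"
  defines "A \<equiv> base_coeff a m"
  shows "advection \<Omega> \<mu> (\<lambda>l. A l + b l) (\<lambda>l. A l + b l) k = advection \<Omega> \<mu> b b k - coupling b k"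
proof -
  let ?f = "\<lambda>p. transport \<Omega> \<mu> p (k - p) * b p * A (k - p)"
  have term_eq: "transport \<Omega> \<mu> p (k - p) * (A p + b p) * (A (k - p) + b (k - p))
      = ?f p + transport \<Omega> \<mu> p (k - p) * b p * b (k - p)" for p
  proof -
    have "transport \<Omega> \<mu> p (k - p) * A p = 0"
      using transport_base(1,2) by (auto simp: A_def base_coeff_eq)
    then have "transport \<Omega> \<mu> p (k - p) * (A p + b p) = transport \<Omega> \<mu> p (k - p) * b p"
      by (simp add: distrib_left)
    then show ?thesis by (simp only: distrib_left)
  qed
  have "(?f has_sum (\<Sum>p\<in>{k - base_freq, k + base_freq}. ?f p)) UNIV"
  proof (rule has_sum_finite_neutralI[OF _ _ _ refl])
    fix p assume p: "p \<in> UNIV - {k - base_freq, k + base_freq}"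
    then have "k - p \<noteq> base_freq" "k - p \<noteq> - base_freq" by (auto simp: algebra_simps)
    then show "?f p = 0" by (simp add: A_def base_coeff_eq)
  qed auto
  moreover have "(\<Sum>p\<in>{k - base_freq, k + base_freq}. ?f p) = - coupling b k"
  proof -
    have ne: "k - base_freq \<noteq> k + base_freq" using base_freq_neq by (metis add_left_imp_eq diff_conv_add_uminus)
    have f1: "?f (k - base_freq) = M_symbol \<Omega> \<mu> 3 (k - base_freq) * real m * b (k - base_freq) * (a / 2)"
      by (simp add: A_def base_coeff_eq transport_base)
    have "k - (k + base_freq) = - base_freq" by simp
    then have f2: "?f (k + base_freq) = M_symbol \<Omega> \<mu> 3 (k + base_freq) * real m * b (k + base_freq) * (a / 2)"
      using base_freq_neq by (simp only: A_def base_coeff_eq transport_base transport_minus) simp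
    have "(\<Sum>p\<in>{k - base_freq, k + base_freq}. ?f p) = ?f (k - base_freq) + ?f (k + base_freq)"
      using ne by (simp only: sum.insert finite.intros sum.empty add_0_right singleton_iff not_False_eq_True empty_iff)
    then show ?thesis unfolding f1 f2 by (simp add: coupling_def algebra_simps)
  qed
  ultimately have "((\<lambda>p. ?f p + transport \<Omega> \<mu> p (k - p) * b p * b (k - p)) has_sum
      (- coupling b k + advection \<Omega> \<mu> b b k)) UNIV"
    unfolding advection_def by (intro has_sum_add has_sum_infsum s) simp
  then show ?thesis
    unfolding advection_def[of _ _ "\<lambda>l. A l + b l"] term_eq by (simp add: infsumI)
qed

text \<open>The source balances the dissipation of the steady state, an eigenfunction with
  eigenvalue \<open>m\<close>, and leaves the equation of the perturbation. The end time
  \<open>T'\<close> is separate from \<open>T\<close> because well-posedness prescribes a time that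
  depends on the data and is not known when the perturbation is built.\<close>

lemma perturbed_weak_solution:
  assumes X: "admissible X" and C: "0 < C" and T': "0 < T'" "T' \<le> T" and rX: "rX + 6 \<le> r"
    and X_mem: "\<And>b. weighted_summable rX b \<Longrightarrow> series b 0 \<in> sobolev X"
    and X_norm: "\<And>b. weighted_summable rX b \<Longrightarrow> sobolev_norm X (series b 0) \<le> C * weighted_sum rX b"
    and odd: "\<And>k t. b (- k) t = - b k t"
    and bound: "\<And>k t. t \<in> {0..T} \<Longrightarrow> \<bar>b k t\<bar> \<le> N / weight k t"
    and ode: "\<And>k t. t \<in> {0..T} \<Longrightarrow>
      (b k has_vector_derivative (forcing (\<lambda>l. b l t) k - \<kappa> * norm (freq k) * b k t)) (at t within {0..T})"
  shows "weak_solution \<kappa> \<mu> \<Omega> (\<lambda>x. \<kappa> * a * real m * sin (real m * x $ 3)) X T'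
    (series (\<lambda>k. base_coeff a m k + b k 0) 0) (\<lambda>t. series (\<lambda>k. base_coeff a m k + b k t) 0)"
proof -
  define A where "A = base_coeff a m"
  have T0: "0 \<in> {0..T}" using pos by simp
  have N: "0 \<le> N"
    using bound[OF T0, of 0] weight_pos[of 0 0] by (meson abs_ge_zero order_trans zero_le_divide_iff not_le order.asym)
  have bD: "\<bar>b k t\<bar> \<le> N / jap k ^ r" if "t \<in> {0..T}" for k t
    using bound[OF that, of k] divide_left_mono[OF weight_ge_jap[of t k] N] that jap_pos[of k] weight_pos[of k t] by force
  have sub: "t \<in> {0..T}" if "t \<in> {0..T'}" for t using that T' by auto
  have wsA: "weighted_summable n (\<lambda>k. \<bar>A k\<bar>)" for n
    using weighted_summable_base[of n a m] by (simp add: weighted_summable_def A_def)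
  have D: "weighted_summable n (\<lambda>k. \<bar>A k\<bar> + N / jap k ^ r)" if "n + 6 \<le> r" for n
    by (rule weighted_summable_add(1)[OF wsA weighted_summable_jap[OF that]])
  have S: "series (\<lambda>k. (\<kappa> * real m) * A k) 0 = (\<lambda>x. \<kappa> * a * real m * sin (real m * x $ 3))"
    unfolding series_cmult A_def series_base by (simp add: mult_ac fun_eq_iff)
  have Ssum: "(\<lambda>k. (\<kappa> * real m) * A k) summable_on UNIV"
    unfolding A_def by (intro summable_on_cmult_right weighted_summable_imp_summable[OF weighted_summable_base[of 0]])
  have "weak_solution \<kappa> \<mu> \<Omega> (series (\<lambda>k. (\<kappa> * real m) * A k) 0) X T'
    (series (\<lambda>k. A k + b k 0) 0) (\<lambda>t. series (\<lambda>k. A k + b k t) 0)"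
  proof (rule weak_solution_series[OF X C T'(1) pos(3,2) X_mem X_norm D[OF rX] D _ _ Ssum])
    show "1 + 6 \<le> r" using r by simp
    show "\<bar>A k + b k t\<bar> \<le> \<bar>A k\<bar> + N / jap k ^ r" if "t \<in> {0..T'}" for k t
      using bD[OF sub[OF that], of k] abs_triangle_ineq[of "A k" "b k t"] by linarith
    show "A (- k) + b (- k) t = - (A k + b k t)" for k t
      by (simp add: odd A_def base_coeff_odd)
    fix k t assume t: "t \<in> {0..T'}"
    note tT = sub[OF t]
    have "(b k has_vector_derivative (forcing (\<lambda>l. b l t) k - \<kappa> * norm (freq k) * b k t)) (at t within {0..T'})"
      by (rule has_vector_derivative_within_subset[OF ode[OF tT]]) (use sub in auto)
    then have "((\<lambda>t. A k + b k t) has_vector_derivative (0 + (forcing (\<lambda>l. b l t) k - \<kappa> * norm (freq k) * b k t))) (at t within {0..T'})"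
      by (intro has_vector_derivative_add has_vector_derivative_const)
    moreover have "0 + (forcing (\<lambda>l. b l t) k - \<kappa> * norm (freq k) * b k t)
        = (\<kappa> * real m) * A k - \<kappa> * norm (freq k) * (A k + b k t) - advection \<Omega> \<mu> (\<lambda>l. A l + b l t) (\<lambda>l. A l + b l t) k"
    proof -
      have "t \<le> T" using tT by simp
      then have "advection \<Omega> \<mu> (\<lambda>l. A l + b l t) (\<lambda>l. A l + b l t) k
          = advection \<Omega> \<mu> (\<lambda>l. b l t) (\<lambda>l. b l t) k - coupling (\<lambda>l. b l t) k"
        unfolding A_def by (intro advection_base advection_terms_summable[OF bound[OF tT] bound[OF tT]])
      moreover have "\<kappa> * (norm (freq k) * A k) = \<kappa> * (real m * A k)"
        unfolding A_def base_dissipation ..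
      ultimately show ?thesis by (simp add: forcing_def algebra_simps)
    qed
    ultimately show "((\<lambda>t. A k + b k t) has_vector_derivative ((\<kappa> * real m) * A k - \<kappa> * norm (freq k) * (A k + b k t)
        - advection \<Omega> \<mu> (\<lambda>l. A l + b l t) (\<lambda>l. A l + b l t) k)) (at t within {0..T'})"
      by (simp only:)
  qed
  then show ?thesis unfolding S unfolding A_def .
qed

section \<open>Symbols along the unstable line of frequencies\<close>

lemma norm_freq_line:
  "norm (freq (line q1 q2 j)) = sqrt ((real_of_int q1)\<^sup>2 + (real_of_int q2)\<^sup>2 + (real m * real_of_int j)\<^sup>2)"
  using norm_vec3_sq[of "freq (line q1 q2 j)"] by (metis freq_line norm_ge_zero real_sqrt_unique)

lemma M_symbol_line:
  assumes "j \<noteq> 0"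
  shows "M_symbol \<Omega> \<mu> 3 (line q1 q2 j) = \<mu> * (real_of_int q2)\<^sup>2 * ((real_of_int q1)\<^sup>2 + (real_of_int q2)\<^sup>2)
    / (4 * \<Omega>\<^sup>2 * (real m * real_of_int j)\<^sup>2 * ((real_of_int q1)\<^sup>2 + (real_of_int q2)\<^sup>2 + (real m * real_of_int j)\<^sup>2)
       + \<mu>\<^sup>2 * real_of_int q2 ^ 4)"
  using assms m norm_vec3_sq[of "freq (line q1 q2 j)"] by (simp add: M_symbol_def Let_def)

text \<open>The vertical frequency occurs only in the denominator. The symbol at
  \<open>j = 2\<close> is therefore the weaker of the pair and may be used in both growth
  conditions.\<close>

lemma M_symbol_line_antimono:
  assumes "q1 \<noteq> 0"
  shows "M_symbol \<Omega> \<mu> 3 (line q1 q2 2) \<le> M_symbol \<Omega> \<mu> 3 (line q1 q2 1)"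
proof -
  define Q c1 c2 where "Q = (real_of_int q1)\<^sup>2 + (real_of_int q2)\<^sup>2"
    and "c1 = (real m * real_of_int 1)\<^sup>2" and "c2 = (real m * real_of_int 2)\<^sup>2"
  have c: "0 < c1" "c1 \<le> c2" using m by (auto simp: c1_def c2_def intro!: power_mono)
  have Q: "0 < Q" using assms by (auto simp: Q_def intro!: add_pos_nonneg)
  have \<Omega>: "0 < 4 * \<Omega>\<^sup>2" using pos by simp
  have "4 * \<Omega>\<^sup>2 * c1 * (Q + c1) \<le> 4 * \<Omega>\<^sup>2 * c2 * (Q + c2)"
    using c Q \<Omega> by (intro mult_mono mult_left_mono add_left_mono mult_nonneg_nonneg add_nonneg_nonneg) auto
  moreover have "0 < 4 * \<Omega>\<^sup>2 * c1 * (Q + c1)"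
    using c Q \<Omega> by (intro mult_pos_pos add_pos_pos) auto
  moreover from this calculation have "0 < 4 * \<Omega>\<^sup>2 * c2 * (Q + c2)" by linarith
  ultimately have "\<mu> * (real_of_int q2)\<^sup>2 * Q / (4 * \<Omega>\<^sup>2 * c2 * (Q + c2) + \<mu>\<^sup>2 * real_of_int q2 ^ 4)
      \<le> \<mu> * (real_of_int q2)\<^sup>2 * Q / (4 * \<Omega>\<^sup>2 * c1 * (Q + c1) + \<mu>\<^sup>2 * real_of_int q2 ^ 4)"
    using pos Q by (intro divide_left_mono mult_pos_pos add_right_mono) (simp_all add: add_pos_nonneg)
  then show ?thesis
    unfolding M_symbol_line[of 1, simplified] M_symbol_line[of 2, simplified] Q_def c1_def c2_def by simp
qed

end


text \<open>The bound \<open>R\<close> precedes the times and \<open>K\<close>, so that it can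
  determine the compact set in the ill-posedness argument. \<open>T0\<close> is the time of
  comparison and \<open>T1\<close> the length of existence; they are kept apart because in that
  argument only a range for the time is known beforehand.\<close>

lemma unstable_perturbation:
  fixes \<kappa> \<mu> \<Omega> a :: real and m :: nat and X Y :: sobolev_index
  assumes spaces: "admissible X" "admissible Y"
    and pos: "\<kappa> > 0" "\<mu> > 0" "\<Omega> > 0" "a > 0" and m: "m \<ge> 1"
    and a_large: "\<kappa> < a * \<mu> * real m / (2 ^ 5 * \<Omega>\<^sup>2 * (real m)\<^sup>2 + 2 * \<mu>\<^sup>2)"
  defines "\<Theta>0 \<equiv> (\<lambda>x::real^3. a * sin (real m * x $ 3))"
    and "S \<equiv> (\<lambda>x::real^3. \<kappa> * a * real m * sin (real m * x $ 3))"
  shows "\<exists>R. \<forall>T0 T1 K. 0 < T0 \<and> T0 \<le> T1 \<and> 0 < K \<longrightarrow> (\<exists>f \<Theta>. f \<in> sobolev Y \<and> sobolev_norm Y f \<le> R \<and>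
      (\<forall>T. 0 < T \<and> T \<le> T1 \<longrightarrow> weak_solution \<kappa> \<mu> \<Omega> S X T f \<Theta>) \<and>
      \<not> (AE x in torus. f x = \<Theta>0 x) \<and> 0 < sobolev_norm Y (\<lambda>x. f x - \<Theta>0 x) \<and>
      2 * K * sobolev_norm Y (\<lambda>x. f x - \<Theta>0 x) \<le> sobolev_norm X (\<lambda>x. \<Theta> T0 x - \<Theta>0 x))"
proof -
  obtain rX CX where CX: "0 < CX" and X_mem: "\<And>b. weighted_summable rX b \<Longrightarrow> series b 0 \<in> sobolev X"
    and X_norm: "\<And>b. weighted_summable rX b \<Longrightarrow> sobolev_norm X (series b 0) \<le> CX * weighted_sum rX b"
    using sobolev_series[OF spaces(1)] by metis
  obtain rY CY where CY: "0 < CY" and Y_mem: "\<And>b. weighted_summable rY b \<Longrightarrow> series b 0 \<in> sobolev Y"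
    and Y_norm: "\<And>b. weighted_summable rY b \<Longrightarrow> sobolev_norm Y (series b 0) \<le> CY * weighted_sum rY b"
    using sobolev_series[OF spaces(2)] by metis
  \<comment> \<open>Large enough both for \<open>7 \<le> r\<close> in the locale and for
    \<open>rX + 6 \<le> r\<close>, which gives membership in \<open>X\<close>.\<close>
  define r where "r = rX + 7"
  define A where "A = base_coeff a m"
  show ?thesis
  proof (intro exI[of _ "CY * (weighted_sum rY A + 1)"] allI impI, elim conjE)
    fix T0 T1 K :: real
    assume T0: "0 < T0" and T1: "T0 \<le> T1" and K: "0 < K"
    interpret perturbation \<kappa> \<mu> \<Omega> a T1 m r
      using pos m T0 T1 by unfold_locales (auto simp: r_def)
    have \<Theta>0: "\<Theta>0 = series A 0"
      by (simp add: \<Theta>0_def A_def series_base fun_eq_iff)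
    \<comment> \<open>\<open>M\<close>, \<open>p\<close> and \<open>P\<close> describe the
      denominator of the symbol at \<open>k3 = 2 * m\<close>: its coefficient of \<open>n^4\<close>
      is \<open>P\<close>, and \<open>2 * P\<close> is the denominator in the assumption on
      \<open>a\<close>.\<close>
    define M where "M = 2 * real m"
    define \<alpha> where "\<alpha> = a * real m / 2"
    define p where "p = 4 * \<Omega>\<^sup>2 * M\<^sup>2"
    define P where "P = p + \<mu>\<^sup>2"
    have MP: "0 < M" "0 < \<alpha>" "0 < p" "0 < P" using pos m by (auto simp: M_def \<alpha>_def p_def P_def add_pos_pos)
    have gap: "\<kappa> < \<alpha> * \<mu> / P"
    proof -
      have "2 ^ 5 * \<Omega>\<^sup>2 * (real m)\<^sup>2 + 2 * \<mu>\<^sup>2 = 2 * P"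
        by (simp add: P_def p_def M_def power2_eq_square)
      then have "\<kappa> < a * \<mu> * real m / (2 * P)" using a_large by simp
      then show ?thesis by (simp add: \<alpha>_def mult_ac)
    qed
    \<comment> \<open>The factor 16 is made of the required 2, the four modes of the data, and 2
      from the comparison of a coefficient with the \<open>X\<close> norm. The additional 1 in the
      growth bound is reserved for the quadratic error.\<close>
    have C0: "0 \<le> 16 * K * CY" using K CY by simp
    obtain n :: nat where n: "1 \<le> n"
      "1 + 16 * K * CY * (1 + sqrt (real n ^ 4 + (real n)\<^sup>2 + M\<^sup>2)) ^ rY
      \<le> exp ((\<alpha> * (\<mu> * (real n)\<^sup>2 * (real n ^ 4 + (real n)\<^sup>2) / (P * real n ^ 4 + p * ((real n)\<^sup>2 + M\<^sup>2)))
              - \<kappa> * sqrt (real n ^ 4 + (real n)\<^sup>2 + M\<^sup>2)) * T0)"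
      using growth_beats_powers[OF MP(2) pos(2) MP(4) pos(1) MP(1) MP(3) C0 T0 gap] by metis
    define q1 q2 where "q1 = (int n)\<^sup>2" and "q2 = int n"
    define L where "L = line q1 q2"
    have q1: "0 < q1" "q1 \<noteq> 0" using n by (auto simp: q1_def)
    have q1_4: "(real_of_int q1)\<^sup>2 = real n ^ 4" by (simp add: q1_def flip: power_mult)
    \<comment> \<open>The smaller symbol and the larger damping of the two modes, hence a growth
      rate valid for both.\<close>
    define g where "g = \<alpha> * M_symbol \<Omega> \<mu> 3 (L 2) - \<kappa> * norm (freq (L 2))"
    define J where "J = jap (L 2) ^ rY"
    have nf2: "norm (freq (L 2)) = sqrt (real n ^ 4 + (real n)\<^sup>2 + M\<^sup>2)"
      unfolding L_def norm_freq_line q1_4 by (simp add: q2_def M_def mult.commute)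
    have nf12: "norm (freq (L 1)) \<le> norm (freq (L 2))"
      unfolding L_def norm_freq_line by (intro real_sqrt_le_mono add_left_mono power_mono mult_left_mono) auto
    have M2: "M_symbol \<Omega> \<mu> 3 (L 2) = \<mu> * (real n)\<^sup>2 * (real n ^ 4 + (real n)\<^sup>2) / (P * real n ^ 4 + p * ((real n)\<^sup>2 + M\<^sup>2))"
    proof -
      have "4 * \<Omega>\<^sup>2 * (real m * real_of_int 2)\<^sup>2 * ((real_of_int q1)\<^sup>2 + (real_of_int q2)\<^sup>2 + (real m * real_of_int 2)\<^sup>2) + \<mu>\<^sup>2 * real_of_int q2 ^ 4
         = P * real n ^ 4 + p * ((real n)\<^sup>2 + M\<^sup>2)"
        unfolding q1_4 by (simp add: P_def p_def M_def q2_def algebra_simps)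
      then show ?thesis
        unfolding L_def using M_symbol_line[of 2 q1 q2] by (simp add: q1_4 q2_def)
    qed
    have growth_exp: "1 + 16 * K * CY * J \<le> exp (g * T0)"
      using n(2) unfolding g_def M2 J_def jap_def nf2 .
    have J1: "1 \<le> J" unfolding J_def by (rule one_le_power[OF jap_ge_1])
    \<comment> \<open>Opposite values at \<open>j = 1\<close> and \<open>j = 2\<close> become equal
      after the alternating signs; the values at the negatives make the data odd.\<close>
    define c0 where "c0 k = (if k = L 1 then - 1 else if k = - L 1 then 1 else if k = L 2 then 1 else if k = - L 2 then - 1 else 0 :: real)" for k
    have Lneg: "L i \<noteq> - L j" for i j
    proof
      assume "L i = - L j"
      then have "L i $ 1 = - (L j $ 1)" by simp
      then show False using q1 by (simp add: L_def line_def)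
    qed
    have Lneg': "- L i \<noteq> L j" for i j using Lneg[of j i] by metis
    have L12: "L i = L j \<longleftrightarrow> i = j" for i j by (simp add: L_def)
    have c0_odd: "c0 (- k) = - c0 k" for k
      using Lneg Lneg' L12 by (auto simp: c0_def minus_equation_iff[of k])
    have c0_le: "\<bar>c0 k\<bar> \<le> 1" for k by (simp add: c0_def)
    have c0_L: "c0 (L j) = (if j = 1 then - 1 else if j = 2 then 1 else 0)" for j
      using Lneg L12 by (simp add: c0_def)
    define F where "F = {L 1, - L 1, L 2, - L 2}"
    have F: "finite F" "card F \<le> 4" by (auto simp: F_def card_insert_if)
    have c0_F: "c0 k = 0" if "k \<notin> F" for k using that by (simp add: c0_def F_def)
    define w where "w = weight (L 1) 0 + weight (L 2) 0"
    have w1: "1 \<le> w" using weight_ge_1[of 0 "L 1"] weight_pos[of "L 2" 0] pos T0 T1 unfolding w_def by linarith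
    have c0_w: "weight k 0 * \<bar>c0 k\<bar> \<le> w" for k
    proof (cases "k \<in> F")
      case True
      then have "weight k 0 \<le> w"
        using weight_pos[of "L 1" 0] weight_pos[of "L 2" 0] by (auto simp: F_def w_def)
      moreover have "weight k 0 * \<bar>c0 k\<bar> \<le> weight k 0 * 1"
        using c0_le weight_pos[of k 0] by (intro mult_left_mono) auto
      ultimately show ?thesis by linarith
    next
      case False
      then show ?thesis using c0_F w1 by simp
    qed
    define Q where "Q = quad_const"
    have Q0: "0 \<le> Q" unfolding Q_def by (rule quad_const_nonneg)
    \<comment> \<open>The first entry keeps the data small and the quadratic error below
      \<open>\<epsilon>\<close>; adding 1 protects against \<open>Q = 0\<close>. The second keeps
      the \<open>Y\<close> norm of the data within the bound fixed beforehand.\<close>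
    define \<epsilon> where "\<epsilon> = min (\<kappa> / (32 * Q * w\<^sup>2 + 1)) (1 / (4 * J))"
    have Qw: "0 < 32 * Q * w\<^sup>2 + 1" using Q0 by (intro add_nonneg_pos mult_nonneg_nonneg) auto
    have \<epsilon>: "0 < \<epsilon>" "\<epsilon> * (4 * J) \<le> 1" "32 * Q * w\<^sup>2 * \<epsilon> \<le> \<kappa>"
    proof -
      show e0: "0 < \<epsilon>" using pos J1 Qw by (simp add: \<epsilon>_def)
      have "\<epsilon> \<le> 1 / (4 * J)" by (simp add: \<epsilon>_def)
      then show "\<epsilon> * (4 * J) \<le> 1" using J1 by (simp add: pos_le_divide_eq)
      have "\<epsilon> \<le> \<kappa> / (32 * Q * w\<^sup>2 + 1)" by (simp add: \<epsilon>_def)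
      then have "\<epsilon> * (32 * Q * w\<^sup>2 + 1) \<le> \<kappa>" using Qw by (simp only: pos_le_divide_eq)
      then show "32 * Q * w\<^sup>2 * \<epsilon> \<le> \<kappa>" using e0 by (simp add: algebra_simps)
    qed
    define \<delta> where "\<delta> = \<epsilon> * w"
    define b0 where "b0 k = \<epsilon> * c0 k" for k
    have \<delta>: "0 \<le> \<delta>" "32 * quad_const * \<delta> \<le> \<kappa>"
    proof -
      show "0 \<le> \<delta>" using \<epsilon> w1 by (simp add: \<delta>_def)
      have "32 * Q * \<epsilon> * (w * 1) \<le> 32 * Q * \<epsilon> * (w * w)"
        using Q0 \<epsilon> w1 by (intro mult_left_mono mult_nonneg_nonneg) auto
      then show "32 * quad_const * \<delta> \<le> \<kappa>"
        using \<epsilon>(3) by (simp add: \<delta>_def Q_def power2_eq_square mult_ac)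
    qed
    have b0_odd: "b0 (- k) = - b0 k" for k by (simp add: b0_def c0_odd)
    have b0_w: "weight k 0 * \<bar>b0 k\<bar> \<le> \<delta>" for k
      using mult_left_mono[OF c0_w[of k], of \<epsilon>] \<epsilon> by (simp add: b0_def \<delta>_def abs_mult mult_ac)
    obtain b where b: "\<And>k. b k 0 = b0 k" "\<And>k t. b (- k) t = - b k t"
      "\<And>k t. t \<in> {0..T1} \<Longrightarrow> \<bar>b k t\<bar> \<le> 2 * \<delta> / weight k t"
      "\<And>k t. t \<in> {0..T1} \<Longrightarrow>
        (b k has_vector_derivative (forcing (\<lambda>l. b l t) k - \<kappa> * norm (freq k) * b k t)) (at t within {0..T1})"
      using small_data_solution[OF b0_odd \<delta> b0_w] by blast
    define f where "f = series (\<lambda>k. A k + b k 0) 0"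
    define \<Theta> where "\<Theta> t = series (\<lambda>k. A k + b k t) 0" for t
    have T0in: "T0 \<in> {0..T1}" "0 \<in> {0..T1}" using T0 T1 by auto
    have b_sum: "weighted_summable rX (\<lambda>k. b k t)" if t: "t \<in> {0..T1}" for t
    proof (rule weighted_summable_mono)
      show "weighted_summable rX (\<lambda>k. 2 * \<delta> / jap k ^ r)" by (rule weighted_summable_jap) (simp add: r_def)
      show "\<bar>b k t\<bar> \<le> 2 * \<delta> / jap k ^ r" for k
        using b(3)[OF t, of k] divide_left_mono[OF weight_ge_jap[of t k], of "2 * \<delta>"] \<delta>(1) t jap_pos[of k] weight_pos[of k t] by force
    qed
    note A_ws = weighted_summable_base[of _ a m, folded A_def]
    have diff: "(\<lambda>x. \<Theta> t x - \<Theta>0 x) = series (\<lambda>k. b k t) 0" if t: "t \<in> {0..T1}" for t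
      unfolding \<Theta>_def \<Theta>0
      using series_add[OF weighted_summable_imp_summable[OF A_ws[of 0]] weighted_summable_imp_summable[OF b_sum[OF t]]] by (simp add: fun_eq_iff)
    have diff0: "(\<lambda>x. f x - \<Theta>0 x) = series b0 0"
      using diff[OF T0in(2)] by (simp add: f_def \<Theta>_def b(1))
    have b0_ws: "weighted_summable rY b0"
      by (rule weighted_summable_finite, rule finite_subset[OF _ F(1)]) (use c0_F in \<open>auto simp: b0_def\<close>)
    have b0_sum: "weighted_sum rY b0 \<le> 4 * J * \<epsilon>"
    proof -
      have "((\<lambda>k. jap k ^ rY * \<bar>b0 k\<bar>) has_sum (\<Sum>k\<in>F. jap k ^ rY * \<bar>b0 k\<bar>)) UNIV"
        by (rule has_sum_finite_neutralI[OF F(1)]) (use c0_F in \<open>auto simp: b0_def\<close>)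
      then have "weighted_sum rY b0 = (\<Sum>k\<in>F. jap k ^ rY * \<bar>b0 k\<bar>)"
        unfolding weighted_sum_def by (rule infsumI)
      also have "\<dots> \<le> of_nat (card F) * (J * \<epsilon>)"
      proof (rule sum_bounded_above)
        fix k assume k: "k \<in> F"
        have "jap (L 1) \<le> jap (L 2)" using nf12 by (simp add: jap_def)
        then have "jap k \<le> jap (L 2)" using k by (auto simp: F_def)
        then have "jap k ^ rY \<le> J" unfolding J_def using jap_pos[of k] by (intro power_mono) auto
        moreover have "\<bar>b0 k\<bar> \<le> \<epsilon>"
          using mult_left_mono[OF c0_le[of k], of \<epsilon>] \<epsilon> by (simp add: b0_def abs_mult)
        ultimately show "jap k ^ rY * \<bar>b0 k\<bar> \<le> J * \<epsilon>" using J1 by (intro mult_mono) auto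
      qed
      also have "\<dots> \<le> 4 * (J * \<epsilon>)" using F(2) J1 \<epsilon> by (intro mult_right_mono) auto
      finally show ?thesis by simp
    qed
    have diffY: "series b0 0 \<in> sobolev Y" "sobolev_norm Y (series b0 0) \<le> CY * (4 * J * \<epsilon>)"
    proof -
      show "series b0 0 \<in> sobolev Y" by (rule Y_mem[OF b0_ws])
      show "sobolev_norm Y (series b0 0) \<le> CY * (4 * J * \<epsilon>)"
        using Y_norm[OF b0_ws] mult_left_mono[OF b0_sum, of CY] CY by linarith
    qed
    have b0_s: "b0 summable_on UNIV" by (rule weighted_summable_imp_summable[OF b0_ws])
    have fc0: "cmod (fourier_coeff (series b0 0) (L 1)) = \<epsilon>"
      using \<epsilon> unfolding fourier_coeff_series[OF b0_s] b0_odd by (simp add: b0_def c0_L complex_norm)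
    have Y_pos: "0 < sobolev_norm Y (series b0 0)"
      using fourier_coeff_le_sobolev_norm[OF spaces(2) diffY(1), of "L 1"] fc0 \<epsilon> by linarith
    have "\<epsilon> * exp (g * T0) - 32 / 3 * quad_const * \<delta>\<^sup>2 / \<kappa> \<le> - b (L 1) T0"
      unfolding L_def
    proof (rule growth[where g = g])
      show "b (line q1 q2 j) 0 = (if j = 1 then - \<epsilon> else if j = 2 then \<epsilon> else 0)" for j
        using c0_L[of j] by (simp add: b(1) b0_def L_def)
      show "g + \<kappa> * norm (freq (line q1 q2 1)) \<le> a * real m / 2 * M_symbol \<Omega> \<mu> 3 (line q1 q2 2)"
        using mult_left_mono[OF nf12, of \<kappa>] pos by (simp add: g_def L_def \<alpha>_def)
      show "g + \<kappa> * norm (freq (line q1 q2 2)) \<le> a * real m / 2 * M_symbol \<Omega> \<mu> 3 (line q1 q2 1)"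
        using mult_left_mono[OF M_symbol_line_antimono[OF q1(2), of q2], of \<alpha>] MP by (simp add: g_def L_def \<alpha>_def)
    qed (use q1 \<epsilon> \<delta> b(3,4) T0in in auto)
    \<comment> \<open>The error is quadratic in \<open>\<epsilon>\<close>; one of the two factors is
      used up by the smallness condition.\<close>
    moreover have "32 / 3 * quad_const * \<delta>\<^sup>2 / \<kappa> \<le> \<epsilon>"
    proof -
      have "32 / 3 * quad_const * \<delta>\<^sup>2 = (32 * Q * w\<^sup>2 * \<epsilon>) * (\<epsilon> / 3)"
        by (simp add: Q_def \<delta>_def power2_eq_square)
      also have "\<dots> \<le> \<kappa> * \<epsilon>" using \<epsilon> pos by (intro mult_mono) auto
      finally show ?thesis using pos by (simp add: pos_divide_le_eq mult.commute)
    qed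
    ultimately have "\<epsilon> * exp (g * T0) - \<epsilon> \<le> - b (L 1) T0" by linarith
    moreover have "\<epsilon> * (1 + 16 * K * CY * J) \<le> \<epsilon> * exp (g * T0)"
      using growth_exp \<epsilon> by (intro mult_left_mono) auto
    ultimately have big: "16 * K * CY * J * \<epsilon> \<le> \<bar>b (L 1) T0\<bar>" by (simp add: algebra_simps)
    have bs: "(\<lambda>k. b k T0) summable_on UNIV" by (rule weighted_summable_imp_summable[OF b_sum[OF T0in(1)]])
    have "cmod (fourier_coeff (series (\<lambda>k. b k T0) 0) (L 1)) = \<bar>b (L 1) T0\<bar>"
      unfolding fourier_coeff_series[OF bs] b(2) by (simp add: complex_norm)
    then have bigX: "16 * K * CY * J * \<epsilon> \<le> 2 * sobolev_norm X (series (\<lambda>k. b k T0) 0)"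
      using fourier_coeff_le_sobolev_norm[OF spaces(1) X_mem[OF b_sum[OF T0in(1)]], of "L 1"] big by linarith
    have main: "2 * K * sobolev_norm Y (series b0 0) \<le> sobolev_norm X (series (\<lambda>k. b k T0) 0)"
    proof -
      have "2 * K * sobolev_norm Y (series b0 0) \<le> 2 * K * (CY * (4 * J * \<epsilon>))"
        using diffY(2) K by (intro mult_left_mono) auto
      also have "\<dots> = (16 * K * CY * J * \<epsilon>) / 2" by simp
      finally show ?thesis using bigX by linarith
    qed
    have fY: "f \<in> sobolev Y" "sobolev_norm Y f \<le> CY * (weighted_sum rY A + 1)"
    proof -
      have f: "f = series (\<lambda>k. A k + b0 k) 0" by (simp add: f_def b(1))
      show "f \<in> sobolev Y" unfolding f by (intro Y_mem weighted_summable_add A_ws b0_ws)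
      have "weighted_sum rY (\<lambda>k. A k + b0 k) \<le> weighted_sum rY A + 1"
        using weighted_summable_add(2)[OF A_ws b0_ws] b0_sum \<epsilon>(2) by (simp add: mult_ac)
      then have "CY * weighted_sum rY (\<lambda>k. A k + b0 k) \<le> CY * (weighted_sum rY A + 1)"
        using CY by (intro mult_left_mono) auto
      then show "sobolev_norm Y f \<le> CY * (weighted_sum rY A + 1)"
        unfolding f using Y_norm[OF weighted_summable_add(1)[OF A_ws b0_ws]] by linarith
    qed
    have not_AE: "\<not> (AE x in torus. f x = \<Theta>0 x)"
    proof
      assume "AE x in torus. f x = \<Theta>0 x"
      then have "AE x in torus. series b0 0 x = 0"
        by eventually_elim (use diff0 in \<open>metis diff_self\<close>)
      then have "fourier_coeff (series b0 0) (L 1) = fourier_coeff (\<lambda>_. 0) (L 1)"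
        by (rule fourier_coeff_cong_AE) (auto intro: continuous_measurable_torus continuous_series b0_s)
      then show False using fc0 \<epsilon> by (simp add: fourier_coeff_def)
    qed
    have "weak_solution \<kappa> \<mu> \<Omega> S X T f \<Theta>" if "0 < T" "T \<le> T1" for T
      unfolding S_def f_def \<Theta>_def A_def
      by (rule perturbed_weak_solution[OF spaces(1) CX that _ X_mem X_norm b(2,3,4)]) (simp_all add: r_def)
    then show "\<exists>f \<Theta>. f \<in> sobolev Y \<and> sobolev_norm Y f \<le> CY * (weighted_sum rY A + 1) \<and>
      (\<forall>T. 0 < T \<and> T \<le> T1 \<longrightarrow> weak_solution \<kappa> \<mu> \<Omega> S X T f \<Theta>) \<and>
      \<not> (AE x in torus. f x = \<Theta>0 x) \<and> 0 < sobolev_norm Y (\<lambda>x. f x - \<Theta>0 x) \<and>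
      2 * K * sobolev_norm Y (\<lambda>x. f x - \<Theta>0 x) \<le> sobolev_norm X (\<lambda>x. \<Theta> T0 x - \<Theta>0 x)"
      using fY not_AE Y_pos main by (intro exI[of _ f] exI[of _ \<Theta>]) (simp add: diff0 diff[OF T0in(1)])
  qed
qed

text \<open>The zero sequence is an admissible perturbation, so this is the case
  \<open>b = 0\<close>, \<open>N = 0\<close> of \<open>perturbed_weak_solution\<close>.\<close>

lemma steady_state:
  fixes \<kappa> \<mu> \<Omega> a T :: real and m :: nat and X :: sobolev_index
  assumes X: "admissible X" and pos: "\<kappa> > 0" "\<mu> > 0" "\<Omega> > 0" "a > 0" "T > 0" and m: "m \<ge> 1"
  defines "\<Theta>0 \<equiv> (\<lambda>x::real^3. a * sin (real m * x $ 3))"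
  shows "\<Theta>0 \<in> sobolev X"
    and "weak_solution \<kappa> \<mu> \<Omega> (\<lambda>x. \<kappa> * a * real m * sin (real m * x $ 3)) X T \<Theta>0 (\<lambda>t. \<Theta>0)"
proof -
  obtain r C where C: "0 < C" and X_mem: "\<And>b. weighted_summable r b \<Longrightarrow> series b 0 \<in> sobolev X"
    and X_norm: "\<And>b. weighted_summable r b \<Longrightarrow> sobolev_norm X (series b 0) \<le> C * weighted_sum r b"
    using sobolev_series[OF X] by metis
  interpret perturbation \<kappa> \<mu> \<Omega> a T m "r + 7"
    using pos m by unfold_locales auto
  have \<Theta>0: "\<Theta>0 = series (base_coeff a m) 0"
    by (simp add: \<Theta>0_def series_base fun_eq_iff)
  show "\<Theta>0 \<in> sobolev X"
    unfolding \<Theta>0 by (intro X_mem weighted_summable_base)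
  have f0: "forcing (\<lambda>l. 0) k = 0" for k
    by (simp add: forcing_def coupling_def advection_def)
  have "weak_solution \<kappa> \<mu> \<Omega> (\<lambda>x. \<kappa> * a * real m * sin (real m * x $ 3)) X T
    (series (\<lambda>k. base_coeff a m k + (\<lambda>_ _. 0) k (0::real)) 0) (\<lambda>t. series (\<lambda>k. base_coeff a m k + (\<lambda>_ _. 0) k t) 0)"
    by (rule perturbed_weak_solution[OF X C pos(5) order_refl _ X_mem X_norm, where N = 0]) (simp_all add: f0)
  then show "weak_solution \<kappa> \<mu> \<Omega> (\<lambda>x. \<kappa> * a * real m * sin (real m * x $ 3)) X T \<Theta>0 (\<lambda>t. \<Theta>0)"
    unfolding \<Theta>0 by simp
qed

lemma weak_solution_in_sobolev:
  "weak_solution \<kappa> \<mu> \<Omega> S X T f \<Theta> \<Longrightarrow> t \<in> {0..T} \<Longrightarrow> \<Theta> t \<in> sobolev X"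
  by (simp add: weak_solution_def)

theorem theorem5p2:
  fixes \<kappa> \<mu> \<Omega> a :: real and m :: nat and X Y :: sobolev_index
    and \<Theta>01 S :: "real^3 \<Rightarrow> real"
  assumes spaces: "admissible X" "admissible Y"
    and incl: "sobolev Y \<subseteq> sobolev X" "sobolev X \<subseteq> sobolev (Wkp 1 4)"
    and pos: "\<kappa> > 0" "\<mu> > 0" "\<Omega> > 0" "a > 0"
    and m: "m \<ge> 1"
    and a_large: "\<kappa> < a * \<mu> * real m / (2 ^ 5 * \<Omega>\<^sup>2 * (real m)\<^sup>2 + 2 * \<mu>\<^sup>2)"
    and \<Theta>01: "\<Theta>01 = (\<lambda>x. a * sin (real m * x $ 3))"
    and S: "S = (\<lambda>x. \<kappa> * a * real m * sin (real m * x $ 3))"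
  shows "\<Theta>01 \<in> sobolev Y \<and>
         (\<forall>T>0. weak_solution \<kappa> \<mu> \<Omega> S X T \<Theta>01 (\<lambda>t. \<Theta>01)) \<and>
         (\<forall>T>0. \<forall>K>0. \<exists>\<Theta>02\<in>sobolev Y. \<exists>\<Theta>2.
            \<not> (AE x in torus. \<Theta>02 x = \<Theta>01 x) \<and>
            weak_solution \<kappa> \<mu> \<Omega> S X T \<Theta>02 \<Theta>2 \<and>
            (SUP t\<in>{0..T}. ennreal (sobolev_norm X (\<lambda>x. \<Theta>2 t x - \<Theta>01 x)))
              \<ge> ennreal (2 * K * sobolev_norm Y (\<lambda>x. \<Theta>02 x - \<Theta>01 x))) \<and>
         locally_Lipschitz_ill_posed \<kappa> \<mu> \<Omega> S X Y"
proof (intro conjI allI impI)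
  show memY: "\<Theta>01 \<in> sobolev Y"
    unfolding \<Theta>01 by (rule steady_state(1)[OF spaces(2) pos zero_less_one m])
  show steady: "weak_solution \<kappa> \<mu> \<Omega> S X T \<Theta>01 (\<lambda>t. \<Theta>01)" if "0 < T" for T
    unfolding \<Theta>01 S by (rule steady_state(2)[OF spaces(1) pos that m])
  obtain R where R': "\<forall>T0 T1 K. 0 < T0 \<and> T0 \<le> T1 \<and> 0 < K \<longrightarrow> (\<exists>f \<Theta>. f \<in> sobolev Y \<and> sobolev_norm Y f \<le> R \<and>
      (\<forall>T. 0 < T \<and> T \<le> T1 \<longrightarrow> weak_solution \<kappa> \<mu> \<Omega> S X T f \<Theta>) \<and>
      \<not> (AE x in torus. f x = \<Theta>01 x) \<and> 0 < sobolev_norm Y (\<lambda>x. f x - \<Theta>01 x) \<and>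
      2 * K * sobolev_norm Y (\<lambda>x. f x - \<Theta>01 x) \<le> sobolev_norm X (\<lambda>x. \<Theta> T0 x - \<Theta>01 x))"
    using unstable_perturbation[OF spaces pos m a_large] unfolding \<Theta>01 S by blast
  note R = R'[rule_format, OF conjI[OF _ conjI]]
  show "\<exists>\<Theta>02\<in>sobolev Y. \<exists>\<Theta>2.
            \<not> (AE x in torus. \<Theta>02 x = \<Theta>01 x) \<and>
            weak_solution \<kappa> \<mu> \<Omega> S X T \<Theta>02 \<Theta>2 \<and>
            (SUP t\<in>{0..T}. ennreal (sobolev_norm X (\<lambda>x. \<Theta>2 t x - \<Theta>01 x)))
              \<ge> ennreal (2 * K * sobolev_norm Y (\<lambda>x. \<Theta>02 x - \<Theta>01 x))"
    if T: "0 < T" and K: "0 < K" for T K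
  proof -
    obtain f \<Theta> where f: "f \<in> sobolev Y" "\<not> (AE x in torus. f x = \<Theta>01 x)"
      and ws: "\<forall>T'. 0 < T' \<and> T' \<le> T \<longrightarrow> weak_solution \<kappa> \<mu> \<Omega> S X T' f \<Theta>"
      and le: "2 * K * sobolev_norm Y (\<lambda>x. f x - \<Theta>01 x) \<le> sobolev_norm X (\<lambda>x. \<Theta> T x - \<Theta>01 x)"
      using R[OF T order_refl K] by auto
    have "ennreal (2 * K * sobolev_norm Y (\<lambda>x. f x - \<Theta>01 x))
        \<le> (SUP t\<in>{0..T}. ennreal (sobolev_norm X (\<lambda>x. \<Theta> t x - \<Theta>01 x)))"
      \<comment> \<open>Comparison time and existence time both equal \<open>T\<close>, so the
        supremum is bounded below by its value at the end point.\<close>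
      by (rule SUP_upper2[of T]) (use T le in \<open>auto intro: ennreal_leI\<close>)
    then show ?thesis using f ws T by (intro bexI[of _ f] exI[of _ \<Theta>]) auto
  qed
  show "locally_Lipschitz_ill_posed \<kappa> \<mu> \<Omega> S X Y"
  proof
    assume "locally_Lipschitz_well_posed \<kappa> \<mu> \<Omega> S X Y"
    then obtain Tf Kf :: "real \<times> real \<Rightarrow> real" where
      cont: "continuous_on ({0..} \<times> {0..}) Tf" "continuous_on ({0..} \<times> {0..}) Kf"
      and TK_pos: "\<forall>r\<in>{0..} \<times> {0..}. 0 < Tf r \<and> 0 < Kf r"
      and wp: "\<forall>f1\<in>sobolev Y. \<forall>f2\<in>sobolev Y.
           let r = (sobolev_norm Y f1, sobolev_norm Y f2) in
           \<exists>\<Theta>1 \<Theta>2.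
             unique_weak_solution \<kappa> \<mu> \<Omega> S X (Tf r) f1 \<Theta>1 \<and>
             unique_weak_solution \<kappa> \<mu> \<Omega> S X (Tf r) f2 \<Theta>2 \<and>
             (\<forall>t\<in>{0..Tf r}. sobolev_norm X (\<lambda>x. \<Theta>1 t x - \<Theta>2 t x)
                             \<le> Kf r * sobolev_norm Y (\<lambda>x. f1 x - f2 x))"
      unfolding locally_Lipschitz_well_posed_def by blast
    define n0 where "n0 = sobolev_norm Y \<Theta>01"
    \<comment> \<open>The perturbed data have norm at most \<open>R\<close>, while the norm of the
      steady state is a fixed number; \<open>max 0 R\<close> keeps the set nonempty.\<close>
    define C where "C = {0..max 0 R} \<times> {n0}"
    have n0: "0 \<le> n0" unfolding n0_def by (rule sobolev_norm_nonneg[OF spaces(2) memY])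
    have CC: "compact C" "C \<noteq> {}" by (auto simp: C_def intro: compact_Times)
    have Csub: "C \<subseteq> {0..} \<times> {0..}" using n0 by (auto simp: C_def)
    \<comment> \<open>The least time lies in every interval that well-posedness can offer and serves
      for the comparison; the perturbation has to exist up to the greatest time, and the greatest
      value of \<open>Kf\<close> is the constant to be defeated.\<close>
    obtain r0 where r0: "r0 \<in> C" "\<And>r. r \<in> C \<Longrightarrow> Tf r0 \<le> Tf r"
      using continuous_attains_inf[OF CC continuous_on_subset[OF cont(1) Csub]] by blast
    obtain r1 where r1: "r1 \<in> C" "\<And>r. r \<in> C \<Longrightarrow> Tf r \<le> Tf r1"
      using continuous_attains_sup[OF CC continuous_on_subset[OF cont(1) Csub]] by blast
    obtain r2 where r2: "r2 \<in> C" "\<And>r. r \<in> C \<Longrightarrow> Kf r \<le> Kf r2"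
      using continuous_attains_sup[OF CC continuous_on_subset[OF cont(2) Csub]] by blast
    have pos0: "0 < Tf r0" "0 < Kf r2" using TK_pos r0(1) r2(1) Csub by auto
    obtain f \<Theta> where f: "f \<in> sobolev Y" "sobolev_norm Y f \<le> R"
      and ws: "\<forall>T. 0 < T \<and> T \<le> Tf r1 \<longrightarrow> weak_solution \<kappa> \<mu> \<Omega> S X T f \<Theta>"
      and d: "0 < sobolev_norm Y (\<lambda>x. f x - \<Theta>01 x)"
      and le: "2 * Kf r2 * sobolev_norm Y (\<lambda>x. f x - \<Theta>01 x) \<le> sobolev_norm X (\<lambda>x. \<Theta> (Tf r0) x - \<Theta>01 x)"
      using R[OF pos0(1) r1(2)[OF r0(1)] pos0(2)] by auto
    define \<rho> where "\<rho> = (sobolev_norm Y f, n0)"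
    have \<rho>: "\<rho> \<in> C" using f sobolev_norm_nonneg[OF spaces(2) f(1)] by (auto simp: \<rho>_def C_def)
    obtain \<Theta>1 \<Theta>2 where
      u1: "unique_weak_solution \<kappa> \<mu> \<Omega> S X (Tf \<rho>) f \<Theta>1" and u2: "unique_weak_solution \<kappa> \<mu> \<Omega> S X (Tf \<rho>) \<Theta>01 \<Theta>2"
      and Lip: "\<forall>t\<in>{0..Tf \<rho>}. sobolev_norm X (\<lambda>x. \<Theta>1 t x - \<Theta>2 t x) \<le> Kf \<rho> * sobolev_norm Y (\<lambda>x. f x - \<Theta>01 x)"
      using wp f(1) memY unfolding \<rho>_def n0_def Let_def by blast
    have T\<rho>: "0 < Tf \<rho>" "Tf \<rho> \<le> Tf r1" "Tf r0 \<in> {0..Tf \<rho>}"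
      using r0(2)[OF \<rho>] r1(2)[OF \<rho>] pos0 by auto
    let ?t = "Tf r0"
    have w: "weak_solution \<kappa> \<mu> \<Omega> S X (Tf \<rho>) f \<Theta>" "weak_solution \<kappa> \<mu> \<Omega> S X (Tf \<rho>) \<Theta>01 (\<lambda>t. \<Theta>01)"
      using ws T\<rho> steady by auto
    \<comment> \<open>Uniqueness identifies the solutions offered by well-posedness with the
      constructed one and with the steady state.\<close>
    have AE: "AE x in torus. \<Theta> ?t x = \<Theta>1 ?t x" "AE x in torus. \<Theta>01 x = \<Theta>2 ?t x"
      using u1[unfolded unique_weak_solution_def, THEN conjunct2, rule_format, OF w(1) T\<rho>(3)]
        u2[unfolded unique_weak_solution_def, THEN conjunct2, rule_format, OF w(2) T\<rho>(3)] .
    have mem: "\<Theta> ?t \<in> sobolev X" "\<Theta>1 ?t \<in> sobolev X" "\<Theta>01 \<in> sobolev X" "\<Theta>2 ?t \<in> sobolev X"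
      using weak_solution_in_sobolev[OF _ T\<rho>(3)] u1 u2 w unfolding unique_weak_solution_def by blast+
    have meas: "h \<in> borel_measurable torus" if "h \<in> sobolev X" for h
      using sobolev_imp_Lp[OF spaces(1) that] Lp_measurable by blast
    have "sobolev_norm X (\<lambda>x. \<Theta> ?t x - \<Theta>01 x) = sobolev_norm X (\<lambda>x. \<Theta>1 ?t x - \<Theta>2 ?t x)"
    proof (rule sobolev_norm_cong_AE)
      show "AE x in torus. \<Theta> ?t x - \<Theta>01 x = \<Theta>1 ?t x - \<Theta>2 ?t x"
        using AE by eventually_elim simp
    qed (intro borel_measurable_diff meas mem)+
    also have "\<dots> \<le> Kf \<rho> * sobolev_norm Y (\<lambda>x. f x - \<Theta>01 x)"
      using Lip T\<rho>(3) by blast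
    also have "\<dots> \<le> Kf r2 * sobolev_norm Y (\<lambda>x. f x - \<Theta>01 x)"
      using r2(2)[OF \<rho>] d by (intro mult_right_mono) auto
    \<comment> \<open>The strictly positive initial distance turns the factor 2 into a
      contradiction.\<close>
    finally have "2 * Kf r2 * sobolev_norm Y (\<lambda>x. f x - \<Theta>01 x) \<le> Kf r2 * sobolev_norm Y (\<lambda>x. f x - \<Theta>01 x)"
      using le by linarith
    moreover have "0 < Kf r2 * sobolev_norm Y (\<lambda>x. f x - \<Theta>01 x)" using pos0(2) d by simp
    ultimately show False by linarith
  qed
qed

end
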